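(* Let $M>0$ and $s>\frac12$. Suppose that Assumptions 1, 2 and 3 of the context hold (with $p=q=2$) and that the spectral density $f$ belongs to $F^{s}_{2,2}(M)$. Let $j_1=j_1(n)$ be the largest integer such that $2^{j_1}\le n^{\frac{1}{2s+1}}$. Then, with probability tending to one as $n\to+\infty$, the linear information projection estimator $f_{j_1(n),\widehat\theta_n}$ exists, i.e. there is $\widehat\theta_n\in\mathbb{R}^{\#\Lambda_{j_1}}$ with $$\langle f_{j_1,\widehat\theta_n},\psi_{j,k}\rangle=\widehat\beta_{j,k}\quad\text{for all }(j,k)\in\Lambda_{j_1},$$ and it satisfies $$\Delta\left(f;f_{j_1(n),\widehat\theta_n}\right)=\mathcal{O}_p\left(n^{-\frac{2s}{2s+1}}\right).$$ Moreover, the convergence is uniform over the class $F^{s}_{2,2}(M)$ in the sense that $$\lim_{K\to+\infty}\limsup_{n\to+\infty}\sup_{f\in F^{s}_{2,2}(M)}\mathbb{P}\left(n^{\frac{2s}{2s+1}}\Delta\left(f;f_{j_1(n),\widehat\theta_n}\right)>K\right)=0.$$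
   Context: **Process.** Assumption 1: $(X_1,\dots,X_n)$ is an $n$-sample drawn from a stationary sequence $(X_t)_{t\in\mathbb{N}}$ of (real) Gaussian random variables. Let $\rho(h)=\mathrm{cov}(X_t,X_{t+h})$, $h\in\mathbb{Z}$; the spectral density is $f(\omega)=\frac{1}{2\pi}\sum_{h\in\mathbb{Z}}\rho(h)e^{i2\pi\omega h}$, $\omega\in[0,1]$. Assumption 2: $\rho$ is non-negative definite and there are constants $0<C_1,C_2<+\infty$ with $\sum_{h}|\rho(h)|=C_1$ and $\sum_h|h\rho^2(h)|=C_2$. In a supremum over $f$, $\mathbb{P}$ is the law of the process with spectral density $f$. The periodogram is $I_n(\omega)=\frac{1}{2\pi n}\sum_{t=1}^n\sum_{t'=1}^n(X_t-\overline X)(X_{t'}-\overline X)^{*}e^{i2\pi\omega(t-t')}$, $\overline X=\frac1n\sum_{t=1}^nX_t$, where $^*$ is conjugate transpose. **Wavelets.** $\phi,\psi$ are the scaling function and wavelet generated by an orthonormal multiresolution decomposition of $L_2([0,1])$ (periodic functions), compactly supported, with $\|\phi\|_\infty,\|\psi\|_\infty<\infty$; $\phi_{j,k}(\omega)=2^{j/2}\phi(2^j\omega-k)$, $\psi_{j,k}(\omega)=2^{j/2}\psi(2^j\omega-k)$, so that for any integer $j_0\ge0$ the functions $\phi_{j_0,k}$ ($0\le k\le2^{j_0}-1$) and $\psi_{j,k}$ ($j\ge j_0$, $0\le k\le 2^j-1$) form an orthonormal basis of $L_2([0,1])$. $\psi$ has $m$ vanishing moments and $0<s<m$ throughout. $\langle\cdot,\cdot\rangle$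 is the $L_2([0,1])$ inner product. Here the coarse level is $j_0=0$. Convention: $\psi_{j_0-1,k}$ denotes $\phi_{j_0,k}$, $0\le k\le 2^{j_0}-1$. $\Lambda_{j_1}=\{(j,k):j_0-1\le j<j_1,\ 0\le k\le 2^j-1\}$, where for $j=j_0-1$ the range of $k$ is $0\le k\le2^{j_0}-1$; thus $\#\Lambda_{j_1}=2^{j_1}$. **Function classes.** For $1\le p,q\le\infty$ and $s^*=s+\frac12-\frac1p\ge0$, $$\|g\|_{s,p,q}=\Big(\sum_{k=0}^{2^{j_0}-1}|\langle g,\phi_{j_0,k}\rangle|^p\Big)^{1/p}+\Big(\sum_{j\ge j_0}2^{js^*q}\Big(\sum_{k=0}^{2^j-1}|\langle g,\psi_{j,k}\rangle|^p\Big)^{q/p}\Big)^{1/q}$$ (sums replaced by maxima when $p$ or $q$ is $\infty$), and $F^s_{p,q}(M)=\{f=\exp(g):\|g\|_{s,p,q}\le M\}$. Assumption 3 (for $M>0$, $1\le p\le2$, $s>1/p$): for $f\in F^s_{p,q}(M)$ put $\rho_f(h)=\int_0^1f(\omega)e^{-i2\pi\omega h}d\omega$, $C_1(f)=\sum_h|\rho_f(h)|$, $C_2(f)=\sum_h|h\rho_f^2(h)|$. The wavelet basis is such that there is a constant $M_*$ with $C_1(f)\le M_*$ and $C_2(f)\le M_*$ for all $f\in F^s_{p,q}(M)$. **Estimator.** For $\theta\in\mathbb{R}^{\#\Lambda_{j_1}}$, $f_{j_1,\theta}=\exp\big(\sum_{(j,k)\in\Lambda_{j_1}}\theta_{j,k}\psi_{j,k}\big)$.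 The empirical coefficients are $\widehat\beta_{j,k}=\int_0^1I_n(\omega)\psi_{j,k}(\omega)d\omega$, $(j,k)\in\Lambda_{j_1}$. The linear estimator $f_{j_1,\widehat\theta_n}$ is the function with $\langle f_{j_1,\widehat\theta_n},\psi_{j,k}\rangle=\widehat\beta_{j,k}$ for all $(j,k)\in\Lambda_{j_1}$, when such $\widehat\theta_n$ exists; probabilities involving it are understood on the event that it exists. **Loss.** $\Delta(f;\widehat f)=\int_0^1\big(f\log(f/\widehat f)-f+\widehat f\big)d\mu$, $\mu$ Lebesgue measure on $[0,1]$. *)

theory Defs
  imports "HOL-Probability.Probability"
begin

section \<open>The space \<open>L\<^sub>2([0,1])\<close>\<close>

abbreviation unit_leb :: "real measure" where
  "unit_leb \<equiv> lebesgue_on {0..1}"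

definition L2_unit :: "(real \<Rightarrow> real) set" where
  "L2_unit = {g. g \<in> borel_measurable unit_leb \<and> integrable unit_leb (\<lambda>x. (g x)\<^sup>2)}"

definition ip :: "(real \<Rightarrow> real) \<Rightarrow> (real \<Rightarrow> real) \<Rightarrow> real" where
  "ip g h = (\<integral>x. g x * h x \<partial>unit_leb)"

definition L2_dist :: "(real \<Rightarrow> real) \<Rightarrow> (real \<Rightarrow> real) \<Rightarrow> real" where
  "L2_dist g h = sqrt (\<integral>x. (g x - h x)\<^sup>2 \<partial>unit_leb)"

definition orthonormal_family :: "'i set \<Rightarrow> ('i \<Rightarrow> real \<Rightarrow> real) \<Rightarrow> bool" where
  "orthonormal_family I e \<longleftrightarrow>
     (\<forall>i\<in>I. e i \<in> L2_unit) \<and> (\<forall>i\<in>I. \<forall>i'\<in>I. ip (e i) (e i') = (if i = i' then 1 else 0))"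

definition orthonormal_basis :: "'i set \<Rightarrow> ('i \<Rightarrow> real \<Rightarrow> real) \<Rightarrow> bool" where
  "orthonormal_basis I e \<longleftrightarrow> orthonormal_family I e \<and>
     (\<forall>g\<in>L2_unit. \<forall>\<epsilon>>0. \<exists>J c. finite J \<and> J \<subseteq> I \<and>
        L2_dist g (\<lambda>x. \<Sum>i\<in>J. c i * e i x) < \<epsilon>)"


section \<open>Periodic wavelets\<close>

text \<open>
  The mother functions \<open>\<phi>\<close>, \<open>\<psi>\<close> live on the real line; elements of \<open>L\<^sub>2([0,1])\<close> are read as
  1-periodic functions, so the dilate \<open>2\<^bsup>j/2\<^esup> u (2\<^sup>j x - k)\<close> is made 1-periodic by wrapping it
  around. For compactly supported \<open>u\<close> the sum over \<open>l\<close> has finitely many nonzero terms, and it is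
  the plain dilate on \<open>[0,1]\<close> whenever that dilate vanishes outside \<open>[0,1]\<close>.
\<close>

definition dilate :: "(real \<Rightarrow> real) \<Rightarrow> nat \<Rightarrow> nat \<Rightarrow> real \<Rightarrow> real" where
  "dilate u j k x =
     (\<Sum>\<^sub>\<infinity>l\<in>(UNIV::int set). 2 powr (real j / 2) * u (2 ^ j * (x + of_int l) - real k))"

text \<open>The convention that \<open>\<psi>\<close> at level \<open>j0 - 1\<close> means \<open>\<phi>\<close> at level \<open>j0\<close>; since \<open>j0 - 1\<close> may be
  \<open>-1\<close>, levels are integers.\<close>

definition wavelet :: "(real \<Rightarrow> real) \<Rightarrow> (real \<Rightarrow> real) \<Rightarrow> nat \<Rightarrow> int \<times> nat \<Rightarrow> real \<Rightarrow> real" where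
  "wavelet \<phi> \<psi> j0 = (\<lambda>(j, k). if j < int j0 then dilate \<phi> j0 k else dilate \<psi> (nat j) k)"

definition full_index :: "nat \<Rightarrow> (int \<times> nat) set" where
  "full_index j0 = {(j, k). int j0 - 1 \<le> j \<and> k < 2 ^ nat (max j (int j0))}"

definition trunc_index :: "nat \<Rightarrow> nat \<Rightarrow> (int \<times> nat) set" where
  "trunc_index j0 j1 = {(j, k) \<in> full_index j0. j < int j1}"

definition approx_space :: "(real \<Rightarrow> real) \<Rightarrow> nat \<Rightarrow> (real \<Rightarrow> real) set" where
  "approx_space \<phi> j =
     {h \<in> L2_unit. \<exists>c. AE x in unit_leb. h x = (\<Sum>k<2 ^ j. c k * dilate \<phi> j k x)}"

definition multiresolution :: "(real \<Rightarrow> real) \<Rightarrow> (real \<Rightarrow> real) \<Rightarrow> bool" where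
  "multiresolution \<phi> \<psi> \<longleftrightarrow>
     (\<forall>j. approx_space \<phi> j \<subseteq> approx_space \<phi> (Suc j)) \<and>
     (\<forall>g\<in>L2_unit. \<forall>\<epsilon>>0. \<exists>j. \<exists>h\<in>approx_space \<phi> j. L2_dist g h < \<epsilon>) \<and>
     (\<forall>j. orthonormal_family {..<2 ^ j} (dilate \<phi> j)) \<and>
     (\<forall>j. orthonormal_family {..<2 ^ j} (dilate \<psi> j)) \<and>
     (\<forall>j. \<forall>k<2 ^ j. dilate \<psi> j k \<in> approx_space \<phi> (Suc j) \<and>
                    (\<forall>h\<in>approx_space \<phi> j. ip h (dilate \<psi> j k) = 0))"

definition wavelet_system :: "(real \<Rightarrow> real) \<Rightarrow> (real \<Rightarrow> real) \<Rightarrow> nat \<Rightarrow> bool" where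
  "wavelet_system \<phi> \<psi> m \<longleftrightarrow>
     \<phi> \<in> borel_measurable borel \<and> \<psi> \<in> borel_measurable borel \<and>
     bounded (range \<phi>) \<and> bounded (range \<psi>) \<and>
     compact (closure {x. \<phi> x \<noteq> 0}) \<and> compact (closure {x. \<psi> x \<noteq> 0}) \<and>
     (\<forall>i<m. (\<integral>x. x ^ i * \<psi> x \<partial>lborel) = 0) \<and>
     multiresolution \<phi> \<psi> \<and>
     (\<forall>j0. orthonormal_basis (full_index j0) (wavelet \<phi> \<psi> j0))"


section \<open>Function classes\<close>

text \<open>The norm and the classes with coarse level 0, for finite exponents \<open>p, q \<ge> 1\<close>. A function
  for which the series over the levels diverges has infinite norm.\<close>

definition sstar :: "real \<Rightarrow> real \<Rightarrow> real" where
  "sstar s p = s + 1/2 - 1/p"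

definition level_term ::
  "(real \<Rightarrow> real) \<Rightarrow> real \<Rightarrow> real \<Rightarrow> real \<Rightarrow> (real \<Rightarrow> real) \<Rightarrow> nat \<Rightarrow> real" where
  "level_term \<psi> s p q g j =
     2 powr (real j * sstar s p * q) * (\<Sum>k<2 ^ j. \<bar>ip g (dilate \<psi> j k)\<bar> powr p) powr (q / p)"

definition besov_finite ::
  "(real \<Rightarrow> real) \<Rightarrow> real \<Rightarrow> real \<Rightarrow> real \<Rightarrow> (real \<Rightarrow> real) \<Rightarrow> bool" where
  "besov_finite \<psi> s p q g \<longleftrightarrow> summable (level_term \<psi> s p q g)"

definition besov_norm ::
  "(real \<Rightarrow> real) \<Rightarrow> (real \<Rightarrow> real) \<Rightarrow> real \<Rightarrow> real \<Rightarrow> real \<Rightarrow> (real \<Rightarrow> real) \<Rightarrow> real" where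
  "besov_norm \<phi> \<psi> s p q g =
     (\<Sum>k<2 ^ 0. \<bar>ip g (dilate \<phi> 0 k)\<bar> powr p) powr (1 / p) +
     (\<Sum>j. level_term \<psi> s p q g j) powr (1 / q)"

definition exp_class ::
  "(real \<Rightarrow> real) \<Rightarrow> (real \<Rightarrow> real) \<Rightarrow> real \<Rightarrow> real \<Rightarrow> real \<Rightarrow> real \<Rightarrow> (real \<Rightarrow> real) set" where
  "exp_class \<phi> \<psi> s p q M =
     {f. \<exists>g\<in>L2_unit. besov_finite \<psi> s p q g \<and> besov_norm \<phi> \<psi> s p q g \<le> M \<and>
           (\<forall>x\<in>{0..1}. f x = exp (g x))}"


section \<open>Stationary Gaussian sequences\<close>

definition gaussian_rv :: "'w measure \<Rightarrow> ('w \<Rightarrow> real) \<Rightarrow> bool" where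
  "gaussian_rv P Z \<longleftrightarrow> Z \<in> borel_measurable P \<and>
     ((\<exists>\<mu> \<sigma>. 0 < \<sigma> \<and> distributed P lborel Z (normal_density \<mu> \<sigma>)) \<or>
      (\<exists>c. AE w in P. Z w = c))"

text \<open>Jointly Gaussian: every finite linear combination is Gaussian (possibly degenerate).\<close>

definition gaussian_sequence :: "'w measure \<Rightarrow> (nat \<Rightarrow> 'w \<Rightarrow> real) \<Rightarrow> bool" where
  "gaussian_sequence P X \<longleftrightarrow> prob_space P \<and>
     (\<forall>N a. gaussian_rv P (\<lambda>w. \<Sum>t<N. a t * X t w))"

definition cov :: "'w measure \<Rightarrow> ('w \<Rightarrow> real) \<Rightarrow> ('w \<Rightarrow> real) \<Rightarrow> real" where
  "cov P Y Z = (\<integral>w. (Y w - (\<integral>v. Y v \<partial>P)) * (Z w - (\<integral>v. Z v \<partial>P)) \<partial>P)"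

text \<open>For Gaussian sequences second-order stationarity, used here, is the same as strict
  stationarity. The (constant) mean is arbitrary.\<close>

definition stationary_gaussian ::
  "'w measure \<Rightarrow> (nat \<Rightarrow> 'w \<Rightarrow> real) \<Rightarrow> (int \<Rightarrow> real) \<Rightarrow> bool" where
  "stationary_gaussian P X \<rho> \<longleftrightarrow> gaussian_sequence P X \<and>
     (\<forall>t. (\<integral>w. X t w \<partial>P) = (\<integral>w. X 0 w \<partial>P)) \<and>
     (\<forall>t t'. cov P (X t) (X t') = \<rho> (int t' - int t))"

definition spectral_density :: "(int \<Rightarrow> real) \<Rightarrow> (real \<Rightarrow> real) \<Rightarrow> bool" where
  "spectral_density \<rho> f \<longleftrightarrow> (\<forall>\<omega>\<in>{0..1}.
     ((\<lambda>h. 1 / (2 * pi) * complex_of_real (\<rho> h) * exp (\<i> * 2 * pi * \<omega> * of_int h))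
        has_sum complex_of_real (f \<omega>)) UNIV)"

definition nonneg_definite :: "(int \<Rightarrow> real) \<Rightarrow> bool" where
  "nonneg_definite \<rho> \<longleftrightarrow>
     (\<forall>T a. finite T \<longrightarrow> 0 \<le> (\<Sum>t\<in>T. \<Sum>t'\<in>T. a t * a t' * \<rho> (t - t')))"

definition covariance_conditions :: "(int \<Rightarrow> real) \<Rightarrow> bool" where
  "covariance_conditions \<rho> \<longleftrightarrow> nonneg_definite \<rho> \<and>
     (\<exists>C1>0. ((\<lambda>h. \<bar>\<rho> h\<bar>) has_sum C1) UNIV) \<and>
     (\<exists>C2>0. ((\<lambda>h. \<bar>of_int h * (\<rho> h)\<^sup>2\<bar>) has_sum C2) UNIV)"

text \<open>The Fourier coefficients of \<open>f\<close>. If \<open>f\<close> is the spectral density of a sequence with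
  autocovariance \<open>\<rho>\<close>, then this is \<open>\<rho> h / (2 \<pi>)\<close>.\<close>

definition fourier_cov :: "(real \<Rightarrow> real) \<Rightarrow> int \<Rightarrow> complex" where
  "fourier_cov f h = (\<integral>\<omega>. complex_of_real (f \<omega>) * exp (- \<i> * 2 * pi * \<omega> * of_int h) \<partial>unit_leb)"

definition uniform_covariance_bound :: "(real \<Rightarrow> real) set \<Rightarrow> bool" where
  "uniform_covariance_bound F \<longleftrightarrow> (\<exists>B. \<forall>f\<in>F.
     (\<lambda>h. norm (fourier_cov f h)) summable_on UNIV \<and>
     (\<Sum>\<^sub>\<infinity>h. norm (fourier_cov f h)) \<le> B \<and>
     (\<lambda>h. norm (of_int h * (fourier_cov f h)\<^sup>2)) summable_on UNIV \<and>
     (\<Sum>\<^sub>\<infinity>h. norm (of_int h * (fourier_cov f h)\<^sup>2)) \<le> B)"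

text \<open>The possible laws, on path space, of the process with spectral density \<open>f\<close>. They differ only
  in the mean, to which the periodogram is insensitive. There is none if \<open>f\<close> is not symmetric about
  \<open>1/2\<close>, the process being real.\<close>

definition path_space :: "(nat \<Rightarrow> real) measure" where
  "path_space = PiM UNIV (\<lambda>_. borel)"

definition process_laws :: "(real \<Rightarrow> real) \<Rightarrow> (nat \<Rightarrow> real) measure set" where
  "process_laws f = {Q. sets Q = sets path_space \<and>
     (\<exists>\<rho>. stationary_gaussian Q (\<lambda>t x. x t) \<rho> \<and> spectral_density \<rho> f)}"


section \<open>The linear information projection estimator\<close>

text \<open>Everything below is a function of the path \<open>x\<close>, of which only \<open>x 1, \<dots>, x n\<close> is used.\<close>

definition sample_mean :: "nat \<Rightarrow> (nat \<Rightarrow> real) \<Rightarrow> real" where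
  "sample_mean n x = (\<Sum>t=1..n. x t) / real n"

definition periodogram :: "nat \<Rightarrow> (nat \<Rightarrow> real) \<Rightarrow> real \<Rightarrow> complex" where
  "periodogram n x \<omega> = 1 / (2 * pi * real n) * (\<Sum>t=1..n. \<Sum>t'=1..n.
     complex_of_real (x t - sample_mean n x) * cnj (complex_of_real (x t' - sample_mean n x)) *
     exp (\<i> * 2 * pi * \<omega> * (real t - real t')))"

definition emp_coeff ::
  "(real \<Rightarrow> real) \<Rightarrow> (real \<Rightarrow> real) \<Rightarrow> nat \<Rightarrow> (nat \<Rightarrow> real) \<Rightarrow> int \<times> nat \<Rightarrow> complex" where
  "emp_coeff \<phi> \<psi> n x jk =
     (\<integral>\<omega>. periodogram n x \<omega> * complex_of_real (wavelet \<phi> \<psi> 0 jk \<omega>) \<partial>unit_leb)"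

text \<open>Parameter vectors are functions on all of \<open>int \<times> nat\<close>, of which only the restriction to
  \<open>trunc_index 0 j1\<close> matters.\<close>

definition exp_family ::
  "(real \<Rightarrow> real) \<Rightarrow> (real \<Rightarrow> real) \<Rightarrow> nat \<Rightarrow> (int \<times> nat \<Rightarrow> real) \<Rightarrow> real \<Rightarrow> real" where
  "exp_family \<phi> \<psi> j1 \<theta> \<omega> = exp (\<Sum>jk\<in>trunc_index 0 j1. \<theta> jk * wavelet \<phi> \<psi> 0 jk \<omega>)"

definition solves_projection ::
  "(real \<Rightarrow> real) \<Rightarrow> (real \<Rightarrow> real) \<Rightarrow> nat \<Rightarrow> nat \<Rightarrow> (nat \<Rightarrow> real) \<Rightarrow> (int \<times> nat \<Rightarrow> real) \<Rightarrow> bool" where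
  "solves_projection \<phi> \<psi> j1 n x \<theta> \<longleftrightarrow> (\<forall>jk\<in>trunc_index 0 j1.
     complex_of_real (ip (exp_family \<phi> \<psi> j1 \<theta>) (wavelet \<phi> \<psi> 0 jk)) = emp_coeff \<phi> \<psi> n x jk)"

definition KL_loss :: "(real \<Rightarrow> real) \<Rightarrow> (real \<Rightarrow> real) \<Rightarrow> real" where
  "KL_loss f f' = (\<integral>\<omega>. f \<omega> * ln (f \<omega> / f' \<omega>) - f \<omega> + f' \<omega> \<partial>unit_leb)"

text \<open>For \<open>n = 0\<close> there is no such integer and the value is irrelevant.\<close>

definition level :: "real \<Rightarrow> nat \<Rightarrow> nat" where
  "level s n = (GREATEST j. 2 ^ j \<le> real n powr (1 / (2 * s + 1)))"

definition estimator_exists ::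
  "(real \<Rightarrow> real) \<Rightarrow> (real \<Rightarrow> real) \<Rightarrow> real \<Rightarrow> nat \<Rightarrow> (nat \<Rightarrow> real) \<Rightarrow> bool" where
  "estimator_exists \<phi> \<psi> s n x \<longleftrightarrow> (\<exists>\<theta>. solves_projection \<phi> \<psi> (level s n) n x \<theta>)"

text \<open>The event that the estimator exists and satisfies \<open>n\<^bsup>2s/(2s+1)\<^esup> \<Delta> > K\<close>. (If there were
  several solutions, this would say that some solution is bad, so a bound on its probability
  covers every choice of the estimator.)\<close>

definition loss_exceeds ::
  "(real \<Rightarrow> real) \<Rightarrow> (real \<Rightarrow> real) \<Rightarrow> real \<Rightarrow> (real \<Rightarrow> real) \<Rightarrow> nat \<Rightarrow> real \<Rightarrow> (nat \<Rightarrow> real) \<Rightarrow> bool" where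
  "loss_exceeds \<phi> \<psi> s f n K x \<longleftrightarrow> (\<exists>\<theta>. solves_projection \<phi> \<psi> (level s n) n x \<theta> \<and>
     real n powr (2 * s / (2 * s + 1)) * KL_loss f (exp_family \<phi> \<psi> (level s n) \<theta>) > K)"

end

theory Submission
  imports Defs
begin

text \<open>
  Let \<open>g = log f\<close> and let \<open>a\<close> be its wavelet coefficients up to the level \<open>J\<close>. Since \<open>s > 1/2\<close>, the
  partial sums \<open>g\<^sub>J\<close>, and hence \<open>g\<close>, are bounded by a constant depending only on the class, and
  \<open>g - g\<^sub>J\<close> has squared \<open>L\<^sub>2\<close> norm at most \<open>M\<^sup>2 2\<^bsup>-2Js\<^esup>\<close>. The map from \<open>\<theta>\<close> to the coefficients of
  \<open>exp (\<Sum> \<theta>\<^sub>i \<psi>\<^sub>i)\<close> is the gradient of a convex function, strongly monotone near \<open>a\<close> on a ball of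
  radius of order \<open>2\<^bsup>-J/2\<^esup>\<close>. So as soon as the empirical coefficients are closer than that to the
  coefficients of \<open>exp g\<^sub>J\<close>, the projection exists, and the loss is bounded by a constant times the sum of
  the squared approximation error and of the squared error \<open>\<sigma>\<^sup>2\<close> of the empirical coefficients.
  By the fourth moments of Gaussian vectors each empirical coefficient has mean squared error at
  most \<open>V / n\<close>, with \<open>V\<close> depending only on the class, hence the expectation of \<open>\<sigma>\<^sup>2\<close> is at most
  \<open>2\<^sup>J V / n\<close>. For the chosen level both errors are of order \<open>n\<^bsup>-2s/(2s+1)\<^esup>\<close>, and Markov's
  inequality concludes.
\<close>

text \<open>The obstacle is that \<open>exp\<close> is not uniformly convex: along a direction of L2
  norm r in the span, monotonicity weakens once the sup norm of that direction exceeds 1.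
  Localisation of the wavelets bounds the sup norm by D r with D = A 2^(J/2), which explains the
  radius. The squared coefficient error is of order n^(-2s/(2s+1)) and 2^J <= n^(1/(2s+1)), so the
  requirement becomes n^((1-2s)/(2s+1)) -> 0. Thus s > 1/2 enters twice, here and in the sup bound
  on g. Everything is deterministic once the squared error is controlled, with constants depending
  on the class only; the single probabilistic input is one Markov bound, so uniformity comes for
  free. For a real path the periodogram is even, so a wavelet enters only through its cosine
  coefficients, whose squares sum to at most 1. The mean squared error then splits into three terms
  of order 1/n: the variance (covariance rows are absolutely summable), the subtraction of the
  sample mean, and the triangular weights 1 - |h|/n, which are controlled by the sum of |h|
  rho(h)^2.\<close>

section \<open>Finite exponential families\<close>

text \<open>For h -> -oo the quotient (exp h - 1) / h decays only like 1 / |h|, since 1 - exp(-y) >=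
  y / (1 + y). The parameter t records this decay, so that the inequality can be used before h is
  known to be small.\<close>

lemma exp_minus_one_mult_ge:
  fixes h t :: real
  assumes "0 < t" "t \<le> 1" "t * \<bar>h\<bar> \<le> 1"
  shows "t * h\<^sup>2 / 2 \<le> (exp h - 1) * h"
proof (cases "0 \<le> h")
  case True
  have "t * (h * h) \<le> 1 * (h * h)"
    using assms(1,2) by (intro mult_right_mono) auto
  then have "t * h\<^sup>2 / 2 \<le> h * h"
    using zero_le_square[of h] unfolding power2_eq_square by linarith
  also have "\<dots> \<le> (exp h - 1) * h"
    using True exp_ge_add_one_self[of h] by (intro mult_right_mono; linarith)
  finally show ?thesis .
next
  case False
  define y where "y = - h"
  have y: "0 < y" "t * y \<le> 1" using False assms by (auto simp: y_def)
  have "exp (- y) \<le> 1 / (1 + y)"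
    using exp_ge_add_one_self[of y] y by (simp add: exp_minus field_simps)
  then have "1 - exp (- y) \<ge> y / (1 + y)"
    using y by (simp add: field_simps)
  moreover have "t * y / 2 \<le> y / (1 + y)"
  proof -
    have "t * (1 + y) \<le> 2" using assms y by (simp add: algebra_simps)
    then have "t * (1 + y) * y \<le> 2 * y" using y by (intro mult_right_mono) auto
    then show ?thesis using y by (simp add: field_simps)
  qed
  ultimately have "t * y / 2 \<le> 1 - exp (- y)" by linarith
  then have "t * y / 2 * y \<le> (1 - exp (- y)) * y"
    using y by (intro mult_right_mono) auto
  then show ?thesis by (simp add: y_def power2_eq_square algebra_simps)
qed

text \<open>From 1 - u <= exp(-u) one gets exp u - 1 - u <= u (exp u - 1), which is then bounded
  separately for each sign of u. The lost factor 1/2 is immaterial.\<close>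

lemma exp_taylor_le:
  fixes x y :: real
  assumes "x \<le> B" "y \<le> B"
  shows "exp y - exp x - exp x * (y - x) \<le> exp B * (y - x)\<^sup>2"
proof -
  define u where "u = y - x"
  have le1: "exp u - 1 - u \<le> u * (exp u - 1)"
  proof -
    have "exp u * (1 + (- u)) \<le> exp u * exp (- u)"
      by (intro mult_left_mono exp_ge_add_one_self) auto
    then show ?thesis by (simp add: algebra_simps flip: exp_add)
  qed
  have le2: "exp x * (u * (exp u - 1)) \<le> exp B * u\<^sup>2"
  proof (cases "0 \<le> u")
    case True
    have "u * (exp u - 1) \<le> u * (u * exp u)"
      using le1 True by (intro mult_left_mono) (auto simp: algebra_simps)
    then have "exp x * (u * (exp u - 1)) \<le> exp x * (u * (u * exp u))" by simp
    also have "\<dots> = exp y * u\<^sup>2" by (simp add: u_def power2_eq_square algebra_simps flip: exp_add)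
    also have "\<dots> \<le> exp B * u\<^sup>2" using assms by (intro mult_right_mono) auto
    finally show ?thesis .
  next
    case False
    have "(- u) * (1 - exp u) \<le> (- u) * (- u)"
      using False exp_ge_add_one_self[of u] by (intro mult_left_mono; linarith)
    then have "u * (exp u - 1) \<le> u\<^sup>2" by (simp add: power2_eq_square algebra_simps)
    then show ?thesis using assms False
      by (intro mult_mono) (auto intro: mult_nonpos_nonpos)
  qed
  have "exp y - exp x - exp x * (y - x) = exp x * (exp u - 1 - u)"
    by (simp add: u_def algebra_simps flip: exp_add)
  also have "\<dots> \<le> exp x * (u * (exp u - 1))" using le1 by simp
  also note le2
  finally show ?thesis by (simp add: u_def)
qed

lemma abs_exp_diff_le:
  fixes x y :: real
  assumes "x \<le> B" "y \<le> B"
  shows "\<bar>exp y - exp x\<bar> \<le> exp B * \<bar>y - x\<bar>"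
proof -
  have *: "exp b - exp a \<le> exp B * (b - a)" if "a \<le> b" "b \<le> B" for a b :: real
  proof -
    have "exp b * (1 + (a - b)) \<le> exp b * exp (a - b)"
      by (intro mult_left_mono exp_ge_add_one_self) auto
    then have "exp b - exp a \<le> exp b * (b - a)" by (simp add: algebra_simps flip: exp_add)
    also have "\<dots> \<le> exp B * (b - a)" using that by (intro mult_right_mono) auto
    finally show ?thesis .
  qed
  show ?thesis
    using *[of x y] *[of y x] assms by (cases "x \<le> y") (auto simp: abs_if)
qed

text \<open>\<open>D\<close> compares the sup norm with the L2 norm on the span: its square bounds
  the diagonal of the reproducing kernel. Countability of the index type allows sequential arguments
  and coordinatewise measurability for coefficient vectors.\<close>

locale finite_exp_family = prob_space M for M :: "'a measure" +
  fixes I :: "'i::countable set" and w :: "'i \<Rightarrow> 'a \<Rightarrow> real" and D :: real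
  assumes finite_I: "finite I"
    and measurable_w: "\<And>i. i \<in> I \<Longrightarrow> w i \<in> borel_measurable M"
    and orthonormal_w: "\<And>i j. i \<in> I \<Longrightarrow> j \<in> I \<Longrightarrow> (\<integral>x. w i x * w j x \<partial>M) = (if i = j then 1 else 0)"
    and sum_w_sq_le: "\<And>x. x \<in> space M \<Longrightarrow> (\<Sum>i\<in>I. (w i x)\<^sup>2) \<le> D\<^sup>2"
    and D_pos: "0 < D"
begin

definition lin :: "('i \<Rightarrow> real) \<Rightarrow> 'a \<Rightarrow> real" where
  "lin \<theta> x = (\<Sum>i\<in>I. \<theta> i * w i x)"

text \<open>The gradient at \<theta> of the convex function \<theta> -> integral of
  \<open>exp (lin \<theta>)\<close>.\<close>

definition coef :: "('i \<Rightarrow> real) \<Rightarrow> 'i \<Rightarrow> real" where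
  "coef \<theta> i = (\<integral>x. exp (lin \<theta> x) * w i x \<partial>M)"

lemma measurable_lin [measurable]: "lin \<theta> \<in> borel_measurable M"
  unfolding lin_def by (intro borel_measurable_sum borel_measurable_times measurable_w) auto

lemma abs_lin_le:
  assumes "x \<in> space M"
  shows "\<bar>lin \<theta> x\<bar> \<le> D * L2_set \<theta> I"
proof -
  have "\<bar>lin \<theta> x\<bar> \<le> (\<Sum>i\<in>I. \<bar>\<theta> i\<bar> * \<bar>w i x\<bar>)"
    unfolding lin_def by (intro order_trans[OF sum_abs]) (simp add: abs_mult)
  also have "\<dots> \<le> L2_set \<theta> I * L2_set (\<lambda>i. w i x) I"
    by (rule L2_set_mult_ineq)
  also have "\<dots> \<le> L2_set \<theta> I * D"
    using sum_w_sq_le[OF assms] D_pos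
    by (intro mult_left_mono) (auto simp: L2_set_def intro: real_le_lsqrt sum_nonneg)
  finally show ?thesis by (simp add: mult.commute)
qed

lemma abs_w_le:
  assumes "x \<in> space M" "i \<in> I"
  shows "\<bar>w i x\<bar> \<le> D"
proof -
  have "(w i x)\<^sup>2 \<le> (\<Sum>i\<in>I. (w i x)\<^sup>2)"
    using assms finite_I by (intro member_le_sum) auto
  also have "\<dots> \<le> D\<^sup>2" by (rule sum_w_sq_le[OF assms(1)])
  finally show ?thesis using D_pos by (simp add: abs_le_square_iff[symmetric])
qed

lemma exp_lin_le: "x \<in> space M \<Longrightarrow> exp (lin \<theta> x) \<le> exp (D * L2_set \<theta> I)"
  using abs_le_D1[OF abs_lin_le[of x \<theta>]] by (simp only: exp_le_cancel_iff)

lemma integrable_bounded: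
  assumes "f \<in> borel_measurable M" "\<And>x. x \<in> space M \<Longrightarrow> \<bar>f x\<bar> \<le> (B::real)"
  shows "integrable M f"
  using assms by (intro integrable_const_bound[where B=B]) auto

lemma integrable_exp_lin [intro]: "integrable M (\<lambda>x. exp (lin \<theta> x))"
  by (rule integrable_bounded[where B="exp (D * L2_set \<theta> I)"]) (use exp_lin_le in auto)

lemma integrable_exp_lin_mult [intro]:
  assumes "f \<in> borel_measurable M" "\<And>x. x \<in> space M \<Longrightarrow> \<bar>f x\<bar> \<le> (B::real)"
  shows "integrable M (\<lambda>x. exp (lin \<theta> x) * f x)"
proof (rule integrable_bounded[where B="exp (D * L2_set \<theta> I) * B"])
  show "(\<lambda>x. exp (lin \<theta> x) * f x) \<in> borel_measurable M" using assms(1) by measurable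
  show "\<bar>exp (lin \<theta> x) * f x\<bar> \<le> exp (D * L2_set \<theta> I) * B" if "x \<in> space M" for x
    unfolding abs_mult using that assms(2)[OF that] exp_lin_le[OF that, of \<theta>] by (intro mult_mono) auto
qed

lemma integrable_exp_lin_w [intro]: "i \<in> I \<Longrightarrow> integrable M (\<lambda>x. exp (lin \<theta> x) * w i x)"
  using measurable_w abs_w_le by (intro integrable_exp_lin_mult) auto

lemma integrable_exp_lin_lin [intro]: "integrable M (\<lambda>x. exp (lin \<theta> x) * lin \<eta> x)"
  using abs_lin_le by (intro integrable_exp_lin_mult) auto

lemma sum_mult_coef: "(\<Sum>i\<in>I. \<eta> i * coef \<theta> i) = (\<integral>x. exp (lin \<theta> x) * lin \<eta> x \<partial>M)"
proof -
  have "(\<Sum>i\<in>I. \<eta> i * coef \<theta> i) = (\<Sum>i\<in>I. \<integral>x. \<eta> i * (exp (lin \<theta> x) * w i x) \<partial>M)"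
    by (simp add: coef_def)
  also have "\<dots> = (\<integral>x. (\<Sum>i\<in>I. \<eta> i * (exp (lin \<theta> x) * w i x)) \<partial>M)"
    by (rule Bochner_Integration.integral_sum[symmetric]) (auto intro!: integrable_mult_right)
  finally show ?thesis
    unfolding lin_def[of \<eta>] by (simp add: sum_distrib_left mult.left_commute)
qed

lemma integral_lin_sq: "(\<integral>x. (lin \<theta> x)\<^sup>2 \<partial>M) = (L2_set \<theta> I)\<^sup>2"
proof -
  have int: "integrable M (\<lambda>x. w i x * w j x)" if "i \<in> I" "j \<in> I" for i j
    using measurable_w[OF that(1)] measurable_w[OF that(2)] abs_w_le that D_pos
    by (intro integrable_bounded[where B="D * D"]) (auto simp: abs_mult intro!: mult_mono)
  have "(\<integral>x. (lin \<theta> x)\<^sup>2 \<partial>M) = (\<integral>x. (\<Sum>i\<in>I. \<Sum>j\<in>I. \<theta> i * \<theta> j * (w i x * w j x)) \<partial>M)"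
    by (simp add: lin_def power2_eq_square sum_product algebra_simps)
  also have "\<dots> = (\<Sum>i\<in>I. \<Sum>j\<in>I. \<theta> i * \<theta> j * (\<integral>x. w i x * w j x \<partial>M))"
    using int by (subst Bochner_Integration.integral_sum; (intro Bochner_Integration.integrable_sum integrable_mult_right sum.cong refl)?)+ auto
  also have "\<dots> = (\<Sum>i\<in>I. \<theta> i * \<theta> i)"
    using finite_I by (intro sum.cong refl) (simp add: orthonormal_w if_distrib[of "\<lambda>z. _ * z"] cong: if_cong)
  finally show ?thesis by (simp add: L2_set_def sum_nonneg power2_eq_square)
qed

lemma integrable_lin_sq: "integrable M (\<lambda>x. (lin u x)\<^sup>2)"
proof (rule integrable_bounded[where B="(D * L2_set u I)\<^sup>2"])
  fix x assume "x \<in> space M"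
  from power_mono[OF abs_lin_le[OF this], of u 2] show "\<bar>(lin u x)\<^sup>2\<bar> \<le> (D * L2_set u I)\<^sup>2" by simp
qed auto

lemma lin_diff: "lin (\<lambda>i. \<theta> i - \<eta> i) x = lin \<theta> x - lin \<eta> x"
  by (simp add: lin_def left_diff_distrib sum_subtractf)

lemma abs_sum_mult_le: "\<bar>\<Sum>i\<in>I. f i * g i\<bar> \<le> L2_set f I * L2_set g I"
  by (rule order_trans[OF sum_abs]) (simp add: abs_mult L2_set_mult_ineq)

text \<open>Pair \<open>coef \<theta> - coef a\<close> with u = \<theta> - a: strong monotonicity
  bounds the pairing from below, \<open>le\<close> and Cauchy-Schwarz from above by |u| d. The
  hypothesis \<open>le\<close> is an inequality rather than an equation, so that it covers both
  exact solutions and a constrained minimiser. No closeness of \<theta> to a is assumed.\<close>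

lemma stability:
  assumes a: "\<And>x. x \<in> space M \<Longrightarrow> \<bar>lin a x\<bar> \<le> B"
    and le: "(\<Sum>i\<in>I. (\<theta> i - a i) * (coef \<theta> i - b i)) \<le> 0"
    and small: "L2_set (\<lambda>i. b i - coef a i) I * D < exp (- B) / 2"
  shows "L2_set (\<lambda>i. \<theta> i - a i) I \<le> L2_set (\<lambda>i. b i - coef a i) I / (exp (- B) / 2)"
proof -
  define u where "u = (\<lambda>i. \<theta> i - a i)"
  define r where "r = L2_set u I"
  define d where "d = L2_set (\<lambda>i. b i - coef a i) I"
  \<comment> \<open>On the ball D r <= 1 this is t = 1, the full strong monotonicity. Outside, t r =
    1 / D is constant, so \<open>key\<close> would give exp(-B) / 2 <= d D, against
    \<open>small\<close>.\<close>
  define t where "t = 1 / max 1 (D * r)"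
  have r0: "0 \<le> r" by (simp add: r_def)
  have t: "0 < t" "t \<le> 1" by (auto simp: t_def)
  have tDr: "t * (D * r) \<le> 1" by (auto simp: t_def field_simps)
  have lower: "exp (- B) * (t * (lin u x)\<^sup>2 / 2) \<le> (exp (lin \<theta> x) - exp (lin a x)) * lin u x"
    if x: "x \<in> space M" for x
  proof -
    have "t * \<bar>lin u x\<bar> \<le> t * (D * r)"
      using abs_lin_le[OF x, of u] t by (intro mult_left_mono) (auto simp: r_def)
    with tDr have "t * (lin u x)\<^sup>2 / 2 \<le> (exp (lin u x) - 1) * lin u x"
      by (intro exp_minus_one_mult_ge t) auto
    moreover have "exp (- B) \<le> exp (lin a x)" using a[OF x] by auto
    ultimately have "exp (- B) * (t * (lin u x)\<^sup>2 / 2) \<le> exp (lin a x) * ((exp (lin u x) - 1) * lin u x)"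
      using t by (intro mult_mono) auto
    also have "\<dots> = (exp (lin \<theta> x) - exp (lin a x)) * lin u x"
      by (simp add: u_def lin_diff algebra_simps flip: exp_add)
    finally show ?thesis .
  qed
  have "exp (- B) * (t * r\<^sup>2 / 2) = (\<integral>x. exp (- B) * (t * (lin u x)\<^sup>2 / 2) \<partial>M)"
    by (simp add: integral_lin_sq r_def)
  also have "\<dots> \<le> (\<integral>x. (exp (lin \<theta> x) - exp (lin a x)) * lin u x \<partial>M)"
  proof (rule integral_mono)
    show "integrable M (\<lambda>x. (exp (lin \<theta> x) - exp (lin a x)) * lin u x)"
      unfolding left_diff_distrib by (intro Bochner_Integration.integrable_diff) auto
  qed (use integrable_lin_sq lower in auto)
  also have "\<dots> = (\<Sum>i\<in>I. u i * coef \<theta> i) - (\<Sum>i\<in>I. u i * coef a i)"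
    unfolding sum_mult_coef left_diff_distrib
    by (rule Bochner_Integration.integral_diff) auto
  also have "\<dots> = (\<Sum>i\<in>I. u i * (coef \<theta> i - b i)) + (\<Sum>i\<in>I. u i * (b i - coef a i))"
    by (simp add: sum_subtractf right_diff_distrib)
  also have "\<dots> \<le> 0 + r * d"
    using le abs_sum_mult_le[of u "\<lambda>i. b i - coef a i"] by (intro add_mono) (auto simp: u_def r_def d_def)
  finally have main: "exp (- B) * (t * r\<^sup>2 / 2) \<le> r * d" by simp
  have key: "exp (- B) / 2 * (t * r) \<le> d"
  proof (cases "r = 0")
    case False
    then have "0 < r" using r0 by simp
    then show ?thesis using main by (simp add: power2_eq_square field_simps)
  qed (simp add: d_def)
  have "D * r \<le> 1"
  proof (rule ccontr)
    assume "\<not> D * r \<le> 1"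
    then have "t * r = 1 / D" using D_pos r0 by (auto simp: t_def max_def)
    with key have "exp (- B) / 2 * (1 / D) \<le> d" by simp
    then have "exp (- B) / 2 \<le> d * D" using D_pos by (simp add: pos_divide_le_eq)
    then show False using small by (simp add: d_def)
  qed
  then have "t = 1" by (simp add: t_def)
  then show ?thesis using key by (simp add: r_def d_def u_def field_simps)
qed

section \<open>Existence and measurability of a parameter with prescribed coefficients\<close>

lemma tendsto_coord:
  fixes X :: "nat \<Rightarrow> 'i \<Rightarrow> real"
  assumes "X \<longlonglongrightarrow> l" shows "(\<lambda>n. X n i) \<longlonglongrightarrow> l i"
  by (rule continuous_on_tendsto_compose[OF continuous_on_product_coordinates assms]) auto

lemma L2_set_le_box:
  assumes "\<And>i. i \<in> I \<Longrightarrow> \<bar>\<theta> i\<bar> \<le> R"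
  shows "L2_set \<theta> I \<le> real (card I) * R"
  using L2_set_le_sum_abs[of \<theta> I] sum_bounded_above[of I "\<lambda>i. \<bar>\<theta> i\<bar>" R] assms by fastforce

lemma integral_exp_lin_tendsto:
  fixes X :: "nat \<Rightarrow> 'i \<Rightarrow> real"
  assumes lim: "X \<longlonglongrightarrow> l" and bd: "\<And>n i. i \<in> I \<Longrightarrow> \<bar>X n i\<bar> \<le> R"
    and f: "f \<in> borel_measurable M" "\<And>x. x \<in> space M \<Longrightarrow> \<bar>f x\<bar> \<le> (B::real)"
  shows "(\<lambda>n. \<integral>x. exp (lin (X n) x) * f x \<partial>M) \<longlonglongrightarrow> (\<integral>x. exp (lin l x) * f x \<partial>M)"
proof (rule integral_dominated_convergence[where w="\<lambda>_. exp (D * (real (card I) * R)) * B"])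
  show "AE x in M. (\<lambda>n. exp (lin (X n) x) * f x) \<longlonglongrightarrow> exp (lin l x) * f x"
    unfolding lin_def by (intro AE_I2 tendsto_intros tendsto_coord lim)
  show "AE x in M. norm (exp (lin (X n) x) * f x) \<le> exp (D * (real (card I) * R)) * B" for n
  proof (intro AE_I2)
    fix x assume x: "x \<in> space M"
    have "exp (lin (X n) x) \<le> exp (D * L2_set (X n) I)" by (rule exp_lin_le[OF x])
    also have "\<dots> \<le> exp (D * (real (card I) * R))"
      using L2_set_le_box[OF bd] D_pos by (simp add: mult_left_mono)
    finally show "norm (exp (lin (X n) x) * f x) \<le> exp (D * (real (card I) * R)) * B"
      using f(2)[OF x] by (simp add: abs_mult mult_mono)
  qed
qed (use f(1) in measurable)

text \<open>Coordinates outside \<open>I\<close> do not affect \<open>lin\<close>; pinning them to 0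
  makes the box compact in the product topology on all functions.\<close>

definition box :: "real \<Rightarrow> ('i \<Rightarrow> real) set" where
  "box R = {\<theta>. \<forall>i. \<theta> i \<in> (if i \<in> I then {- R..R} else {0})}"

lemma compact_box: "compact (box R)"
proof -
  have "box R = PiE UNIV (\<lambda>i. if i \<in> I then {- R..R} else {0})"
    by (auto simp: box_def PiE_def Pi_def)
  moreover have "compactin (product_topology (\<lambda>_. euclidean) UNIV) (PiE UNIV (\<lambda>i. if i \<in> I then {- R..R} else {0::real}))"
    by (subst compactin_PiE) auto
  ultimately show ?thesis
    unfolding euclidean_product_topology compactin_euclidean_iff by simp
qed

lemma continuous_on_integral_exp_lin:
  assumes "f \<in> borel_measurable M" "\<And>x. x \<in> space M \<Longrightarrow> \<bar>f x\<bar> \<le> (B::real)"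
  shows "continuous_on (box R) (\<lambda>\<theta>. \<integral>x. exp (lin \<theta> x) * f x \<partial>M)"
  unfolding continuous_on_sequentially
proof (intro allI ballI impI, elim conjE)
  fix X :: "nat \<Rightarrow> 'i \<Rightarrow> real" and l
  assume box: "l \<in> box R" "\<forall>n. X n \<in> box R" and lim: "X \<longlonglongrightarrow> l"
  have "\<bar>X n i\<bar> \<le> R" if "i \<in> I" for n i
    using box(2)[rule_format, of n] that by (auto simp: box_def abs_le_iff split: if_splits dest!: spec[of _ i])
  then show "((\<lambda>\<theta>. \<integral>x. exp (lin \<theta> x) * f x \<partial>M) \<circ> X) \<longlonglongrightarrow> (\<integral>x. exp (lin l x) * f x \<partial>M)"
    unfolding comp_def by (intro integral_exp_lin_tendsto[OF lim _ assms])
qed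

lemma continuous_on_coef: "i \<in> I \<Longrightarrow> continuous_on (box R) (\<lambda>\<theta>. coef \<theta> i)"
  unfolding coef_def using measurable_w abs_w_le by (intro continuous_on_integral_exp_lin) auto

lemma continuous_on_integral_exp: "continuous_on (box R) (\<lambda>\<theta>. \<integral>x. exp (lin \<theta> x) \<partial>M)"
  using continuous_on_integral_exp_lin[of "\<lambda>_. 1" 1] by auto

text \<open>The tangent inequality for \<open>exp\<close> at \<open>lin \<eta>\<close>, integrated.
  The gradient is taken at \<eta>, the endpoint of the step, so no differentiation under the
  integral is needed anywhere.\<close>

lemma convexity: "(\<integral>x. exp (lin \<eta> x) \<partial>M) - (\<integral>x. exp (lin \<theta> x) \<partial>M) \<le> (\<Sum>i\<in>I. (\<eta> i - \<theta> i) * coef \<eta> i)"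
proof -
  have "(\<integral>x. exp (lin \<eta> x) \<partial>M) - (\<integral>x. exp (lin \<theta> x) \<partial>M) = (\<integral>x. exp (lin \<eta> x) - exp (lin \<theta> x) \<partial>M)"
    by (rule Bochner_Integration.integral_diff[symmetric]) auto
  also have "\<dots> \<le> (\<integral>x. exp (lin \<eta> x) * lin (\<lambda>i. \<eta> i - \<theta> i) x \<partial>M)"
  proof (rule integral_mono)
    fix x
    have "exp (lin \<eta> x) * (1 + (lin \<theta> x - lin \<eta> x)) \<le> exp (lin \<eta> x) * exp (lin \<theta> x - lin \<eta> x)"
      by (intro mult_left_mono exp_ge_add_one_self) auto
    then show "exp (lin \<eta> x) - exp (lin \<theta> x) \<le> exp (lin \<eta> x) * lin (\<lambda>i. \<eta> i - \<theta> i) x"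
      by (simp add: lin_diff algebra_simps flip: exp_add)
  qed auto
  also have "\<dots> = (\<Sum>i\<in>I. (\<eta> i - \<theta> i) * coef \<eta> i)" by (simp add: sum_mult_coef)
  finally show ?thesis .
qed

lemma coef_cong: "(\<And>i. i \<in> I \<Longrightarrow> \<theta> i = \<eta> i) \<Longrightarrow> coef \<theta> = coef \<eta>"
  by (intro ext) (simp add: coef_def lin_def)

lemma L2_set_bound_coord: "i \<in> I \<Longrightarrow> \<bar>f i\<bar> \<le> L2_set f I"
  using finite_I member_le_L2_set[of I i "\<lambda>i. \<bar>f i\<bar>"] by (simp add: L2_set_def)

text \<open>The convex function \<open>\<theta> \<mapsto> \<integral> exp (lin \<theta>) - \<theta> \<cdot> b\<close> is minimised over a ball around \<open>a\<close>. The
  minimiser satisfies a variational inequality, whose instance at \<open>a\<close> is the hypothesis of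
  \<open>stability\<close>; hence the minimiser is interior and therefore critical.\<close>

lemma coef_surj_near:
  assumes a: "\<And>x. x \<in> space M \<Longrightarrow> \<bar>lin a x\<bar> \<le> B"
    and small: "L2_set (\<lambda>i. b i - coef a i) I * D < exp (- B) / 2"
  shows "\<exists>\<theta>. \<forall>i\<in>I. coef \<theta> i = b i"
proof -
  define G where "G = (\<lambda>\<theta>. (\<integral>x. exp (lin \<theta> x) \<partial>M) - (\<Sum>i\<in>I. \<theta> i * b i))"
  \<comment> \<open>Large enough for the box to contain the ball around a (up to irrelevant
    coordinates); the box only supplies compactness.\<close>
  define R where "R = L2_set a I + 1 / D"
  \<comment> \<open>The radius 1 / D is the one that \<open>stability\<close> can beat: its bound d
    / (exp(-B) / 2) is below 1 / D exactly by \<open>small\<close>.\<close>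
  define K where "K = box R \<inter> {\<theta>. L2_set (\<lambda>i. \<theta> i - a i) I \<le> 1 / D}"
  have coord: "continuous_on S (\<lambda>\<theta>::'i \<Rightarrow> real. \<theta> i)" for i S
    by (rule continuous_on_subset[OF continuous_on_product_coordinates]) auto
  have "closed {\<theta>. L2_set (\<lambda>i. \<theta> i - a i) I \<le> 1 / D}"
    unfolding L2_set_def by (intro closed_Collect_le continuous_intros coord)
  then have "compact K" unfolding K_def by (intro compact_Int_closed compact_box)
  moreover have KI: "\<theta> \<in> K" if "\<And>i. i \<notin> I \<Longrightarrow> \<theta> i = 0" "L2_set (\<lambda>i. \<theta> i - a i) I \<le> 1 / D" for \<theta>
  proof -
    have "\<bar>\<theta> i\<bar> \<le> R" if "i \<in> I" for i
      using L2_set_bound_coord[OF that, of a] L2_set_bound_coord[OF that, of "\<lambda>i. \<theta> i - a i"]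
        \<open>L2_set (\<lambda>i. \<theta> i - a i) I \<le> 1 / D\<close> unfolding R_def by linarith
    then have "\<theta> i \<le> R \<and> - R \<le> \<theta> i" if "i \<in> I" for i
      using that by (fastforce simp: abs_le_iff)
    then show ?thesis using that by (auto simp: K_def box_def)
  qed
  have KD: "\<theta> i = 0" if "\<theta> \<in> K" "i \<notin> I" for \<theta> i
    using that by (auto simp: K_def box_def split: if_splits dest!: spec[of _ i])
  define a0 where "a0 = (\<lambda>i. if i \<in> I then a i else 0)"
  have L2a0: "L2_set (\<lambda>i. a0 i - a i) I = 0" by (simp add: L2_set_def a0_def)
  then have a0K: "a0 \<in> K" using D_pos by (intro KI) (auto simp: a0_def)
  moreover have "continuous_on K G"
    unfolding G_def K_def
    by (intro continuous_intros coord continuous_on_subset[OF continuous_on_integral_exp]) auto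
  ultimately obtain \<theta> where \<theta>: "\<theta> \<in> K" "\<And>\<eta>. \<eta> \<in> K \<Longrightarrow> G \<theta> \<le> G \<eta>"
    using continuous_attains_inf[of K G] by blast
  \<comment> \<open>Move from \<theta> towards \<eta> by 1 / (n + 1). Minimality and
    \<open>convexity\<close> give the inequality with the gradient at the moved point
    \<open>X n\<close>; continuity of \<open>coef\<close> carries it to \<theta> in the
    limit.\<close>
  have variational: "0 \<le> (\<Sum>i\<in>I. (\<eta> i - \<theta> i) * (coef \<theta> i - b i))" if \<eta>: "\<eta> \<in> K" for \<eta>
  proof -
    define t where "t = (\<lambda>n::nat. 1 / real (Suc n))"
    define X where "X = (\<lambda>n i. \<theta> i + t n * (\<eta> i - \<theta> i))"
    have t: "0 < t n" "t n \<le> 1" for n by (auto simp: t_def)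
    have XK: "X n \<in> K" for n
    proof (rule KI)
      show "X n i = 0" if "i \<notin> I" for i using KD[OF \<theta>(1) that] KD[OF \<eta> that] by (simp add: X_def)
      have "L2_set (\<lambda>i. X n i - a i) I
          = L2_set (\<lambda>i. (1 - t n) * (\<theta> i - a i) + t n * (\<eta> i - a i)) I"
        by (simp add: X_def algebra_simps)
      also have "\<dots> \<le> L2_set (\<lambda>i. (1 - t n) * (\<theta> i - a i)) I + L2_set (\<lambda>i. t n * (\<eta> i - a i)) I"
        by (rule L2_set_triangle_ineq)
      also have "\<dots> = (1 - t n) * L2_set (\<lambda>i. \<theta> i - a i) I + t n * L2_set (\<lambda>i. \<eta> i - a i) I"
        using t[of n] by (simp add: L2_set_right_distrib)
      also have "\<dots> \<le> (1 - t n) * (1 / D) + t n * (1 / D)"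
        using \<theta>(1) \<eta> t[of n] by (intro add_mono mult_left_mono) (auto simp: K_def)
      finally show "L2_set (\<lambda>i. X n i - a i) I \<le> 1 / D" by (simp add: algebra_simps)
    qed
    have ge: "0 \<le> (\<Sum>i\<in>I. (\<eta> i - \<theta> i) * (coef (X n) i - b i))" for n
    proof -
      have "0 \<le> G (X n) - G \<theta>" using \<theta>(2)[OF XK] by simp
      also have "\<dots> \<le> (\<Sum>i\<in>I. (X n i - \<theta> i) * coef (X n) i) - (\<Sum>i\<in>I. (X n i - \<theta> i) * b i)"
        using convexity[of "X n" \<theta>] by (simp add: G_def left_diff_distrib sum_subtractf)
      also have "\<dots> = t n * (\<Sum>i\<in>I. (\<eta> i - \<theta> i) * (coef (X n) i - b i))"
        by (simp add: X_def sum_distrib_left algebra_simps flip: sum_subtractf)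
      finally show ?thesis using t[of n] by (simp add: zero_le_mult_iff)
    qed
    have "t \<longlonglongrightarrow> 0" unfolding t_def by (rule LIMSEQ_Suc[OF lim_1_over_n])
    then have "(\<lambda>n. X n i) \<longlonglongrightarrow> \<theta> i + 0 * (\<eta> i - \<theta> i)" for i
      unfolding X_def by (intro tendsto_intros)
    then have "X \<longlonglongrightarrow> \<theta>"
      using limitin_componentwise[of "\<lambda>_. euclidean" UNIV X \<theta> sequentially]
      unfolding euclidean_product_topology limitin_canonical_iff by simp
    moreover have "X n \<in> box R" for n using XK by (auto simp: K_def)
    moreover have "\<theta> \<in> box R" using \<theta> by (auto simp: K_def)
    ultimately have "(\<lambda>n. coef (X n) i) \<longlonglongrightarrow> coef \<theta> i" if "i \<in> I" for i
      using continuous_on_coef[OF that, of R] unfolding continuous_on_sequentially comp_def by blast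
    then have "(\<lambda>n. \<Sum>i\<in>I. (\<eta> i - \<theta> i) * (coef (X n) i - b i))
        \<longlonglongrightarrow> (\<Sum>i\<in>I. (\<eta> i - \<theta> i) * (coef \<theta> i - b i))"
      by (intro tendsto_intros)
    then show ?thesis using ge by (intro LIMSEQ_le_const) auto
  qed
  have "0 \<le> (\<Sum>i\<in>I. (a i - \<theta> i) * (coef \<theta> i - b i))"
    using variational[OF a0K] by (simp add: a0_def cong: sum.cong)
  then have "(\<Sum>i\<in>I. (\<theta> i - a i) * (coef \<theta> i - b i)) \<le> 0"
    by (simp add: left_diff_distrib sum_subtractf)
  from stability[OF a this small]
  have "L2_set (\<lambda>i. \<theta> i - a i) I \<le> L2_set (\<lambda>i. b i - coef a i) I / (exp (- B) / 2)" .
  also have "\<dots> < 1 / D" using small D_pos by (simp add: field_simps)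
  finally have interior: "L2_set (\<lambda>i. \<theta> i - a i) I < 1 / D" .
  \<comment> \<open>A step of gradient descent: \<theta> - e v has to stay in the ball, so e is the
    slack of \<open>interior\<close> divided by 1 + |v|, the 1 avoiding a division by zero. The
    variational inequality at this point reads 0 <= - e |v|^2.\<close>
  define v where "v = (\<lambda>i. if i \<in> I then coef \<theta> i - b i else 0)"
  define e where "e = (1 / D - L2_set (\<lambda>i. \<theta> i - a i) I) / (1 + L2_set v I)"
  have v1: "0 < 1 + L2_set v I" using L2_set_nonneg[of v I] by linarith
  then have e: "0 < e" using interior unfolding e_def by (intro divide_pos_pos) auto
  have eq: "e * (1 + L2_set v I) = 1 / D - L2_set (\<lambda>i. \<theta> i - a i) I"
    unfolding e_def using v1 by simp
  have "(\<lambda>i. \<theta> i - e * v i) \<in> K"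
  proof (rule KI)
    show "\<theta> i - e * v i = 0" if "i \<notin> I" for i using KD[OF \<theta>(1) that] that by (simp add: v_def)
    have "L2_set (\<lambda>i. \<theta> i - e * v i - a i) I = L2_set (\<lambda>i. (\<theta> i - a i) + (- e) * v i) I"
      by (simp add: algebra_simps)
    also have "\<dots> \<le> L2_set (\<lambda>i. \<theta> i - a i) I + L2_set (\<lambda>i. (- e) * v i) I"
      by (rule L2_set_triangle_ineq)
    also have "L2_set (\<lambda>i. (- e) * v i) I = L2_set (\<lambda>i. e * v i) I"
      by (simp add: L2_set_def)
    also have "\<dots> = e * L2_set v I" using e by (simp add: L2_set_right_distrib)
    finally show "L2_set (\<lambda>i. \<theta> i - e * v i - a i) I \<le> 1 / D" using eq e by (simp add: algebra_simps)
  qed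
  from variational[OF this] have "0 \<le> - (e * (\<Sum>i\<in>I. (v i)\<^sup>2))"
    by (simp add: v_def power2_eq_square sum_distrib_left sum_negf mult.assoc cong: sum.cong)
  then have "(\<Sum>i\<in>I. (v i)\<^sup>2) \<le> 0" using e by (simp add: mult_le_0_iff)
  then have "(\<Sum>i\<in>I. (v i)\<^sup>2) = 0" by (intro antisym sum_nonneg) auto
  then have "\<forall>i\<in>I. v i = 0" using finite_I by (simp add: sum_nonneg_eq_0_iff)
  then show ?thesis by (intro exI[of _ \<theta>]) (auto simp: v_def)
qed

text \<open>Applies to every solution, since the sum in the hypothesis of \<open>stability\<close>
  then vanishes. The loss bound therefore covers all solutions and not just the minimiser
  constructed above.\<close>

lemma coef_near:
  assumes a: "\<And>x. x \<in> space M \<Longrightarrow> \<bar>lin a x\<bar> \<le> B"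
    and small: "L2_set (\<lambda>i. b i - coef a i) I * D < exp (- B) / 2"
    and \<theta>: "\<And>i. i \<in> I \<Longrightarrow> coef \<theta> i = b i"
  shows "L2_set (\<lambda>i. \<theta> i - a i) I \<le> L2_set (\<lambda>i. b i - coef a i) I / (exp (- B) / 2)"
  by (rule stability[OF a _ small]) (auto simp: \<theta>)

text \<open>The continuous image of each compact box is closed, so the range of the coefficient map
  is a countable union of closed sets.\<close>

lemma measurable_coef_range:
  assumes "\<And>i. i \<in> I \<Longrightarrow> y i \<in> borel_measurable N"
  shows "{x \<in> space N. \<exists>\<theta>. \<forall>i\<in>I. coef \<theta> i = y i x} \<in> sets N"
proof -
  define Y where "Y = (\<lambda>x i. if i \<in> I then y i x else 0)"
  define C where "C = (\<lambda>\<theta> i. if i \<in> I then coef \<theta> i else 0)"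
  have "(\<lambda>x. Y x i) \<in> borel_measurable N" for i
    using assms by (cases "i \<in> I") (auto simp: Y_def)
  then have Y [measurable]: "Y \<in> borel_measurable N" by (rule measurable_coordinatewise_then_product)
  have "closed (C ` box R)" for R
  proof (intro compact_imp_closed compact_continuous_image compact_box continuous_on_coordinatewise_then_product)
    show "continuous_on (box R) (\<lambda>\<theta>. C \<theta> i)" for i
      by (cases "i \<in> I") (auto simp: C_def continuous_on_coef)
  qed
  then have "(\<Union>n. C ` box (real n)) \<in> sets borel" by auto
  moreover have "{x \<in> space N. \<exists>\<theta>. \<forall>i\<in>I. coef \<theta> i = y i x} = Y -` (\<Union>n. C ` box (real n)) \<inter> space N"
  proof (intro equalityI subsetI)
    fix x assume "x \<in> {x \<in> space N. \<exists>\<theta>. \<forall>i\<in>I. coef \<theta> i = y i x}"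
    then obtain \<theta> where x: "x \<in> space N" and \<theta>: "\<And>i. i \<in> I \<Longrightarrow> coef \<theta> i = y i x" by auto
    define \<theta>' where "\<theta>' = (\<lambda>i. if i \<in> I then \<theta> i else 0)"
    have "coef \<theta>' = coef \<theta>" by (rule coef_cong) (simp add: \<theta>'_def)
    then have "C \<theta>' = Y x" using \<theta> by (auto simp: C_def Y_def)
    moreover obtain n where n: "L2_set \<theta> I \<le> real n" using real_arch_simple by blast
    have "\<theta>' \<in> box (real n)"
      unfolding box_def
    proof (intro CollectI allI)
      fix i show "\<theta>' i \<in> (if i \<in> I then {- real n..real n} else {0})"
        using L2_set_bound_coord[of i \<theta>] n by (auto simp: \<theta>'_def abs_le_iff)
    qed
    ultimately show "x \<in> Y -` (\<Union>n. C ` box (real n)) \<inter> space N" using x by (auto intro: image_eqI[OF sym])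
  next
    fix x assume "x \<in> Y -` (\<Union>n. C ` box (real n)) \<inter> space N"
    then obtain \<theta> where "x \<in> space N" "Y x = C \<theta>" by auto
    then show "x \<in> {x \<in> space N. \<exists>\<theta>. \<forall>i\<in>I. coef \<theta> i = y i x}"
      by (auto simp: Y_def C_def fun_eq_iff intro!: exI[of _ \<theta>]) (metis)
  qed
  ultimately show ?thesis using measurable_sets[OF Y] by auto
qed

section \<open>Least squares in the span of the family\<close>

lemma integrable_mult_w:
  assumes q: "q \<in> borel_measurable M" "integrable M (\<lambda>x. (q x)\<^sup>2)" and i: "i \<in> I"
  shows "integrable M (\<lambda>x. q x * w i x)"
proof (rule Bochner_Integration.integrable_bound[where f="\<lambda>x. D * (1 + (q x)\<^sup>2)"])
  show "integrable M (\<lambda>x. D * (1 + (q x)\<^sup>2))" using q by auto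
  show "(\<lambda>x. q x * w i x) \<in> borel_measurable M" using q(1) measurable_w[OF i] by measurable
  show "AE x in M. norm (q x * w i x) \<le> norm (D * (1 + (q x)\<^sup>2))"
  proof (intro AE_I2)
    fix x assume x: "x \<in> space M"
    have "0 \<le> (\<bar>q x\<bar> - 1)\<^sup>2" by simp
    then have "\<bar>q x\<bar> * 2 \<le> 1 + (q x)\<^sup>2" by (simp add: power2_eq_square algebra_simps)
    then have "\<bar>q x\<bar> \<le> 1 + (q x)\<^sup>2" by linarith
    then have "\<bar>q x\<bar> * \<bar>w i x\<bar> \<le> (1 + (q x)\<^sup>2) * D"
      using abs_w_le[OF x i] by (intro mult_mono) auto
    then show "norm (q x * w i x) \<le> norm (D * (1 + (q x)\<^sup>2))"
      using D_pos by (simp add: abs_mult mult.commute)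
  qed
qed

lemma integrable_mult_lin:
  assumes q: "q \<in> borel_measurable M" "integrable M (\<lambda>x. (q x)\<^sup>2)"
  shows "integrable M (\<lambda>x. q x * lin c x)"
    and "(\<integral>x. q x * lin c x \<partial>M) = (\<Sum>i\<in>I. c i * (\<integral>x. q x * w i x \<partial>M))"
proof -
  have eq: "q x * lin c x = (\<Sum>i\<in>I. c i * (q x * w i x))" for x
    by (simp add: lin_def sum_distrib_left algebra_simps)
  show "integrable M (\<lambda>x. q x * lin c x)"
    unfolding eq using integrable_mult_w[OF q] by (intro Bochner_Integration.integrable_sum integrable_mult_right)
  show "(\<integral>x. q x * lin c x \<partial>M) = (\<Sum>i\<in>I. c i * (\<integral>x. q x * w i x \<partial>M))"
    unfolding eq using integrable_mult_w[OF q]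
    by (subst Bochner_Integration.integral_sum) auto
qed

text \<open>Completing the square in the coefficients. It yields both Bessel's inequality and the
  optimality of the true coefficients among all c.\<close>

lemma integral_diff_lin_sq:
  assumes q: "q \<in> borel_measurable M" "integrable M (\<lambda>x. (q x)\<^sup>2)"
  shows "integrable M (\<lambda>x. (q x - lin c x)\<^sup>2)"
    and "(\<integral>x. (q x - lin c x)\<^sup>2 \<partial>M)
      = (\<integral>x. (q x)\<^sup>2 \<partial>M) - (\<Sum>i\<in>I. (\<integral>x. q x * w i x \<partial>M)\<^sup>2) + (\<Sum>i\<in>I. (c i - (\<integral>x. q x * w i x \<partial>M))\<^sup>2)"
proof -
  have eq: "(q x - lin c x)\<^sup>2 = (q x)\<^sup>2 - 2 * (q x * lin c x) + (lin c x)\<^sup>2" for x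
    by (simp add: power2_eq_square algebra_simps)
  show "integrable M (\<lambda>x. (q x - lin c x)\<^sup>2)"
    unfolding eq using integrable_mult_lin(1)[OF q] q integrable_lin_sq by auto
  have "(\<integral>x. (q x - lin c x)\<^sup>2 \<partial>M)
      = (\<integral>x. (q x)\<^sup>2 \<partial>M) - 2 * (\<integral>x. q x * lin c x \<partial>M) + (\<integral>x. (lin c x)\<^sup>2 \<partial>M)"
    unfolding eq using integrable_mult_lin(1)[OF q] q integrable_lin_sq by simp
  also have "\<dots> = (\<integral>x. (q x)\<^sup>2 \<partial>M) - 2 * (\<Sum>i\<in>I. c i * (\<integral>x. q x * w i x \<partial>M)) + (\<Sum>i\<in>I. (c i)\<^sup>2)"
    by (simp add: integrable_mult_lin(2)[OF q] integral_lin_sq L2_set_def sum_nonneg)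
  moreover have "- 2 * (\<Sum>i\<in>I. c i * (\<integral>x. q x * w i x \<partial>M)) + (\<Sum>i\<in>I. (c i)\<^sup>2)
      = (\<Sum>i\<in>I. (c i - (\<integral>x. q x * w i x \<partial>M))\<^sup>2) - (\<Sum>i\<in>I. (\<integral>x. q x * w i x \<partial>M)\<^sup>2)"
    by (simp add: sum_distrib_left power2_eq_square algebra_simps flip: sum_subtractf sum.distrib)
  ultimately show "(\<integral>x. (q x - lin c x)\<^sup>2 \<partial>M)
      = (\<integral>x. (q x)\<^sup>2 \<partial>M) - (\<Sum>i\<in>I. (\<integral>x. q x * w i x \<partial>M)\<^sup>2) + (\<Sum>i\<in>I. (c i - (\<integral>x. q x * w i x \<partial>M))\<^sup>2)"
    by linarith
qed

lemma bessel:
  assumes q: "q \<in> borel_measurable M" "integrable M (\<lambda>x. (q x)\<^sup>2)"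
  shows "(\<Sum>i\<in>I. (\<integral>x. q x * w i x \<partial>M)\<^sup>2) \<le> (\<integral>x. (q x)\<^sup>2 \<partial>M)"
proof -
  have "0 \<le> (\<integral>x. (q x - lin (\<lambda>i. \<integral>x. q x * w i x \<partial>M) x)\<^sup>2 \<partial>M)" by simp
  then show ?thesis unfolding integral_diff_lin_sq(2)[OF q] by simp
qed

section \<open>Loss and coefficient bias around a bounded logarithm\<close>

context
  fixes g :: "'a \<Rightarrow> real" and a :: "'i \<Rightarrow> real" and B :: real
  assumes g [measurable]: "g \<in> borel_measurable M" and g_le: "AE x in M. \<bar>g x\<bar> \<le> B"
    and a_le: "\<And>x. x \<in> space M \<Longrightarrow> \<bar>lin a x\<bar> \<le> B"
begin

lemma integrable_g_bounded:
  assumes [measurable]: "f \<in> borel_measurable M" and "AE x in M. \<bar>f x\<bar> \<le> (C::real)"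
  shows "integrable M f"
  using assms by (intro integrable_const_bound[where B=C]) auto

lemma AE_exp_g_le: "AE x in M. exp (g x) \<le> exp B"
  using g_le by eventually_elim auto

lemma integrable_exp_g: "integrable M (\<lambda>x. exp (g x))"
  by (rule integrable_g_bounded[where C="exp B"]) (use AE_exp_g_le in auto)

lemma integrable_exp_g_mult_lin: "integrable M (\<lambda>x. exp (g x) * (g x - lin \<theta> x))"
proof (rule integrable_g_bounded[where C="exp B * (B + D * L2_set \<theta> I)"])
  show "AE x in M. \<bar>exp (g x) * (g x - lin \<theta> x)\<bar> \<le> exp B * (B + D * L2_set \<theta> I)"
    using g_le AE_space
  proof eventually_elim
    fix x assume "\<bar>g x\<bar> \<le> B" "x \<in> space M"
    then show "\<bar>exp (g x) * (g x - lin \<theta> x)\<bar> \<le> exp B * (B + D * L2_set \<theta> I)"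
      using abs_lin_le[of x \<theta>] unfolding abs_mult by (intro mult_mono) auto
  qed
qed auto

lemma integrable_KL: "integrable M (\<lambda>x. exp (g x) * (g x - lin \<theta> x) - exp (g x) + exp (lin \<theta> x))"
  using integrable_exp_g_mult_lin integrable_exp_g by auto

lemma integrable_g_sq: "integrable M (\<lambda>x. (g x)\<^sup>2)"
proof (rule integrable_g_bounded[where C="B\<^sup>2"])
  show "AE x in M. \<bar>(g x)\<^sup>2\<bar> \<le> B\<^sup>2" using g_le by eventually_elim (use power_mono[of "\<bar>_\<bar>" B 2] in simp)
qed auto

lemma integrable_exp_g_sq: "integrable M (\<lambda>x. (exp (g x))\<^sup>2)"
proof (rule integrable_g_bounded[where C="(exp B)\<^sup>2"])
  show "AE x in M. \<bar>(exp (g x))\<^sup>2\<bar> \<le> (exp B)\<^sup>2" using AE_exp_g_le by eventually_elim (auto simp: power_mono)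
qed auto

text \<open>The loss depends on \<theta> through the integral of \<open>exp (lin \<theta>)\<close>
  minus a linear term, so \<open>convexity\<close> bounds the increase from a to \<theta> by a
  pairing. At a solution this pairing is the parameter error times the error of the prescribed
  coefficients: already of second order.\<close>

lemma KL_projection_le:
  "(\<integral>x. exp (g x) * (g x - lin \<theta> x) - exp (g x) + exp (lin \<theta> x) \<partial>M)
    \<le> (\<integral>x. exp (g x) * (g x - lin a x) - exp (g x) + exp (lin a x) \<partial>M)
      + (\<Sum>i\<in>I. (\<theta> i - a i) * (coef \<theta> i - (\<integral>x. exp (g x) * w i x \<partial>M)))"
proof -
  note int = integrable_exp_g integrable_exp_g_mult_lin integrable_exp_lin
  have "(\<integral>x. exp (g x) * (g x - lin \<theta> x) - exp (g x) + exp (lin \<theta> x) \<partial>M)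
      - (\<integral>x. exp (g x) * (g x - lin a x) - exp (g x) + exp (lin a x) \<partial>M)
    = ((\<integral>x. exp (g x) * (g x - lin \<theta> x) \<partial>M) - (\<integral>x. exp (g x) * (g x - lin a x) \<partial>M))
      + ((\<integral>x. exp (lin \<theta> x) \<partial>M) - (\<integral>x. exp (lin a x) \<partial>M))"
    using int by simp
  also have "(\<integral>x. exp (g x) * (g x - lin \<theta> x) \<partial>M) - (\<integral>x. exp (g x) * (g x - lin a x) \<partial>M)
      = (\<integral>x. exp (g x) * (g x - lin \<theta> x) - exp (g x) * (g x - lin a x) \<partial>M)"
    by (rule Bochner_Integration.integral_diff[symmetric]) (rule int)+
  also have "\<dots> = (\<integral>x. exp (g x) * lin (\<lambda>i. a i - \<theta> i) x \<partial>M)"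
    by (simp add: lin_diff algebra_simps)
  also have "\<dots> = (\<Sum>i\<in>I. (a i - \<theta> i) * (\<integral>x. exp (g x) * w i x \<partial>M))"
    by (rule integrable_mult_lin(2)) (auto simp: integrable_exp_g_sq)
  finally show ?thesis
    using convexity[of \<theta> a] by (simp add: right_diff_distrib left_diff_distrib sum_subtractf)
qed

text \<open>The integrand is the Taylor remainder of \<open>exp\<close> between \<open>g x\<close>
  and \<open>lin a x\<close>, both bounded by \<open>B\<close>.\<close>

lemma KL_approx_le:
  "(\<integral>x. exp (g x) * (g x - lin a x) - exp (g x) + exp (lin a x) \<partial>M) \<le> exp B * (\<integral>x. (g x - lin a x)\<^sup>2 \<partial>M)"
proof -
  have "(\<integral>x. exp (g x) * (g x - lin a x) - exp (g x) + exp (lin a x) \<partial>M)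
      \<le> (\<integral>x. exp B * (g x - lin a x)\<^sup>2 \<partial>M)"
  proof (rule integral_mono_AE[OF integrable_KL])
    show "integrable M (\<lambda>x. exp B * (g x - lin a x)\<^sup>2)"
      using integral_diff_lin_sq(1)[OF g integrable_g_sq] by auto
    show "AE x in M. exp (g x) * (g x - lin a x) - exp (g x) + exp (lin a x) \<le> exp B * (g x - lin a x)\<^sup>2"
      using g_le AE_space
    proof eventually_elim
      fix x assume "\<bar>g x\<bar> \<le> B" "x \<in> space M"
      then show "exp (g x) * (g x - lin a x) - exp (g x) + exp (lin a x) \<le> exp B * (g x - lin a x)\<^sup>2"
        using exp_taylor_le[of "g x" B "lin a x"] a_le[of x]
        by (simp add: abs_le_iff right_diff_distrib power2_commute)
    qed
  qed
  then show ?thesis by simp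
qed

text \<open>Bessel's inequality for exp g - exp(lin a), then the Lipschitz bound for
  \<open>exp\<close>. Bounding the coefficients one at a time would cost a factor growing with the
  dimension.\<close>

lemma coef_approx_le:
  "(\<Sum>i\<in>I. ((\<integral>x. exp (g x) * w i x \<partial>M) - coef a i)\<^sup>2) \<le> (exp B)\<^sup>2 * (\<integral>x. (g x - lin a x)\<^sup>2 \<partial>M)"
proof -
  define q where "q = (\<lambda>x. exp (g x) - exp (lin a x))"
  have q [measurable]: "q \<in> borel_measurable M" unfolding q_def by measurable
  have le: "AE x in M. (q x)\<^sup>2 \<le> (exp B)\<^sup>2 * (g x - lin a x)\<^sup>2"
    using g_le AE_space
  proof eventually_elim
    fix x assume "\<bar>g x\<bar> \<le> B" "x \<in> space M"
    then have "\<bar>q x\<bar> \<le> exp B * \<bar>g x - lin a x\<bar>"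
      unfolding q_def using a_le[of x] by (intro abs_exp_diff_le) (auto simp: abs_le_iff)
    from power_mono[OF this, of 2] show "(q x)\<^sup>2 \<le> (exp B)\<^sup>2 * (g x - lin a x)\<^sup>2"
      by (simp add: power_mult_distrib)
  qed
  have int: "integrable M (\<lambda>x. (exp B)\<^sup>2 * (g x - lin a x)\<^sup>2)"
    using integral_diff_lin_sq(1)[OF g integrable_g_sq] by auto
  have qsq: "integrable M (\<lambda>x. (q x)\<^sup>2)"
    by (rule Bochner_Integration.integrable_bound[OF int]) (use le in auto)
  have "(\<integral>x. exp (g x) * w i x \<partial>M) - coef a i = (\<integral>x. q x * w i x \<partial>M)" if "i \<in> I" for i
    unfolding coef_def q_def left_diff_distrib
    using integrable_mult_w[OF _ integrable_exp_g_sq that] that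
    by (intro Bochner_Integration.integral_diff[symmetric]) auto
  then have "(\<Sum>i\<in>I. ((\<integral>x. exp (g x) * w i x \<partial>M) - coef a i)\<^sup>2) = (\<Sum>i\<in>I. (\<integral>x. q x * w i x \<partial>M)\<^sup>2)"
    by simp
  also have "\<dots> \<le> (\<integral>x. (q x)\<^sup>2 \<partial>M)" by (rule bessel[OF q qsq])
  also have "\<dots> \<le> (\<integral>x. (exp B)\<^sup>2 * (g x - lin a x)\<^sup>2 \<partial>M)"
    by (rule integral_mono_AE[OF qsq int le])
  finally show ?thesis by simp
qed

end

end

section \<open>Wavelet approximation\<close>

lemma prob_space_unit_leb: "prob_space unit_leb"
  by (rule prob_spaceI) (simp add: emeasure_restrict_space)

lemma sum_int_points_le:
  fixes R y :: real
  assumes "0 \<le> R"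
  shows "finite {n::int. \<bar>y + of_int n\<bar> \<le> R}" "real (card {n::int. \<bar>y + of_int n\<bar> \<le> R}) \<le> 2 * R + 1"
proof -
  have eq: "{n::int. \<bar>y + of_int n\<bar> \<le> R} = {\<lceil>- R - y\<rceil>..\<lfloor>R - y\<rfloor>}"
    by (auto simp: le_floor_iff ceiling_le_iff abs_le_iff)
  show "finite {n::int. \<bar>y + of_int n\<bar> \<le> R}" unfolding eq by simp
  show "real (card {n::int. \<bar>y + of_int n\<bar> \<le> R}) \<le> 2 * R + 1"
    unfolding eq using assms by simp linarith
qed

text \<open>Shift and wrapping combine into the integer 2^j l - k, by which 2^j x is translated.
  Only the at most 2 R + 1 integers that bring 2^j x into the support contribute, whatever j and x
  are.\<close>

lemma sum_abs_dilate_le: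
  assumes bd: "bounded (range u)" and supp: "compact (closure {x. u x \<noteq> 0})"
  obtains A where "0 < A" "\<And>j x. (\<Sum>k<2 ^ j. \<bar>dilate u j k x\<bar>) \<le> A * 2 powr (real j / 2)"
proof -
  obtain b where b: "\<And>x. \<bar>u x\<bar> \<le> b" using bd unfolding bounded_iff by auto
  have "bounded {x. u x \<noteq> 0}"
    using compact_imp_bounded[OF supp] closure_subset by (rule bounded_subset)
  then obtain R0 where R0: "\<And>x. u x \<noteq> 0 \<Longrightarrow> \<bar>x\<bar> \<le> R0" unfolding bounded_iff by auto
  define R where "R = max 0 R0"
  have R: "0 \<le> R" "\<And>x. u x \<noteq> 0 \<Longrightarrow> \<bar>x\<bar> \<le> R" using R0 by (auto simp: R_def intro: max.coboundedI2)
  have b0: "0 \<le> b" using b[of 0] by linarith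
  \<comment> \<open>The added 1 makes \<open>A\<close> positive even if \<open>u\<close> vanishes
    identically.\<close>
  define A where "A = b * (2 * R + 1) + 1"
  show thesis
  proof
    show "0 < A" using b0 R(1) by (simp add: A_def add_nonneg_pos)
    fix j :: nat and x :: real
    define y where "y = 2 ^ j * x"
    define N where "N = {n::int. \<bar>y + of_int n\<bar> \<le> R}"
    note N = sum_int_points_le[OF R(1), of y, folded N_def]
    define S where "S = (\<lambda>k::nat. {l::int. 2 ^ j * l - int k \<in> N})"
    have finS: "finite (S k)" for k
    proof -
      have "inj (\<lambda>l::int. 2 ^ j * l - int k)" by (auto intro!: injI)
      from finite_vimageI[OF N(1) this] show ?thesis by (simp add: S_def vimage_def)
    qed
    have zero: "u (2 ^ j * (x + of_int l) - real k) = 0" if "l \<notin> S k" for l k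
    proof (rule ccontr)
      assume "u (2 ^ j * (x + of_int l) - real k) \<noteq> 0"
      from R(2)[OF this] have "\<bar>y + of_int (2 ^ j * l - int k)\<bar> \<le> R"
        by (simp add: y_def algebra_simps)
      then show False using that by (simp add: S_def N_def)
    qed
    have "\<bar>dilate u j k x\<bar> \<le> real (card (S k)) * (2 powr (real j / 2) * b)" for k
    proof -
      have "dilate u j k x = (\<Sum>\<^sub>\<infinity>l\<in>S k. 2 powr (real j / 2) * u (2 ^ j * (x + of_int l) - real k))"
        unfolding dilate_def by (rule infsum_cong_neutral) (auto simp: zero)
      also have "\<dots> = (\<Sum>l\<in>S k. 2 powr (real j / 2) * u (2 ^ j * (x + of_int l) - real k))"
        by (simp add: finS)
      finally have "\<bar>dilate u j k x\<bar> \<le> (\<Sum>l\<in>S k. \<bar>2 powr (real j / 2) * u (2 ^ j * (x + of_int l) - real k)\<bar>)"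
        by simp
      also have "\<dots> \<le> (\<Sum>l\<in>S k. 2 powr (real j / 2) * b)"
        by (intro sum_mono) (simp add: abs_mult b)
      finally show ?thesis by simp
    qed
    then have "(\<Sum>k<2 ^ j. \<bar>dilate u j k x\<bar>) \<le> (\<Sum>k<2 ^ j. real (card (S k)) * (2 powr (real j / 2) * b))"
      by (intro sum_mono)
    also have "\<dots> = real (\<Sum>k<2 ^ j. card (S k)) * (2 powr (real j / 2) * b)"
      by (simp add: sum_distrib_right)
    also have "(\<Sum>k<2 ^ j. card (S k)) = card (Sigma {..<2 ^ j} S)"
      using finS by simp
    also have "\<dots> \<le> card N"
    proof (rule card_inj_on_le[OF _ _ N(1)])
      \<comment> \<open>Uniqueness of division by 2^j: k - k' is a multiple of 2^j of absolute value
        below 2^j.\<close>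
      show "inj_on (\<lambda>(k, l). 2 ^ j * l - int k) (Sigma {..<2 ^ j} S)"
      proof (rule inj_onI, clarsimp)
        fix k l k' l'
        assume k: "k < 2 ^ j" "k' < 2 ^ j" and e: "2 ^ j * l - int k = 2 ^ j * l' - int k'"
        have "int k - int k' = 2 ^ j * (l - l')" using e by (simp add: algebra_simps)
        moreover have "\<bar>int k - int k'\<bar> < 2 ^ j" using k by (simp add: abs_less_iff)
          (metis (no_types) less_diff_eq of_nat_0_le_iff add_strict_increasing2 add.commute diff_less_eq of_nat_less_numeral_power_cancel_iff of_nat_numeral of_nat_power of_nat_less_iff)
        ultimately have "\<bar>2 ^ j * (l - l')\<bar> < 2 ^ j" by simp
        then have "\<bar>l - l'\<bar> < 1" by (simp add: abs_mult)
        then show "k = k' \<and> l = l'" using \<open>int k - int k' = 2 ^ j * (l - l')\<close> by simp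
      qed
      show "(\<lambda>(k, l). 2 ^ j * l - int k) ` Sigma {..<2 ^ j} S \<subseteq> N" by (auto simp: S_def)
    qed
    finally have "(\<Sum>k<2 ^ j. \<bar>dilate u j k x\<bar>) \<le> real (card N) * (2 powr (real j / 2) * b)"
      using b0 by (simp add: mult_right_mono)
    also have "\<dots> \<le> (2 * R + 1) * (2 powr (real j / 2) * b)"
      using N(2) b0 by (intro mult_right_mono) auto
    also have "\<dots> \<le> A * 2 powr (real j / 2)"
      by (simp add: A_def algebra_simps)
    finally show "(\<Sum>k<2 ^ j. \<bar>dilate u j k x\<bar>) \<le> A * 2 powr (real j / 2)" .
  qed
qed

section \<open>Multiscale index sets; the wavelets as an exponential family\<close>

lemma sum_sq_le_square_sum_abs: "finite S \<Longrightarrow> (\<Sum>i\<in>S. (f i)\<^sup>2) \<le> (\<Sum>i\<in>S. \<bar>f i\<bar> :: real)\<^sup>2"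
  using L2_set_le_sum_abs[of f S] power_mono[of "L2_set f S" "\<Sum>i\<in>S. \<bar>f i\<bar>" 2]
  by (simp add: L2_set_def sum_nonneg)

lemma trunc_index_0: "trunc_index 0 0 = {(-1, 0)}"
  by (auto simp: trunc_index_def full_index_def)

lemma trunc_index_Suc: "trunc_index 0 (Suc J) = trunc_index 0 J \<union> Pair (int J) ` {..<2 ^ J}"
proof (intro equalityI subsetI)
  fix i assume i: "i \<in> trunc_index 0 (Suc J)"
  obtain j k where jk: "i = (j, k)" by (cases i)
  show "i \<in> trunc_index 0 J \<union> Pair (int J) ` {..<2 ^ J}"
    using i unfolding jk by (cases "j = int J") (auto simp: trunc_index_def full_index_def)
qed (auto simp: trunc_index_def full_index_def)

lemma finite_trunc_index [simp]: "finite (trunc_index 0 J)"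
  by (induction J) (simp_all add: trunc_index_0 trunc_index_Suc)

lemma sum_trunc_index_Suc:
  "sum F (trunc_index 0 (Suc J)) = sum F (trunc_index 0 J) + (\<Sum>k<2 ^ J. F (int J, k))"
proof -
  have "trunc_index 0 J \<inter> Pair (int J) ` {..<2 ^ J} = {}" by (auto simp: trunc_index_def)
  then show ?thesis
    by (simp add: trunc_index_Suc sum.union_disjoint sum.reindex inj_on_def)
qed

lemma sum_trunc_index: "sum F (trunc_index 0 J) = F (-1, 0) + (\<Sum>j<J. \<Sum>k<2 ^ j. F (int j, k))"
  by (induction J) (simp_all add: trunc_index_0 sum_trunc_index_Suc add.assoc)

lemma card_trunc_index: "card (trunc_index 0 J) = 2 ^ J"
proof -
  have "card (trunc_index 0 J) = 1 + (\<Sum>j<J. 2 ^ j)"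
    using sum_trunc_index[of "\<lambda>_. 1::nat" J] by simp
  also have "\<dots> = 2 ^ J" by (induction J) auto
  finally show ?thesis .
qed

lemma trunc_index_subset: "trunc_index 0 J \<subseteq> full_index 0"
  by (auto simp: trunc_index_def)

lemma finite_subset_trunc_index:
  assumes "finite S" "S \<subseteq> full_index 0"
  obtains J' where "J \<le> J'" "S \<subseteq> trunc_index 0 J'"
proof -
  define J' where "J' = max J (nat (Max (insert 0 (fst ` S)) + 1))"
  have "fst i < int J'" if "i \<in> S" for i
  proof -
    have "fst i \<le> Max (insert 0 (fst ` S))" using that assms(1) by (intro Max_ge) auto
    then show ?thesis unfolding J'_def by linarith
  qed
  then have "S \<subseteq> trunc_index 0 J'" using assms(2) by (auto simp: trunc_index_def)
  then show thesis using that[of J'] by (auto simp: J'_def)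
qed

lemma wavelet_of_nat [simp]: "wavelet \<phi> \<psi> 0 (int j, k) = dilate \<psi> j k"
  by (simp add: wavelet_def)

lemma wavelet_minus_one [simp]: "wavelet \<phi> \<psi> 0 (-1, k) = dilate \<phi> 0 k"
  by (simp add: wavelet_def)

locale wavelet_basis =
  fixes \<phi> \<psi> :: "real \<Rightarrow> real" and A :: real
  assumes basis: "orthonormal_basis (full_index 0) (wavelet \<phi> \<psi> 0)"
    and A_pos: "0 < A"
    and dilate_le: "\<And>j x. (\<Sum>k<2 ^ j. (dilate \<psi> j k x)\<^sup>2) \<le> A\<^sup>2 * 2 ^ j" "\<And>x. (dilate \<phi> 0 0 x)\<^sup>2 \<le> A\<^sup>2"
begin

abbreviation "W \<equiv> wavelet \<phi> \<psi> 0"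

abbreviation "D J \<equiv> A * sqrt (2 ^ J)"

text \<open>The scaling function and the levels below J contribute 1 + (1 + 2 + ... + 2^(J-1)) = 2^J
  times A^2, which is where \<open>D J\<close> comes from.\<close>

lemma sum_W_sq_le: "(\<Sum>i\<in>trunc_index 0 J. (W i x)\<^sup>2) \<le> (D J)\<^sup>2"
proof -
  have "(\<Sum>i\<in>trunc_index 0 J. (W i x)\<^sup>2) \<le> A\<^sup>2 * 2 ^ J"
  proof (induction J)
    case 0 then show ?case using dilate_le(2)[of x] by (simp add: trunc_index_0)
  next
    case (Suc J)
    then show ?case using dilate_le(1)[of J x] unfolding sum_trunc_index_Suc by simp
  qed
  then show ?thesis by (simp add: power_mult_distrib)
qed

lemma W_L2: "i \<in> full_index 0 \<Longrightarrow> W i \<in> L2_unit"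
  and W_orthonormal: "i \<in> full_index 0 \<Longrightarrow> j \<in> full_index 0 \<Longrightarrow> ip (W i) (W j) = (if i = j then 1 else 0)"
  using basis by (auto simp: orthonormal_basis_def orthonormal_family_def)

lemma finite_exp_family: "finite_exp_family unit_leb (trunc_index 0 J) W (D J)"
proof -
  interpret prob_space unit_leb by (rule prob_space_unit_leb)
  show ?thesis
  proof unfold_locales
    fix i j assume i: "i \<in> trunc_index 0 J"
    then have i': "i \<in> full_index 0" using trunc_index_subset by blast
    from W_L2[OF i'] show "W i \<in> borel_measurable unit_leb" by (simp add: L2_unit_def)
    assume "j \<in> trunc_index 0 J"
    then have "j \<in> full_index 0" using trunc_index_subset by blast
    from W_orthonormal[OF i' this] show "(\<integral>x. W i x * W j x \<partial>unit_leb) = (if i = j then 1 else 0)"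
      by (simp only: ip_def)
  qed (use sum_W_sq_le A_pos in simp_all)
qed

sublocale F: finite_exp_family unit_leb "trunc_index 0 J" W "D J" for J
  by (rule finite_exp_family)

end

lemma wavelet_system_basis:
  assumes "wavelet_system \<phi> \<psi> m"
  obtains A where "wavelet_basis \<phi> \<psi> A"
proof -
  have b: "bounded (range \<phi>)" "bounded (range \<psi>)"
    "compact (closure {x. \<phi> x \<noteq> 0})" "compact (closure {x. \<psi> x \<noteq> 0})"
    and basis: "orthonormal_basis (full_index 0) (wavelet \<phi> \<psi> 0)"
    using assms by (auto simp: wavelet_system_def)
  obtain A1 where A1: "0 < A1" "\<And>j x. (\<Sum>k<2 ^ j. \<bar>dilate \<phi> j k x\<bar>) \<le> A1 * 2 powr (real j / 2)"
    using sum_abs_dilate_le[OF b(1,3)] by blast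
  obtain A2 where A2: "0 < A2" "\<And>j x. (\<Sum>k<2 ^ j. \<bar>dilate \<psi> j k x\<bar>) \<le> A2 * 2 powr (real j / 2)"
    using sum_abs_dilate_le[OF b(2,4)] by blast
  define A where "A = max A1 A2"
  have A: "(\<Sum>k<2 ^ j. \<bar>dilate \<phi> j k x\<bar>) \<le> A * 2 powr (real j / 2)"
    "(\<Sum>k<2 ^ j. \<bar>dilate \<psi> j k x\<bar>) \<le> A * 2 powr (real j / 2)" for j x
    by (rule order_trans[OF A1(2)] order_trans[OF A2(2)], simp add: A_def)+
  have "(\<Sum>k<2 ^ j. (dilate \<psi> j k x)\<^sup>2) \<le> A\<^sup>2 * 2 ^ j" for j x
  proof -
    have "(\<Sum>k<2 ^ j. (dilate \<psi> j k x)\<^sup>2) \<le> (\<Sum>k<2 ^ j. \<bar>dilate \<psi> j k x\<bar>)\<^sup>2"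
      by (rule sum_sq_le_square_sum_abs) simp
    also have "\<dots> \<le> (A * 2 powr (real j / 2))\<^sup>2"
      by (intro power_mono A sum_nonneg) auto
    also have "\<dots> = A\<^sup>2 * 2 ^ j"
      by (simp add: power_mult_distrib powr_power powr_realpow)
    finally show ?thesis .
  qed
  moreover have "(dilate \<phi> 0 0 x)\<^sup>2 \<le> A\<^sup>2" for x
    using A(1)[of 0 x] power_mono[of "\<bar>dilate \<phi> 0 0 x\<bar>" A 2] by simp
  moreover have "0 < A" using A1(1) by (simp add: A_def)
  ultimately have "wavelet_basis \<phi> \<psi> A" using basis by unfold_locales auto
  then show thesis by (rule that)
qed

text \<open>For p = q = 2 the exponent \<open>sstar s 2\<close> is \<open>s\<close>, so the norm is
  a weighted l2 norm. Only partial sums are recorded, as all later uses concern finitely many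
  levels.\<close>

lemma besov_22_bounds:
  assumes fin: "besov_finite \<psi> s 2 2 g" and norm: "besov_norm \<phi> \<psi> s 2 2 g \<le> M"
  shows "\<bar>ip g (dilate \<phi> 0 0)\<bar> \<le> M"
    and "finite F \<Longrightarrow> (\<Sum>j\<in>F. 2 powr (2 * real j * s) * (\<Sum>k<2 ^ j. (ip g (dilate \<psi> j k))\<^sup>2)) \<le> M\<^sup>2"
proof -
  define L where "L = (\<lambda>j. 2 powr (2 * real j * s) * (\<Sum>k<2 ^ j. (ip g (dilate \<psi> j k))\<^sup>2))"
  have "level_term \<psi> s 2 2 g = L"
    by (intro ext) (simp add: level_term_def sstar_def L_def powr_one sum_nonneg mult.commute mult.left_commute)
  then have sL: "summable L" and nL: "\<bar>ip g (dilate \<phi> 0 0)\<bar> + sqrt (suminf L) \<le> M"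
    using fin norm by (auto simp: besov_finite_def besov_norm_def powr_half_sqrt suminf_nonneg L_def sum_nonneg)
  have L0: "0 \<le> L j" for j by (simp add: L_def sum_nonneg)
  have s0: "0 \<le> suminf L" by (rule suminf_nonneg[OF sL L0])
  show "\<bar>ip g (dilate \<phi> 0 0)\<bar> \<le> M" using nL real_sqrt_ge_zero[OF s0] by linarith
  assume "finite F"
  then have "sum L F \<le> suminf L" by (intro sum_le_suminf sL) (auto simp: L0)
  also have "\<dots> \<le> M\<^sup>2"
    using nL power_mono[of "sqrt (suminf L)" M 2] s0 by simp
  finally show "(\<Sum>j\<in>F. 2 powr (2 * real j * s) * (\<Sum>k<2 ^ j. (ip g (dilate \<psi> j k))\<^sup>2)) \<le> M\<^sup>2"
    by (simp add: L_def)
qed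

section \<open>Sup bound and approximation rate on the Besov ball\<close>

context wavelet_basis
begin

text \<open>The scaling function contributes M A, and the levels a geometric series of ratio 2^(1/2
  - s), convergent since s > 1/2.\<close>

definition sup_bound :: "real \<Rightarrow> real \<Rightarrow> real" where
  "sup_bound s M = M * A * (1 + 1 / (1 - 2 powr (1/2 - s)))"

text \<open>Cauchy-Schwarz on each level: the coefficients have l2 norm at most M 2^(-js), the
  wavelets at a point at most A 2^(j/2).\<close>

lemma abs_lin_besov_le:
  assumes s: "1/2 < s" and M: "0 < M"
    and fin: "besov_finite \<psi> s 2 2 g" and norm: "besov_norm \<phi> \<psi> s 2 2 g \<le> M"
  shows "\<bar>F.lin J (\<lambda>i. ip g (W i)) x\<bar> \<le> sup_bound s M"
proof -
  note b = besov_22_bounds[OF fin norm]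
  define q where "q = 2 powr (1/2 - s)"
  have q: "0 \<le> q" "q < 1" using s powr_less_mono[of "1/2 - s" 0 2] by (simp_all add: q_def)
  have lev: "\<bar>\<Sum>k<2 ^ j. ip g (dilate \<psi> j k) * dilate \<psi> j k x\<bar> \<le> M * A * q ^ j" for j
  proof -
    define e where "e = (\<Sum>k<2 ^ j. (ip g (dilate \<psi> j k))\<^sup>2)"
    have "2 powr (2 * real j * s) * e \<le> M\<^sup>2" using b(2)[of "{j}"] by (simp add: e_def)
    moreover have "2 powr (2 * real j * s) = (2 powr (real j * s))\<^sup>2"
      by (simp add: powr_power mult.commute mult.left_commute)
    ultimately have "e \<le> (M * 2 powr (- (real j * s)))\<^sup>2"
      by (simp add: powr_minus power_mult_distrib field_simps)
    then have e: "sqrt e \<le> M * 2 powr (- (real j * s))"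
      using M by (intro real_le_lsqrt) (auto simp: e_def sum_nonneg)
    have w: "sqrt (\<Sum>k<2 ^ j. (dilate \<psi> j k x)\<^sup>2) \<le> A * 2 powr (real j / 2)"
      using dilate_le(1)[of j x] A_pos
      by (intro real_le_lsqrt) (auto simp: sum_nonneg power_mult_distrib powr_power powr_realpow)
    have "\<bar>\<Sum>k<2 ^ j. ip g (dilate \<psi> j k) * dilate \<psi> j k x\<bar>
        \<le> (\<Sum>k<2 ^ j. \<bar>ip g (dilate \<psi> j k)\<bar> * \<bar>dilate \<psi> j k x\<bar>)"
      by (rule order_trans[OF sum_abs]) (simp add: abs_mult)
    also have "\<dots> \<le> L2_set (\<lambda>k. ip g (dilate \<psi> j k)) {..<2 ^ j} * L2_set (\<lambda>k. dilate \<psi> j k x) {..<2 ^ j}"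
      by (rule L2_set_mult_ineq)
    also have "\<dots> \<le> (M * 2 powr (- (real j * s))) * (A * 2 powr (real j / 2))"
      using e w M by (intro mult_mono) (auto simp: L2_set_def e_def sum_nonneg)
    also have "\<dots> = M * A * (2 powr (- (real j * s)) * 2 powr (real j / 2))"
      by simp
    also have "2 powr (- (real j * s)) * 2 powr (real j / 2) = q ^ j"
      by (simp add: q_def powr_power algebra_simps flip: powr_add)
    finally show ?thesis .
  qed
  have "\<bar>F.lin J (\<lambda>i. ip g (W i)) x\<bar> \<le> \<bar>ip g (dilate \<phi> 0 0) * dilate \<phi> 0 0 x\<bar>
      + (\<Sum>j<J. \<bar>\<Sum>k<2 ^ j. ip g (dilate \<psi> j k) * dilate \<psi> j k x\<bar>)"
    unfolding F.lin_def sum_trunc_index by (simp add: order_trans[OF abs_triangle_ineq] sum_abs)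
  also have "\<dots> \<le> M * A + (\<Sum>j<J. M * A * q ^ j)"
    using b(1) dilate_le(2)[of x, folded abs_le_square_iff] A_pos M lev
    by (intro add_mono sum_mono) (auto simp: abs_mult intro!: mult_mono)
  also have "(\<Sum>j<J. M * A * q ^ j) = M * A * (\<Sum>j<J. q ^ j)" by (simp add: sum_distrib_left)
  also have "(\<Sum>j<J. q ^ j) \<le> 1 / (1 - q)"
    using sum_le_suminf[of "\<lambda>j. q ^ j" "{..<J}"] q by (simp add: suminf_geometric summable_geometric)
  finally show ?thesis using M A_pos by (simp add: sup_bound_def q_def algebra_simps)
qed

text \<open>Completeness only provides some finite combination close to g. Enlarging its index set
  to all levels below some J', optimality of the true coefficients makes the error at J' at most
  \<epsilon>, and the errors at J and J' differ by the finite block of levels between them.\<close>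

lemma lin_approx_le:
  assumes s: "1/2 < s" and g: "g \<in> L2_unit"
    and fin: "besov_finite \<psi> s 2 2 g" and norm: "besov_norm \<phi> \<psi> s 2 2 g \<le> M"
  shows "(\<integral>x. (g x - F.lin J (\<lambda>i. ip g (W i)) x)\<^sup>2 \<partial>unit_leb) \<le> M\<^sup>2 * 2 powr (- 2 * real J * s)"
proof -
  note b = besov_22_bounds[OF fin norm]
  have gm: "g \<in> borel_measurable unit_leb" "integrable unit_leb (\<lambda>x. (g x)\<^sup>2)"
    using g by (auto simp: L2_unit_def)
  define a where "a = (\<lambda>i. ip g (W i))"
  define E where "E = (\<lambda>J. \<integral>x. (g x - F.lin J a x)\<^sup>2 \<partial>unit_leb)"
  have E: "E J = (\<integral>x. (g x)\<^sup>2 \<partial>unit_leb) - (\<Sum>i\<in>trunc_index 0 J. (a i)\<^sup>2)" for J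
    unfolding E_def F.integral_diff_lin_sq(2)[OF gm] by (simp add: a_def ip_def)
  have best: "E J \<le> (\<integral>x. (g x - F.lin J c x)\<^sup>2 \<partial>unit_leb)" for J c
    unfolding E F.integral_diff_lin_sq(2)[OF gm] by (simp add: a_def ip_def sum_nonneg)
  have "E J \<le> M\<^sup>2 * 2 powr (- 2 * real J * s) + \<epsilon>" if "0 < \<epsilon>" for \<epsilon>
  proof -
    obtain S c where S: "finite S" "S \<subseteq> full_index 0"
      and dist: "L2_dist g (\<lambda>x. \<Sum>i\<in>S. c i * W i x) < sqrt \<epsilon>"
      using basis g \<open>0 < \<epsilon>\<close> unfolding orthonormal_basis_def by (meson real_sqrt_gt_zero)
    obtain J' where J': "J \<le> J'" "S \<subseteq> trunc_index 0 J'"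
      using finite_subset_trunc_index[OF S] by blast
    define c' where "c' = (\<lambda>i. if i \<in> S then c i else 0)"
    have "F.lin J' c' x = (\<Sum>i\<in>S. c i * W i x)" for x
      unfolding F.lin_def by (rule sum.mono_neutral_cong_right) (use J' in \<open>auto simp: c'_def\<close>)
    with best[of J' c'] dist have "E J' \<le> \<epsilon>" by (simp add: L2_dist_def)
    have diff: "E J = E J' + (\<Sum>j\<in>{J..<J'}. \<Sum>k<2 ^ j. (a (int j, k))\<^sup>2)"
      using sum.atLeastLessThan_concat[of 0 J J' "\<lambda>j. \<Sum>k<2 ^ j. (a (int j, k))\<^sup>2"] J'(1)
      unfolding E sum_trunc_index by (simp add: lessThan_atLeast0)
    also have "(\<Sum>j\<in>{J..<J'}. \<Sum>k<2 ^ j. (a (int j, k))\<^sup>2)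
        \<le> (\<Sum>j\<in>{J..<J'}. 2 powr (- 2 * real J * s) * (2 powr (2 * real j * s) * (\<Sum>k<2 ^ j. (a (int j, k))\<^sup>2)))"
    proof (intro sum_mono)
      fix j assume "j \<in> {J..<J'}"
      then have "real J * s \<le> real j * s" using s by (intro mult_right_mono) auto
      \<comment> \<open>On the levels j >= J the Besov weight is at least its value at J, so
        inserting the quotient of the two only increases the block.\<close>
      then have "1 \<le> 2 powr (- 2 * real J * s) * 2 powr (2 * real j * s)"
        unfolding powr_add[symmetric] by (intro ge_one_powr_ge_zero) auto
      then have "1 * (\<Sum>k<2 ^ j. (a (int j, k))\<^sup>2)
          \<le> (2 powr (- 2 * real J * s) * 2 powr (2 * real j * s)) * (\<Sum>k<2 ^ j. (a (int j, k))\<^sup>2)"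
        by (intro mult_right_mono sum_nonneg) auto
      then show "(\<Sum>k<2 ^ j. (a (int j, k))\<^sup>2)
          \<le> 2 powr (- 2 * real J * s) * (2 powr (2 * real j * s) * (\<Sum>k<2 ^ j. (a (int j, k))\<^sup>2))"
        by (simp add: mult.assoc)
    qed
    also have "\<dots> \<le> 2 powr (- 2 * real J * s) * M\<^sup>2"
      unfolding sum_distrib_left[symmetric] using b(2)[of "{J..<J'}"]
      by (intro mult_left_mono) (auto simp: a_def)
    finally show ?thesis using \<open>E J' \<le> \<epsilon>\<close> by (simp add: mult.commute)
  qed
  then have "E J \<le> M\<^sup>2 * 2 powr (- 2 * real J * s)" by (rule field_le_epsilon)
  then show ?thesis by (simp add: E_def a_def)
qed

text \<open>L2 convergence of the partial sums suffices, without a subsequence: the squared excess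
  of |g| over the bound is at most (g - g_J)^2 for every J, so its integral is 0.\<close>

lemma AE_abs_besov_le:
  assumes s: "1/2 < s" and M: "0 < M" and g: "g \<in> L2_unit"
    and fin: "besov_finite \<psi> s 2 2 g" and norm: "besov_norm \<phi> \<psi> s 2 2 g \<le> M"
  shows "AE x in unit_leb. \<bar>g x\<bar> \<le> sup_bound s M"
proof -
  have gm [measurable]: "g \<in> borel_measurable unit_leb" and g2: "integrable unit_leb (\<lambda>x. (g x)\<^sup>2)"
    using g by (auto simp: L2_unit_def)
  define B where "B = sup_bound s M"
  define h where "h = (\<lambda>x. (max 0 (\<bar>g x\<bar> - B))\<^sup>2)"
  have B0: "0 \<le> B" using abs_lin_besov_le[OF s M fin norm, of 0 0] by (simp add: B_def)
  have le: "h x \<le> (g x - F.lin J (\<lambda>i. ip g (W i)) x)\<^sup>2" for x J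
  proof -
    have "max 0 (\<bar>g x\<bar> - B) \<le> \<bar>g x - F.lin J (\<lambda>i. ip g (W i)) x\<bar>"
      using abs_lin_besov_le[OF s M fin norm, of J x] by (auto simp: B_def)
    from power_mono[OF this, of 2] show ?thesis by (simp add: h_def)
  qed
  have int: "integrable unit_leb h"
  proof (rule Bochner_Integration.integrable_bound[OF g2])
    show "AE x in unit_leb. norm (h x) \<le> norm ((g x)\<^sup>2)"
    proof (intro AE_I2)
      fix x
      have "max 0 (\<bar>g x\<bar> - B) \<le> \<bar>g x\<bar>" using B0 by auto
      from power_mono[OF this, of 2] show "norm (h x) \<le> norm ((g x)\<^sup>2)" by (simp add: h_def)
    qed
  qed (simp add: h_def)
  have "integral\<^sup>L unit_leb h \<le> M\<^sup>2 * 2 powr (- 2 * real J * s)" for J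
  proof -
    have "integral\<^sup>L unit_leb h \<le> (\<integral>x. (g x - F.lin J (\<lambda>i. ip g (W i)) x)\<^sup>2 \<partial>unit_leb)"
      by (intro integral_mono int F.integral_diff_lin_sq(1) gm g2 le)
    also note lin_approx_le[OF s g fin norm]
    finally show ?thesis .
  qed
  moreover have "(\<lambda>J. M\<^sup>2 * 2 powr (- 2 * real J * s)) \<longlonglongrightarrow> 0"
  proof -
    have "2 powr (- 2 * real J * s) = (2 powr (- 2 * s)) ^ J" for J
      by (simp add: powr_power algebra_simps)
    moreover have "(\<lambda>J. (2 powr (- 2 * s)) ^ J) \<longlonglongrightarrow> 0"
      using s powr_less_mono[of "- 2 * s" 0 2] by (intro LIMSEQ_realpow_zero) auto
    ultimately show ?thesis by (simp add: tendsto_mult_right_zero)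
  qed
  ultimately have "integral\<^sup>L unit_leb h \<le> 0" by (intro LIMSEQ_le_const) auto
  moreover have "0 \<le> integral\<^sup>L unit_leb h" by (simp add: h_def)
  ultimately have "AE x in unit_leb. h x = 0"
    using integral_nonneg_eq_0_iff_AE[OF int] by (simp add: h_def antisym)
  then show ?thesis by eventually_elim (auto simp: h_def B_def max_def split: if_splits)
qed

end

section \<open>Quadratic forms in Gaussian vectors\<close>

text \<open>Both sides of the kurtosis identity vanish for a constant variable, so later arguments
  need not separate degenerate linear combinations.\<close>

lemma (in prob_space) gaussian_central_moments:
  assumes "gaussian_rv M Z"
  shows "integrable M Z"
    and "integrable M (\<lambda>w. (Z w - expectation Z) ^ 4)"
    and "expectation (\<lambda>w. (Z w - expectation Z) ^ 4) = 3 * (expectation (\<lambda>w. (Z w - expectation Z)\<^sup>2))\<^sup>2"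
proof -
  have Z [measurable]: "Z \<in> borel_measurable M" using assms by (simp add: gaussian_rv_def)
  consider \<mu> \<sigma> where "0 < \<sigma>" "distributed M lborel Z (normal_density \<mu> \<sigma>)" | c where "AE w in M. Z w = c"
    using assms by (auto simp: gaussian_rv_def)
  then have "integrable M Z \<and> integrable M (\<lambda>w. (Z w - expectation Z) ^ 4) \<and>
    expectation (\<lambda>w. (Z w - expectation Z) ^ 4) = 3 * (expectation (\<lambda>w. (Z w - expectation Z)\<^sup>2))\<^sup>2"
  proof cases
    case 1
    have int: "integrable M (\<lambda>w. g (Z w))" and ex: "expectation (\<lambda>w. g (Z w)) = c"
      if "has_bochner_integral lborel (\<lambda>x. normal_density \<mu> \<sigma> x * g x) c" "g \<in> borel_measurable borel" for g c
      using that distributed_integrable[OF 1(2), of g] distributed_integral[OF 1(2), of g]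
      by (auto simp: has_bochner_integral_iff normal_density_nonneg)
    note m1 = normal_moment_nz_1[OF 1(1), of \<mu>]
    have mu: "integrable M Z" "expectation Z = \<mu>"
      using int[OF m1] ex[OF m1] by auto
    have m2: "expectation (\<lambda>w. (Z w - \<mu>)\<^sup>2) = \<sigma>\<^sup>2"
      using ex[OF normal_moment_even[OF 1(1), of \<mu> 1]] by (simp add: fact_numeral)
    have m4: "integrable M (\<lambda>w. (Z w - \<mu>) ^ 4)" "expectation (\<lambda>w. (Z w - \<mu>) ^ 4) = 3 * (\<sigma>\<^sup>2)\<^sup>2"
      using int[OF normal_moment_even[OF 1(1), of \<mu> 2]] ex[OF normal_moment_even[OF 1(1), of \<mu> 2]] 1(1)
      by (simp_all add: fact_numeral field_simps)
    show ?thesis using mu m2 m4 by simp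
  next
    case 2
    then have "integrable M Z \<longleftrightarrow> integrable M (\<lambda>_. c)"
      by (intro integrable_cong_AE) auto
    moreover have e: "expectation Z = c" using 2 integral_cong_AE[of Z M "\<lambda>_. c"] by (simp add: prob_space)
    have "AE w in M. (Z w - expectation Z) ^ 4 = 0" "AE w in M. (Z w - expectation Z) ^ 2 = 0"
      using 2 by (auto simp: e)
    then have "integrable M (\<lambda>w. (Z w - expectation Z) ^ 4) \<longleftrightarrow> integrable M (\<lambda>_. 0::real)"
      "expectation (\<lambda>w. (Z w - expectation Z) ^ 4) = expectation (\<lambda>_. 0::real)"
      "expectation (\<lambda>w. (Z w - expectation Z) ^ 2) = expectation (\<lambda>_. 0::real)"
      by (intro integrable_cong_AE integral_cong_AE; simp)+
    ultimately show ?thesis by simp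
  qed
  then show "integrable M Z" "integrable M (\<lambda>w. (Z w - expectation Z) ^ 4)"
    "expectation (\<lambda>w. (Z w - expectation Z) ^ 4) = 3 * (expectation (\<lambda>w. (Z w - expectation Z)\<^sup>2))\<^sup>2"
    by auto
qed

text \<open>By polarization, all that is needed of a centred Gaussian vector is the relation between the
  second and fourth moments of its linear combinations.\<close>

locale gaussian_vector = prob_space M for M :: "'w measure" +
  fixes I :: "'i set" and Z :: "'i \<Rightarrow> 'w \<Rightarrow> real"
  assumes fin: "finite I"
    and meas: "\<And>i. i \<in> I \<Longrightarrow> Z i \<in> borel_measurable M"
    and int4: "\<And>a. integrable M (\<lambda>w. (\<Sum>i\<in>I. a i * Z i w) ^ 4)"
    and moment4: "\<And>a. expectation (\<lambda>w. (\<Sum>i\<in>I. a i * Z i w) ^ 4)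
      = 3 * (expectation (\<lambda>w. (\<Sum>i\<in>I. a i * Z i w)\<^sup>2))\<^sup>2"
begin

definition \<Gamma> :: "'i \<Rightarrow> 'i \<Rightarrow> real" where "\<Gamma> i j = expectation (\<lambda>w. Z i w * Z j w)"

lemma \<Gamma>_sym: "\<Gamma> i j = \<Gamma> j i" by (simp add: \<Gamma>_def mult.commute)

lemma four:
  assumes I: "i \<in> I" "j \<in> I" "k \<in> I" "l \<in> I"
  shows "integrable M (\<lambda>w. (x1 * Z i w + x2 * Z j w + x3 * Z k w + x4 * Z l w) ^ 4)"
    and "expectation (\<lambda>w. (x1 * Z i w + x2 * Z j w + x3 * Z k w + x4 * Z l w) ^ 4)
      = 3 * (expectation (\<lambda>w. (x1 * Z i w + x2 * Z j w + x3 * Z k w + x4 * Z l w)\<^sup>2))\<^sup>2"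
proof -
  \<comment> \<open>A sum of four indicators rather than a case distinction: the indices may
    coincide, and then their weights add up.\<close>
  define a where "a = (\<lambda>t. (if t = i then x1 else 0) + (if t = j then x2 else 0)
    + (if t = k then x3 else 0) + (if t = l then x4 else (0::real)))"
  have "(\<Sum>t\<in>I. a t * Z t w) = x1 * Z i w + x2 * Z j w + x3 * Z k w + x4 * Z l w" for w
    using fin I by (simp add: a_def distrib_right sum.distrib if_distrib[of "\<lambda>z. z * _"] cong: if_cong)
  then show "integrable M (\<lambda>w. (x1 * Z i w + x2 * Z j w + x3 * Z k w + x4 * Z l w) ^ 4)"
    "expectation (\<lambda>w. (x1 * Z i w + x2 * Z j w + x3 * Z k w + x4 * Z l w) ^ 4)
      = 3 * (expectation (\<lambda>w. (x1 * Z i w + x2 * Z j w + x3 * Z k w + x4 * Z l w)\<^sup>2))\<^sup>2"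
    using int4[of a] moment4[of a] by simp_all
qed

lemma integrable_mult2:
  assumes "i \<in> I" "j \<in> I"
  shows "integrable M (\<lambda>w. Z i w * Z j w)"
proof (rule Bochner_Integration.integrable_bound)
  show "integrable M (\<lambda>w. 1 + (Z i w) ^ 4 + (Z j w) ^ 4)"
    using four(1)[OF assms(1,1,1,1), of 1 0 0 0] four(1)[OF assms(2,2,2,2), of 1 0 0 0] by simp
  show "(\<lambda>w. Z i w * Z j w) \<in> borel_measurable M" using assms meas by measurable
  show "AE w in M. norm (Z i w * Z j w) \<le> norm (1 + (Z i w) ^ 4 + (Z j w) ^ 4)"
  proof (intro AE_I2)
    fix w
    have *: "\<bar>x * y\<bar> \<le> 1 + x ^ 4 + y ^ 4" for x y :: real
    proof -
      have "0 \<le> (\<bar>x\<bar> - \<bar>y\<bar>)\<^sup>2" "0 \<le> (x\<^sup>2 - 1)\<^sup>2" "0 \<le> (y\<^sup>2 - 1)\<^sup>2" by simp_all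
      moreover have "(\<bar>x\<bar> - \<bar>y\<bar>)\<^sup>2 = x\<^sup>2 + y\<^sup>2 - 2 * \<bar>x * y\<bar>"
        by (simp add: power2_diff abs_mult)
      moreover have "(x\<^sup>2 - 1)\<^sup>2 = x ^ 4 - 2 * x\<^sup>2 + 1" "(y\<^sup>2 - 1)\<^sup>2 = y ^ 4 - 2 * y\<^sup>2 + 1"
        by (simp_all add: power2_diff flip: power_mult)
      moreover have "0 \<le> x ^ 4" "0 \<le> y ^ 4" by simp_all
      ultimately show ?thesis by linarith
    qed
    from *[of "Z i w" "Z j w"] show "norm (Z i w * Z j w) \<le> norm (1 + (Z i w) ^ 4 + (Z j w) ^ 4)"
      by simp
  qed
qed

lemma second_moment:
  assumes I: "i \<in> I" "j \<in> I" "k \<in> I" "l \<in> I"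
  shows "expectation (\<lambda>w. (x1 * Z i w + x2 * Z j w + x3 * Z k w + x4 * Z l w)\<^sup>2)
    = x1\<^sup>2 * \<Gamma> i i + x2\<^sup>2 * \<Gamma> j j + x3\<^sup>2 * \<Gamma> k k + x4\<^sup>2 * \<Gamma> l l
      + 2 * (x1 * x2 * \<Gamma> i j + x1 * x3 * \<Gamma> i k + x1 * x4 * \<Gamma> i l
        + x2 * x3 * \<Gamma> j k + x2 * x4 * \<Gamma> j l + x3 * x4 * \<Gamma> k l)"
proof -
  have "(\<lambda>w. (x1 * Z i w + x2 * Z j w + x3 * Z k w + x4 * Z l w)\<^sup>2)
    = (\<lambda>w. x1\<^sup>2 * (Z i w * Z i w) + x2\<^sup>2 * (Z j w * Z j w) + x3\<^sup>2 * (Z k w * Z k w) + x4\<^sup>2 * (Z l w * Z l w)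
      + 2 * (x1 * x2 * (Z i w * Z j w) + x1 * x3 * (Z i w * Z k w) + x1 * x4 * (Z i w * Z l w)
        + x2 * x3 * (Z j w * Z k w) + x2 * x4 * (Z j w * Z l w) + x3 * x4 * (Z k w * Z l w)))"
    by (intro ext) (simp add: power2_eq_square algebra_simps)
  then show ?thesis using I by (simp add: \<Gamma>_def integrable_mult2)
qed

text \<open>Signing the 8 patterns by the product of their signs keeps only the monomial x y z v, of
  coefficient 4! = 24, and 8 * 24 = 192. The sign of x stays fixed because the power is
  even.\<close>

lemma polarization4:
  fixes x y z v :: real
  shows "x * y * z * v = ((x+y+z+v)^4 - (x+y+z-v)^4 - (x+y-z+v)^4 + (x+y-z-v)^4
    - (x-y+z+v)^4 + (x-y+z-v)^4 + (x-y-z+v)^4 - (x-y-z-v)^4) / 192"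
  by (simp add: power4_eq_xxxx algebra_simps)

text \<open>Each polarised fourth power has expectation 3 times the square of a quadratic form in
  the signs. The signed sum keeps the products of complementary pairs, each with factor 3 * 8 * 8 =
  192, which cancels the denominator.\<close>

lemma isserlis:
  assumes I: "i \<in> I" "j \<in> I" "k \<in> I" "l \<in> I"
  shows "integrable M (\<lambda>w. Z i w * Z j w * Z k w * Z l w)"
    and "expectation (\<lambda>w. Z i w * Z j w * Z k w * Z l w)
      = \<Gamma> i j * \<Gamma> k l + \<Gamma> i k * \<Gamma> j l + \<Gamma> i l * \<Gamma> j k"
proof -
  define L where "L = (\<lambda>e2 e3 e4 w. (1 * Z i w + e2 * Z j w + e3 * Z k w + e4 * Z l w) ^ 4)"
  have int: "integrable M (L e2 e3 e4)" for e2 e3 e4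
    unfolding L_def by (rule four(1)[OF I])
  have ex: "expectation (L e2 e3 e4)
    = 3 * (\<Gamma> i i + e2\<^sup>2 * \<Gamma> j j + e3\<^sup>2 * \<Gamma> k k + e4\<^sup>2 * \<Gamma> l l
      + 2 * (e2 * \<Gamma> i j + e3 * \<Gamma> i k + e4 * \<Gamma> i l
        + e2 * e3 * \<Gamma> j k + e2 * e4 * \<Gamma> j l + e3 * e4 * \<Gamma> k l))\<^sup>2" for e2 e3 e4
    unfolding L_def four(2)[OF I] second_moment[OF I] by simp
  have eq: "(\<lambda>w. Z i w * Z j w * Z k w * Z l w)
    = (\<lambda>w. (L 1 1 1 w - L 1 1 (-1) w - L 1 (-1) 1 w + L 1 (-1) (-1) w
      - L (-1) 1 1 w + L (-1) 1 (-1) w + L (-1) (-1) 1 w - L (-1) (-1) (-1) w) / 192)"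
    by (subst polarization4) (simp add: L_def)
  show "integrable M (\<lambda>w. Z i w * Z j w * Z k w * Z l w)"
    unfolding eq using int by simp
  have "expectation (\<lambda>w. Z i w * Z j w * Z k w * Z l w)
    = (expectation (L 1 1 1) - expectation (L 1 1 (-1)) - expectation (L 1 (-1) 1) + expectation (L 1 (-1) (-1))
      - expectation (L (-1) 1 1) + expectation (L (-1) 1 (-1)) + expectation (L (-1) (-1) 1) - expectation (L (-1) (-1) (-1))) / 192"
    unfolding eq using int by simp
  also have "\<dots> = \<Gamma> i j * \<Gamma> k l + \<Gamma> i k * \<Gamma> j l + \<Gamma> i l * \<Gamma> j k"
    unfolding ex by (simp add: power2_eq_square algebra_simps)
  finally show "expectation (\<lambda>w. Z i w * Z j w * Z k w * Z l w)
      = \<Gamma> i j * \<Gamma> k l + \<Gamma> i k * \<Gamma> j l + \<Gamma> i l * \<Gamma> j k" .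
qed

text \<open>Schur's test: split C E by the arithmetic-geometric mean inequality and sum out the two
  remaining indices with the row bound \<open>R\<close>. Two matrices are allowed because one
  pairing below involves the transpose of \<open>C\<close>.\<close>

lemma schur_bound:
  assumes R: "\<And>i. i \<in> I \<Longrightarrow> (\<Sum>j\<in>I. \<bar>\<Gamma> i j\<bar>) \<le> R"
  shows "(\<Sum>i\<in>I. \<Sum>j\<in>I. \<Sum>k\<in>I. \<Sum>l\<in>I. C i j * E k l * (\<Gamma> i k * \<Gamma> j l))
    \<le> R\<^sup>2 * ((\<Sum>i\<in>I. \<Sum>j\<in>I. (C i j)\<^sup>2) + (\<Sum>i\<in>I. \<Sum>j\<in>I. (E i j)\<^sup>2)) / 2"
proof (cases "I = {}")
  case False
  then obtain i0 where "i0 \<in> I" by auto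
  have R0: "0 \<le> R" by (rule order_trans[OF _ R[OF \<open>i0 \<in> I\<close>]]) (simp add: sum_nonneg)
  have half: "(\<Sum>i\<in>I. \<Sum>j\<in>I. \<Sum>k\<in>I. \<Sum>l\<in>I. (C i j)\<^sup>2 * (\<bar>\<Gamma> i k\<bar> * \<bar>\<Gamma> j l\<bar>)) \<le> R\<^sup>2 * (\<Sum>i\<in>I. \<Sum>j\<in>I. (C i j)\<^sup>2)" for C
  proof -
    have "(\<Sum>k\<in>I. \<Sum>l\<in>I. (C i j)\<^sup>2 * (\<bar>\<Gamma> i k\<bar> * \<bar>\<Gamma> j l\<bar>)) \<le> R\<^sup>2 * (C i j)\<^sup>2" if "i \<in> I" "j \<in> I" for i j
    proof -
      have "(\<Sum>k\<in>I. \<Sum>l\<in>I. (C i j)\<^sup>2 * (\<bar>\<Gamma> i k\<bar> * \<bar>\<Gamma> j l\<bar>))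
          = (C i j)\<^sup>2 * ((\<Sum>k\<in>I. \<bar>\<Gamma> i k\<bar>) * (\<Sum>l\<in>I. \<bar>\<Gamma> j l\<bar>))"
        by (subst sum_product) (simp only: sum_distrib_left)
      also have "\<dots> \<le> (C i j)\<^sup>2 * (R * R)"
        using R that R0 by (intro mult_left_mono mult_mono) (auto intro: sum_nonneg)
      finally show ?thesis by (simp add: power2_eq_square mult.commute)
    qed
    then show ?thesis unfolding sum_distrib_left by (intro sum_mono)
  qed
  have swap: "(\<Sum>i\<in>I. \<Sum>j\<in>I. \<Sum>k\<in>I. \<Sum>l\<in>I. (E k l)\<^sup>2 * (\<bar>\<Gamma> i k\<bar> * \<bar>\<Gamma> j l\<bar>))
      = (\<Sum>i\<in>I. \<Sum>j\<in>I. \<Sum>k\<in>I. \<Sum>l\<in>I. (E i j)\<^sup>2 * (\<bar>\<Gamma> i k\<bar> * \<bar>\<Gamma> j l\<bar>))"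
  proof -
    have fubini: "(\<Sum>i\<in>I. \<Sum>j\<in>I. \<Sum>k\<in>I. \<Sum>l\<in>I. f i j k l) = (\<Sum>k\<in>I. \<Sum>l\<in>I. \<Sum>i\<in>I. \<Sum>j\<in>I. f i j k l)" for f :: "_ \<Rightarrow> _ \<Rightarrow> _ \<Rightarrow> _ \<Rightarrow> real"
    proof -
      have "(\<Sum>i\<in>I. \<Sum>j\<in>I. \<Sum>k\<in>I. \<Sum>l\<in>I. f i j k l) = (\<Sum>i\<in>I. \<Sum>k\<in>I. \<Sum>j\<in>I. \<Sum>l\<in>I. f i j k l)"
        by (rule sum.cong[OF refl], rule sum.swap)
      also have "\<dots> = (\<Sum>k\<in>I. \<Sum>i\<in>I. \<Sum>j\<in>I. \<Sum>l\<in>I. f i j k l)"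
        by (rule sum.swap)
      also have "\<dots> = (\<Sum>k\<in>I. \<Sum>i\<in>I. \<Sum>l\<in>I. \<Sum>j\<in>I. f i j k l)"
        by (rule sum.cong[OF refl], rule sum.cong[OF refl], rule sum.swap)
      also have "\<dots> = (\<Sum>k\<in>I. \<Sum>l\<in>I. \<Sum>i\<in>I. \<Sum>j\<in>I. f i j k l)"
        by (rule sum.cong[OF refl], rule sum.swap)
      finally show ?thesis .
    qed
    then show ?thesis by (subst fubini) (simp add: \<Gamma>_sym)
  qed
  have "C i j * E k l * (\<Gamma> i k * \<Gamma> j l)
      \<le> ((C i j)\<^sup>2 * (\<bar>\<Gamma> i k\<bar> * \<bar>\<Gamma> j l\<bar>) + (E k l)\<^sup>2 * (\<bar>\<Gamma> i k\<bar> * \<bar>\<Gamma> j l\<bar>)) / 2" for i j k l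
  proof -
    have "0 \<le> (\<bar>C i j\<bar> - \<bar>E k l\<bar>)\<^sup>2" by simp
    then have "\<bar>C i j * E k l\<bar> \<le> ((C i j)\<^sup>2 + (E k l)\<^sup>2) / 2"
      by (simp add: power2_diff abs_mult)
    then have "\<bar>C i j * E k l\<bar> * \<bar>\<Gamma> i k * \<Gamma> j l\<bar> \<le> ((C i j)\<^sup>2 + (E k l)\<^sup>2) / 2 * \<bar>\<Gamma> i k * \<Gamma> j l\<bar>"
      by (intro mult_right_mono) auto
    moreover have "C i j * E k l * (\<Gamma> i k * \<Gamma> j l) \<le> \<bar>C i j * E k l\<bar> * \<bar>\<Gamma> i k * \<Gamma> j l\<bar>"
      using abs_ge_self[of "C i j * E k l * (\<Gamma> i k * \<Gamma> j l)"] by (simp add: abs_mult)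
    ultimately show ?thesis by (simp add: abs_mult algebra_simps add_divide_distrib)
  qed
  then have "(\<Sum>i\<in>I. \<Sum>j\<in>I. \<Sum>k\<in>I. \<Sum>l\<in>I. C i j * E k l * (\<Gamma> i k * \<Gamma> j l))
      \<le> (\<Sum>i\<in>I. \<Sum>j\<in>I. \<Sum>k\<in>I. \<Sum>l\<in>I. ((C i j)\<^sup>2 * (\<bar>\<Gamma> i k\<bar> * \<bar>\<Gamma> j l\<bar>) + (E k l)\<^sup>2 * (\<bar>\<Gamma> i k\<bar> * \<bar>\<Gamma> j l\<bar>)) / 2)"
    by (intro sum_mono)
  also have "\<dots> = ((\<Sum>i\<in>I. \<Sum>j\<in>I. \<Sum>k\<in>I. \<Sum>l\<in>I. (C i j)\<^sup>2 * (\<bar>\<Gamma> i k\<bar> * \<bar>\<Gamma> j l\<bar>))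
      + (\<Sum>i\<in>I. \<Sum>j\<in>I. \<Sum>k\<in>I. \<Sum>l\<in>I. (E k l)\<^sup>2 * (\<bar>\<Gamma> i k\<bar> * \<bar>\<Gamma> j l\<bar>))) / 2"
    by (simp add: sum.distrib sum_divide_distrib add_divide_distrib)
  finally show ?thesis
    unfolding swap using half[of C] half[of E] by (simp add: distrib_left)
qed (simp add: sum_nonneg)

text \<open>Of the three pairings of \<open>isserlis\<close> the first is the squared mean; the
  other two form the variance and are each at most \<open>R\<^sup>2\<close> times the squared
  Frobenius norm of C. What remains is the squared bias.\<close>

lemma quadratic_form:
  assumes R: "\<And>i. i \<in> I \<Longrightarrow> (\<Sum>j\<in>I. \<bar>\<Gamma> i j\<bar>) \<le> R"
  shows "integrable M (\<lambda>w. ((\<Sum>i\<in>I. \<Sum>j\<in>I. C i j * (Z i w * Z j w)) - \<beta>)\<^sup>2)"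
    and "expectation (\<lambda>w. ((\<Sum>i\<in>I. \<Sum>j\<in>I. C i j * (Z i w * Z j w)) - \<beta>)\<^sup>2)
      \<le> 2 * R\<^sup>2 * (\<Sum>i\<in>I. \<Sum>j\<in>I. (C i j)\<^sup>2) + ((\<Sum>i\<in>I. \<Sum>j\<in>I. C i j * \<Gamma> i j) - \<beta>)\<^sup>2"
proof -
  define Q where "Q = (\<lambda>w. \<Sum>i\<in>I. \<Sum>j\<in>I. C i j * (Z i w * Z j w))"
  have Q: "integrable M Q" "expectation Q = (\<Sum>i\<in>I. \<Sum>j\<in>I. C i j * \<Gamma> i j)"
    unfolding Q_def \<Gamma>_def using integrable_mult2 by (auto simp: Bochner_Integration.integral_sum)
  have sq: "(Q w)\<^sup>2 = (\<Sum>i\<in>I. \<Sum>j\<in>I. \<Sum>k\<in>I. \<Sum>l\<in>I. C i j * C k l * (Z i w * Z j w * Z k w * Z l w))" for w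
    unfolding Q_def power2_eq_square sum_distrib_right sum_distrib_left by (simp add: algebra_simps)
  have Q2: "integrable M (\<lambda>w. (Q w)\<^sup>2)"
    unfolding sq using isserlis(1) by (intro Bochner_Integration.integrable_sum integrable_mult_right)
  have "expectation (\<lambda>w. (Q w)\<^sup>2) = (\<Sum>i\<in>I. \<Sum>j\<in>I. \<Sum>k\<in>I. \<Sum>l\<in>I.
      C i j * C k l * (\<Gamma> i j * \<Gamma> k l + \<Gamma> i k * \<Gamma> j l + \<Gamma> i l * \<Gamma> j k))"
    unfolding sq using isserlis by (simp add: Bochner_Integration.integral_sum)
  also have "\<dots> = (\<Sum>i\<in>I. \<Sum>j\<in>I. \<Sum>k\<in>I. \<Sum>l\<in>I. (C i j * \<Gamma> i j) * (C k l * \<Gamma> k l))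
      + (\<Sum>i\<in>I. \<Sum>j\<in>I. \<Sum>k\<in>I. \<Sum>l\<in>I. C i j * C k l * (\<Gamma> i k * \<Gamma> j l))
      + (\<Sum>i\<in>I. \<Sum>j\<in>I. \<Sum>k\<in>I. \<Sum>l\<in>I. C i j * C k l * (\<Gamma> i l * \<Gamma> j k))"
    by (simp add: distrib_left sum.distrib mult.assoc mult.left_commute)
  also have "(\<Sum>i\<in>I. \<Sum>j\<in>I. \<Sum>k\<in>I. \<Sum>l\<in>I. (C i j * \<Gamma> i j) * (C k l * \<Gamma> k l)) = (expectation Q)\<^sup>2"
    unfolding Q(2) power2_eq_square by (simp only: sum_distrib_right) (simp only: sum_distrib_left)
  \<comment> \<open>Exchanging the names k and l brings the third pairing into the shape of
    \<open>schur_bound\<close>, with the transposed matrix.\<close>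
  also have "(\<Sum>i\<in>I. \<Sum>j\<in>I. \<Sum>k\<in>I. \<Sum>l\<in>I. C i j * C k l * (\<Gamma> i l * \<Gamma> j k))
      = (\<Sum>i\<in>I. \<Sum>j\<in>I. \<Sum>k\<in>I. \<Sum>l\<in>I. C i j * C l k * (\<Gamma> i k * \<Gamma> j l))"
    by (rule sum.cong[OF refl], rule sum.cong[OF refl], rule sum.swap)
  also have "\<dots> \<le> R\<^sup>2 * ((\<Sum>i\<in>I. \<Sum>j\<in>I. (C i j)\<^sup>2) + (\<Sum>i\<in>I. \<Sum>j\<in>I. (C j i)\<^sup>2)) / 2"
    by (rule schur_bound[OF R])
  also have "(\<Sum>i\<in>I. \<Sum>j\<in>I. (C j i)\<^sup>2) = (\<Sum>i\<in>I. \<Sum>j\<in>I. (C i j)\<^sup>2)"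
    by (rule sum.swap)
  finally have "expectation (\<lambda>w. (Q w)\<^sup>2) \<le> (expectation Q)\<^sup>2 + 2 * R\<^sup>2 * (\<Sum>i\<in>I. \<Sum>j\<in>I. (C i j)\<^sup>2)"
    using schur_bound[OF R, of C C] by simp
  moreover have eq: "(Q w - \<beta>)\<^sup>2 = (Q w)\<^sup>2 - 2 * \<beta> * Q w + \<beta>\<^sup>2" for w
    by (simp add: power2_diff)
  moreover have int: "integrable M (\<lambda>w. (Q w - \<beta>)\<^sup>2)"
    unfolding eq using Q Q2 by simp
  moreover have "expectation (\<lambda>w. (Q w - \<beta>)\<^sup>2) = expectation (\<lambda>w. (Q w)\<^sup>2) - 2 * \<beta> * expectation Q + \<beta>\<^sup>2"
    unfolding eq using Q Q2 by (simp add: prob_space)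
  ultimately have "expectation (\<lambda>w. (Q w - \<beta>)\<^sup>2) \<le> 2 * R\<^sup>2 * (\<Sum>i\<in>I. \<Sum>j\<in>I. (C i j)\<^sup>2) + (expectation Q - \<beta>)\<^sup>2"
    by (simp add: power2_diff)
  then show "expectation (\<lambda>w. ((\<Sum>i\<in>I. \<Sum>j\<in>I. C i j * (Z i w * Z j w)) - \<beta>)\<^sup>2)
      \<le> 2 * R\<^sup>2 * (\<Sum>i\<in>I. \<Sum>j\<in>I. (C i j)\<^sup>2) + ((\<Sum>i\<in>I. \<Sum>j\<in>I. C i j * \<Gamma> i j) - \<beta>)\<^sup>2"
    unfolding Q(2) by (simp add: Q_def)
  show "integrable M (\<lambda>w. ((\<Sum>i\<in>I. \<Sum>j\<in>I. C i j * (Z i w * Z j w)) - \<beta>)\<^sup>2)"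
    using int by (simp add: Q_def)
qed

end

text \<open>The moment conditions range over all linear combinations, hence pass to linear images.
  Subtracting the sample mean is such an image.\<close>

lemma gaussian_vector_linear_image:
  assumes "gaussian_vector M I Z" "finite J"
    and Y: "\<And>j w. j \<in> J \<Longrightarrow> Y j w = (\<Sum>i\<in>I. A j i * Z i w)"
  shows "gaussian_vector M J Y"
proof -
  interpret gaussian_vector M I Z by fact
  have eq: "(\<Sum>j\<in>J. a j * Y j w) = (\<Sum>i\<in>I. (\<Sum>j\<in>J. a j * A j i) * Z i w)" for a w
    by (simp add: Y sum_distrib_left sum_distrib_right mult.assoc) (rule sum.swap)
  have "Y j \<in> borel_measurable M" if "j \<in> J" for j
  proof -
    have "Y j = (\<lambda>w. \<Sum>i\<in>I. A j i * Z i w)" using Y[OF that] by auto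
    then show ?thesis using meas by (simp add: borel_measurable_sum)
  qed
  then show ?thesis
    by unfold_locales (simp_all add: eq int4 moment4 assms(2))
qed

section \<open>Empirical coefficients of a stationary Gaussian process\<close>

text \<open>The real part of the Fourier coefficient of v, which is all that an even function, such
  as the spectral density or the periodogram of a real path, sees of v.\<close>

definition cos_coef :: "(real \<Rightarrow> real) \<Rightarrow> int \<Rightarrow> real" where
  "cos_coef v h = (\<integral>x. v x * cos (2 * pi * of_int h * x) \<partial>unit_leb)"

lemma measurable_cos_unit [measurable]: "(\<lambda>x. cos (c * x)) \<in> borel_measurable unit_leb"
  by (intro continuous_imp_measurable_on_sets_lebesgue continuous_intros) auto

lemma integrable_unit_bounded:
  assumes "f \<in> borel_measurable unit_leb" "\<And>x. x \<in> {0..1} \<Longrightarrow> \<bar>f x\<bar> \<le> (c::real)"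
  shows "integrable unit_leb f"
proof -
  interpret prob_space unit_leb by (rule prob_space_unit_leb)
  show ?thesis using assms by (intro integrable_const_bound[where B=c]) auto
qed

lemma integral_cos_period:
  "(\<integral>x. cos (2 * pi * of_int m * x) \<partial>unit_leb) = (if m = 0 then 1 else 0)"
proof -
  have "(\<integral>x. cos (2 * pi * of_int m * x) \<partial>unit_leb) = integral {0..1} (\<lambda>x. cos (2 * pi * of_int m * x))"
    by (rule lebesgue_integral_eq_integral) (auto intro: integrable_unit_bounded[where c=1])
  also have "\<dots> = (if m = 0 then 1 else 0)"
  proof (cases "m = 0")
    case False
    define F where "F = (\<lambda>x. sin (2 * pi * of_int m * x) / (2 * pi * of_int m))"
    have "(F has_vector_derivative cos (2 * pi * of_int m * x)) (at x within {0..1})" for x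
      unfolding F_def has_real_derivative_iff_has_vector_derivative[symmetric]
      using False by (auto intro!: derivative_eq_intros)
    then have "((\<lambda>x. cos (2 * pi * of_int m * x)) has_integral (F 1 - F 0)) {0..1}"
      by (intro fundamental_theorem_of_calculus) auto
    moreover have "sin (2 * pi * of_int m) = 0"
      using sin_integer_2pi[of "of_int m"] by (simp add: mult.commute)
    ultimately show ?thesis using False by (auto simp: F_def integral_unique)
  qed simp
  finally show ?thesis .
qed

lemma cos_coef_cos:
  "cos_coef (\<lambda>x. cos (2 * pi * of_int k * x)) h
    = ((if h = k then 1 else 0) + (if h = - k then 1 else 0)) / 2"
proof -
  have "cos (2 * pi * of_int k * x) * cos (2 * pi * of_int h * x)
      = (cos (2 * pi * of_int (k - h) * x) + cos (2 * pi * of_int (k + h) * x)) / 2" for x :: real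
    unfolding cos_times_cos by (simp add: algebra_simps)
  then have "cos_coef (\<lambda>x. cos (2 * pi * of_int k * x)) h
      = (\<integral>x. (cos (2 * pi * of_int (k - h) * x) + cos (2 * pi * of_int (k + h) * x)) / 2 \<partial>unit_leb)"
    unfolding cos_coef_def by (simp only:)
  also have "\<dots> = ((\<integral>x. cos (2 * pi * of_int (k - h) * x) \<partial>unit_leb) + (\<integral>x. cos (2 * pi * of_int (k + h) * x) \<partial>unit_leb)) / 2"
    by (simp add: Bochner_Integration.integral_add integrable_unit_bounded[where c=1] del: of_int_add of_int_diff)
  finally have "cos_coef (\<lambda>x. cos (2 * pi * of_int k * x)) h
      = ((\<integral>x. cos (2 * pi * of_int (k - h) * x) \<partial>unit_leb) + (\<integral>x. cos (2 * pi * of_int (k + h) * x) \<partial>unit_leb)) / 2" .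
  then show ?thesis unfolding integral_cos_period by (auto simp: eq_neg_iff_add_eq_0 add.commute)
qed

lemma cos_coef_minus: "cos_coef v (- h) = cos_coef v h"
  by (simp add: cos_coef_def)

lemma sum_symmetric_int:
  fixes f :: "int \<Rightarrow> real"
  assumes "\<And>h. f (- h) = f h"
  shows "(\<Sum>h\<in>{- int N..int N}. f h) = f 0 + 2 * (\<Sum>h=1..N. f (int h))"
proof (induction N)
  case (Suc N)
  have "{- int (Suc N)..int (Suc N)} = insert (int (Suc N)) (insert (- int (Suc N)) {- int N..int N})"
    by auto
  then have "(\<Sum>h\<in>{- int (Suc N)..int (Suc N)}. f h)
      = f (int (Suc N)) + (f (- int (Suc N)) + (\<Sum>h\<in>{- int N..int N}. f h))"
    by (simp add: sum.insert_if)
  then show ?case using Suc.IH assms[of "int (Suc N)"] by simp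
qed simp

text \<open>Frequencies h and -h have equal coefficients, so the sum over -N..N is exactly the
  Bessel sum for the orthonormal system 1, sqrt 2 cos(2 pi h x), to which the earlier locale applies
  with D^2 = 2 (N + 1).\<close>

lemma cos_coef_bessel:
  assumes v: "v \<in> L2_unit" and F: "finite F"
  shows "(\<Sum>h\<in>F. (cos_coef v h)\<^sup>2) \<le> (\<integral>x. (v x)\<^sup>2 \<partial>unit_leb)"
proof -
  obtain N :: nat where N: "F \<subseteq> {- int N..int N}"
  proof
    show "F \<subseteq> {- int (nat (Max (insert 0 (abs ` F))))..int (nat (Max (insert 0 (abs ` F))))}"
    proof
      fix h assume "h \<in> F"
      then have "\<bar>h\<bar> \<le> Max (insert 0 (abs ` F))" using F by (intro Max_ge) auto
      then show "h \<in> {- int (nat (Max (insert 0 (abs ` F))))..int (nat (Max (insert 0 (abs ` F))))}" by auto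
    qed
  qed
  define e where "e = (\<lambda>h::nat. \<lambda>x. (if h = 0 then 1 else sqrt 2) * cos (2 * pi * of_int (int h) * x))"
  interpret P: prob_space unit_leb by (rule prob_space_unit_leb)
  interpret finite_exp_family unit_leb "{0..N}" e "sqrt (2 * real (N + 1))"
  proof unfold_locales
    show "e i \<in> borel_measurable unit_leb" for i
      unfolding e_def by (intro borel_measurable_times borel_measurable_const measurable_cos_unit)
    show "(\<integral>x. e i x * e j x \<partial>unit_leb) = (if i = j then 1 else 0)" for i j
    proof -
      have "(\<integral>x. e i x * e j x \<partial>unit_leb) = (if i = 0 then 1 else sqrt 2) * (if j = 0 then 1 else sqrt 2)
          * cos_coef (\<lambda>x. cos (2 * pi * of_int (int i) * x)) (int j)"
        unfolding cos_coef_def integral_mult_right_zero[symmetric] by (simp add: e_def mult_ac)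
      then show ?thesis unfolding cos_coef_cos by (cases "i = 0"; cases "j = 0") auto
    qed
    show "(\<Sum>i\<in>{0..N}. (e i x)\<^sup>2) \<le> (sqrt (2 * real (N + 1)))\<^sup>2" for x
    proof -
      have "(e i x)\<^sup>2 \<le> 2" for i
      proof -
        have "(cos (2 * pi * of_int (int i) * x))\<^sup>2 \<le> 1" by (simp add: abs_square_le_1)
        then show ?thesis by (auto simp: e_def power_mult_distrib)
      qed
      then have "(\<Sum>i\<in>{0..N}. (e i x)\<^sup>2) \<le> (\<Sum>i\<in>{0..N}. 2)" by (intro sum_mono)
      then show ?thesis by simp
    qed
  qed auto
  have "(\<Sum>h\<in>F. (cos_coef v h)\<^sup>2) \<le> (\<Sum>h\<in>{- int N..int N}. (cos_coef v h)\<^sup>2)"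
    using N by (intro sum_mono2) auto
  also have "\<dots> = (cos_coef v 0)\<^sup>2 + 2 * (\<Sum>h=1..N. (cos_coef v (int h))\<^sup>2)"
    by (rule sum_symmetric_int) (simp add: cos_coef_minus)
  also have "\<dots> = (\<Sum>h\<in>{0..N}. (\<integral>x. v x * e h x \<partial>unit_leb)\<^sup>2)"
  proof -
    have "(\<integral>x. v x * e h x \<partial>unit_leb) = (if h = 0 then 1 else sqrt 2) * cos_coef v (int h)" for h
      unfolding cos_coef_def integral_mult_right_zero[symmetric] by (simp add: e_def mult_ac)
    then show ?thesis
      by (simp add: sum.atLeast_Suc_atMost power_mult_distrib sum_distrib_left)
  qed
  also have "\<dots> \<le> (\<integral>x. (v x)\<^sup>2 \<partial>unit_leb)"
    using v by (intro bessel) (simp_all add: L2_unit_def)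
  finally show ?thesis .
qed

section \<open>Fourier series of the spectral density\<close>

lemma integrable_L2_unit: "v \<in> L2_unit \<Longrightarrow> integrable unit_leb v"
proof -
  interpret prob_space unit_leb by (rule prob_space_unit_leb)
  assume v: "v \<in> L2_unit"
  have "v \<in> borel_measurable unit_leb" using v unfolding L2_unit_def by blast
  moreover have "integrable unit_leb (\<lambda>x. (v x)\<^sup>2)" using v unfolding L2_unit_def by blast
  ultimately show ?thesis by (rule square_integrable_imp_integrable)
qed

lemma spectral_density_real:
  assumes "spectral_density \<rho> f" "\<omega> \<in> {0..1}"
  shows "((\<lambda>h. \<rho> h / (2 * pi) * cos (2 * pi * of_int h * \<omega>)) has_sum f \<omega>) UNIV"
proof -
  have "((\<lambda>h. Re (1 / (2 * pi) * complex_of_real (\<rho> h) * exp (\<i> * 2 * pi * \<omega> * of_int h))) has_sum Re (complex_of_real (f \<omega>))) UNIV"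
    using assms by (intro has_sum_Re) (auto simp: spectral_density_def)
  moreover have "Re (1 / (2 * pi) * complex_of_real (\<rho> h) * exp (\<i> * 2 * pi * \<omega> * of_int h))
      = \<rho> h / (2 * pi) * cos (2 * pi * of_int h * \<omega>)" for h
  proof -
    have "exp (\<i> * 2 * pi * \<omega> * of_int h) = cis (2 * pi * of_int h * \<omega>)"
      by (simp add: cis_conv_exp mult_ac)
    moreover have "1 / (2 * pi) * complex_of_real (\<rho> h) = complex_of_real (\<rho> h / (2 * pi))" by simp
    ultimately have "1 / (2 * pi) * complex_of_real (\<rho> h) * exp (\<i> * 2 * pi * \<omega> * of_int h)
      = complex_of_real (\<rho> h / (2 * pi)) * cis (2 * pi * of_int h * \<omega>)" by (simp only:)
    then show ?thesis by (simp only: times_complex.sel Re_complex_of_real Im_complex_of_real) simp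
  qed
  ultimately show ?thesis by (simp only: Re_complex_of_real)
qed

text \<open>At frequency 0 every cosine equals 1, and unconditional summability of reals is
  absolute.\<close>

lemma spectral_density_summable:
  assumes "spectral_density \<rho> f"
  shows "(\<lambda>h. \<bar>\<rho> h\<bar> / (2 * pi)) summable_on UNIV"
proof -
  have "(\<lambda>h. \<rho> h / (2 * pi)) summable_on UNIV"
    using spectral_density_real[OF assms, of 0] by (auto simp: summable_on_def)
  from this[unfolded summable_on_iff_abs_summable_on_real[of "\<lambda>h. \<rho> h / (2 * pi)"]]
  show ?thesis by simp
qed

text \<open>Weierstrass' test: the remainder after a finite set H is at most S minus the sum of |r
  h| over H, uniformly in x, so series and integral may be exchanged.\<close>

lemma has_sum_spectral_inner:
  assumes f: "spectral_density \<rho> f" "f \<in> borel_measurable unit_leb" and v: "v \<in> L2_unit"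
  shows "((\<lambda>h. \<rho> h / (2 * pi) * cos_coef v h) has_sum (\<integral>x. f x * v x \<partial>unit_leb)) UNIV"
proof -
  define r where "r = (\<lambda>h. \<rho> h / (2 * pi))"
  have vm [measurable]: "v \<in> borel_measurable unit_leb" using v by (simp add: L2_unit_def)
  note [measurable] = f(2)
  note vi = integrable_L2_unit[OF v]
  define S where "S = (\<Sum>\<^sub>\<infinity>h. \<bar>r h\<bar>)"
  have S: "((\<lambda>h. \<bar>r h\<bar>) has_sum S) UNIV"
    using spectral_density_summable[OF f(1)] unfolding S_def r_def by (simp add: has_sum_infsum)
  have bound: "\<bar>f x - (\<Sum>h\<in>H. r h * cos (2 * pi * of_int h * x))\<bar> \<le> S - (\<Sum>h\<in>H. \<bar>r h\<bar>)"
    if x: "x \<in> {0..1}" and H: "finite H" for x H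
  proof -
    have 1: "((\<lambda>h. r h * cos (2 * pi * of_int h * x)) has_sum f x - (\<Sum>h\<in>H. r h * cos (2 * pi * of_int h * x))) (UNIV - H)"
      using spectral_density_real[OF f(1) x] H by (intro has_sum_Diff has_sum_finite) (auto simp: r_def)
    have 2: "((\<lambda>h. \<bar>r h\<bar>) has_sum S - (\<Sum>h\<in>H. \<bar>r h\<bar>)) (UNIV - H)"
      using S H by (intro has_sum_Diff has_sum_finite) auto
    have 3: "\<bar>r h * cos (2 * pi * of_int h * x)\<bar> \<le> \<bar>r h\<bar>" for h
      unfolding abs_mult by (rule mult_left_le) auto
    have "f x - (\<Sum>h\<in>H. r h * cos (2 * pi * of_int h * x)) \<le> S - (\<Sum>h\<in>H. \<bar>r h\<bar>)"
      by (rule has_sum_mono[OF 1 2]) (use 3 in \<open>auto simp: abs_le_iff\<close>)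
    moreover have "- (f x - (\<Sum>h\<in>H. r h * cos (2 * pi * of_int h * x))) \<le> S - (\<Sum>h\<in>H. \<bar>r h\<bar>)"
      by (rule has_sum_mono[OF has_sum_uminusI[OF 1] 2]) (use 3 in \<open>auto simp: abs_le_iff\<close>)
    ultimately show ?thesis by (simp add: abs_le_iff)
  qed
  have vcos: "integrable unit_leb (\<lambda>x. cos (c * x) * v x)" for c
    by (rule Bochner_Integration.integrable_bound[OF vi]) (auto simp: abs_mult mult_left_le_one_le)
  have fv: "integrable unit_leb (\<lambda>x. f x * v x)"
  proof (rule Bochner_Integration.integrable_bound)
    show "integrable unit_leb (\<lambda>x. S * v x)" using vi by simp
    show "AE x in unit_leb. norm (f x * v x) \<le> norm (S * v x)"
    proof (intro AE_I2)
      fix x assume "x \<in> space unit_leb"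
      then have "\<bar>f x\<bar> \<le> \<bar>S\<bar>" using bound[of x "{}"] by simp
      then show "norm (f x * v x) \<le> norm (S * v x)" by (simp add: abs_mult mult_right_mono)
    qed
  qed measurable
  have le: "norm ((\<Sum>h\<in>H. r h * cos_coef v h) - (\<integral>x. f x * v x \<partial>unit_leb)) \<le> (S - (\<Sum>h\<in>H. \<bar>r h\<bar>)) * (\<integral>x. \<bar>v x\<bar> \<partial>unit_leb)"
    if H: "finite H" for H
  proof -
    have eq: "(f x - (\<Sum>h\<in>H. r h * cos (2 * pi * of_int h * x))) * v x
        = f x * v x - (\<Sum>h\<in>H. r h * (cos (2 * pi * of_int h * x) * v x))" for x
      by (simp add: left_diff_distrib sum_distrib_right mult.assoc)
    have int: "integrable unit_leb (\<lambda>x. (f x - (\<Sum>h\<in>H. r h * cos (2 * pi * of_int h * x))) * v x)"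
      unfolding eq using fv vcos by (intro Bochner_Integration.integrable_diff Bochner_Integration.integrable_sum integrable_mult_right)
    have "(\<integral>x. f x * v x \<partial>unit_leb) - (\<Sum>h\<in>H. r h * cos_coef v h)
        = (\<integral>x. (f x - (\<Sum>h\<in>H. r h * cos (2 * pi * of_int h * x))) * v x \<partial>unit_leb)"
      unfolding eq cos_coef_def using fv vcos
      by (simp add: Bochner_Integration.integral_diff Bochner_Integration.integral_sum Bochner_Integration.integrable_sum mult.commute[of "v _"])
    also have "\<bar>\<dots>\<bar> \<le> (\<integral>x. \<bar>(f x - (\<Sum>h\<in>H. r h * cos (2 * pi * of_int h * x))) * v x\<bar> \<partial>unit_leb)"
      by (rule integral_abs_bound)
    also have "\<dots> \<le> (\<integral>x. (S - (\<Sum>h\<in>H. \<bar>r h\<bar>)) * \<bar>v x\<bar> \<partial>unit_leb)"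
    proof (rule integral_mono)
      fix x assume "x \<in> space unit_leb"
      then show "\<bar>(f x - (\<Sum>h\<in>H. r h * cos (2 * pi * of_int h * x))) * v x\<bar> \<le> (S - (\<Sum>h\<in>H. \<bar>r h\<bar>)) * \<bar>v x\<bar>"
        unfolding abs_mult using H by (intro mult_right_mono bound) auto
    qed (use int vi in auto)
    finally show ?thesis by (simp add: abs_minus_commute)
  qed
  have "((\<lambda>H. (S - (\<Sum>h\<in>H. \<bar>r h\<bar>)) * (\<integral>x. \<bar>v x\<bar> \<partial>unit_leb)) \<longlongrightarrow> (S - S) * (\<integral>x. \<bar>v x\<bar> \<partial>unit_leb)) (finite_subsets_at_top UNIV)"
    using S unfolding has_sum_def by (intro tendsto_intros)
  then have "((\<lambda>H. (\<Sum>h\<in>H. r h * cos_coef v h) - (\<integral>x. f x * v x \<partial>unit_leb)) \<longlongrightarrow> 0) (finite_subsets_at_top UNIV)"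
    by (intro Lim_null_comparison[OF eventually_mono[OF eventually_finite_subsets_at_top_weakI le]]) auto
  then show ?thesis unfolding has_sum_def r_def by (simp add: LIM_zero_iff)
qed

text \<open>Testing f against cos(2 pi h x) picks the frequencies h and -h with weight 1/2 each; by
  evenness of \<rho> this recovers \<rho> h / (2 pi) as the real part of the Fourier coefficient.
  This transfers the uniform bounds on the class to every covariance.\<close>

lemma abs_autocov_le_fourier_cov:
  assumes f: "spectral_density \<rho> f" "f \<in> borel_measurable unit_leb" and even: "\<And>h. \<rho> (- h) = \<rho> h"
  shows "\<bar>\<rho> h\<bar> / (2 * pi) \<le> norm (fourier_cov f h)"
proof -
  note [measurable] = f(2)
  define e where "e = (\<lambda>x::real. cos (2 * pi * of_int h * x))"
  have e: "e \<in> L2_unit" unfolding L2_unit_def e_def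
    by (auto intro!: integrable_unit_bounded[where c=1] simp: abs_square_le_1)
  have "((\<lambda>k. \<rho> k / (2 * pi) * cos_coef e k) has_sum (\<rho> h / (2 * pi))) UNIV"
  proof -
    have "((\<lambda>k. \<rho> k / (2 * pi) * cos_coef e k) has_sum (\<Sum>k\<in>{h, - h}. \<rho> k / (2 * pi) * cos_coef e k)) {h, - h}"
      by (rule has_sum_finite) simp
    moreover have "(\<Sum>k\<in>{h, - h}. \<rho> k / (2 * pi) * cos_coef e k) = \<rho> h / (2 * pi)"
      unfolding e_def cos_coef_cos by (cases "h = 0") (auto simp: even field_simps)
    ultimately have "((\<lambda>k. \<rho> k / (2 * pi) * cos_coef e k) has_sum (\<rho> h / (2 * pi))) {h, - h}"
      by (simp only:)
    then show ?thesis
      by (subst has_sum_cong_neutral[where T="{h, - h}" and g="\<lambda>k. \<rho> k / (2 * pi) * cos_coef e k"])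
        (auto simp: e_def cos_coef_cos)
  qed
  from has_sum_unique[OF has_sum_spectral_inner[OF f e] this]
  have eq: "(\<integral>x. f x * e x \<partial>unit_leb) = \<rho> h / (2 * pi)" .
  have fe: "\<exists>c. \<forall>x\<in>{0..1}. \<bar>f x\<bar> \<le> c"
  proof (intro exI ballI)
    fix x :: real assume x: "x \<in> {0..1}"
    have s: "((\<lambda>k. \<bar>\<rho> k\<bar> / (2 * pi)) has_sum (\<Sum>\<^sub>\<infinity>k. \<bar>\<rho> k\<bar> / (2 * pi))) UNIV"
      using spectral_density_summable[OF f(1)] by (rule has_sum_infsum)
    have b: "\<bar>\<rho> k / (2 * pi) * cos (2 * pi * of_int k * x)\<bar> \<le> \<bar>\<rho> k\<bar> / (2 * pi)" for k
      unfolding abs_mult by (rule order_trans[OF mult_left_le]) auto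
    note sx = spectral_density_real[OF f(1) x]
    have "f x \<le> (\<Sum>\<^sub>\<infinity>k. \<bar>\<rho> k\<bar> / (2 * pi))"
      by (rule has_sum_mono[OF sx s]) (rule abs_le_D1[OF b])
    moreover have "- f x \<le> (\<Sum>\<^sub>\<infinity>k. \<bar>\<rho> k\<bar> / (2 * pi))"
      by (rule has_sum_mono[OF has_sum_uminusI[OF sx] s]) (rule abs_le_D2[OF b])
    ultimately show "\<bar>f x\<bar> \<le> (\<Sum>\<^sub>\<infinity>k. \<bar>\<rho> k\<bar> / (2 * pi))" by (simp add: abs_le_iff)
  qed
  then obtain c where c: "\<And>x. x \<in> {0..1} \<Longrightarrow> \<bar>f x\<bar> \<le> c" by blast
  have "integrable unit_leb (\<lambda>x. complex_of_real (f x) * exp (- \<i> * 2 * pi * x * of_int h))"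
  proof (rule Bochner_Integration.integrable_bound)
    show "integrable unit_leb f" using c by (intro integrable_unit_bounded) auto
    have "(\<lambda>x. exp (- \<i> * 2 * pi * complex_of_real x * of_int h)) \<in> borel_measurable unit_leb"
      by (intro continuous_imp_measurable_on_sets_lebesgue continuous_intros) auto
    then show "(\<lambda>x. complex_of_real (f x) * exp (- \<i> * 2 * pi * x * of_int h)) \<in> borel_measurable unit_leb"
      by measurable
    have "norm (exp (- \<i> * 2 * pi * complex_of_real x * of_int h)) = 1" for x
      by (simp add: norm_exp_eq_Re)
    then show "AE x in unit_leb. norm (complex_of_real (f x) * exp (- \<i> * 2 * pi * x * of_int h)) \<le> norm (f x)"
      by (simp add: norm_mult)
  qed
  then have "Re (fourier_cov f h) = (\<integral>x. Re (complex_of_real (f x) * exp (- \<i> * 2 * pi * x * of_int h)) \<partial>unit_leb)"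
    unfolding fourier_cov_def by (rule integral_Re[symmetric])
  also have "\<dots> = (\<integral>x. f x * e x \<partial>unit_leb)"
  proof -
    have "- \<i> * 2 * pi * complex_of_real x * of_int h = \<i> * complex_of_real (- (2 * pi * of_int h * x))" for x
      by (simp add: mult_ac)
    then show ?thesis by (simp only: cis_conv_exp[symmetric]) (simp add: e_def)
  qed
  finally show ?thesis using abs_Re_le_cmod[of "fourier_cov f h"] by (simp add: eq)
qed

text \<open>Enlarging the square by one row and one column adds each difference between -n and n
  once, which raises every weight n - |h| by one.\<close>

lemma sum_toeplitz:
  fixes F :: "int \<Rightarrow> real"
  shows "(\<Sum>i=1..n. \<Sum>j=1..n. F (int i - int j)) = (\<Sum>h\<in>{- int n<..<int n}. (real n - \<bar>of_int h\<bar>) * F h)"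
proof (induction n)
  case (Suc n)
  have set: "{- int (Suc n)<..<int (Suc n)} = {- int n..int n}" by auto
  have split: "{- int n..int n} = {- int n..-1} \<union> ({0} \<union> {1..int n})" by auto
  have neg: "(\<Sum>i=1..n. F (int i - int (Suc n))) = (\<Sum>h\<in>{- int n..-1}. F h)"
    by (rule sum.reindex_bij_witness[where i="\<lambda>h. nat (h + int (Suc n))" and j="\<lambda>i. int i - int (Suc n)"]) auto
  have pos: "(\<Sum>j=1..n. F (int (Suc n) - int j)) = (\<Sum>h\<in>{1..int n}. F h)"
    by (rule sum.reindex_bij_witness[where i="\<lambda>h. nat (int (Suc n) - h)" and j="\<lambda>j. int (Suc n) - int j"]) auto
  have all: "(\<Sum>h\<in>{- int n..int n}. F h)
      = (\<Sum>h\<in>{- int n..-1}. F h) + (F 0 + (\<Sum>h\<in>{1..int n}. F h))"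
    unfolding split by (subst sum.union_disjoint; (subst sum.union_disjoint)?) auto
  have "(\<Sum>i=1..Suc n. \<Sum>j=1..Suc n. F (int i - int j))
      = (\<Sum>i=1..n. \<Sum>j=1..n. F (int i - int j)) + (\<Sum>i=1..n. F (int i - int (Suc n)))
        + ((\<Sum>j=1..n. F (int (Suc n) - int j)) + F 0)"
    by (simp add: sum.distrib)
  also have "\<dots> = (\<Sum>h\<in>{- int n<..<int n}. (real n - \<bar>of_int h\<bar>) * F h) + (\<Sum>h\<in>{- int n..int n}. F h)"
    unfolding Suc.IH neg pos all by simp
  also have "(\<Sum>h\<in>{- int n<..<int n}. (real n - \<bar>of_int h\<bar>) * F h)
      = (\<Sum>h\<in>{- int n..int n}. (real n - \<bar>of_int h\<bar>) * F h)"
    by (rule sum.mono_neutral_left) (auto, linarith?)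
  also have "\<dots> + (\<Sum>h\<in>{- int n..int n}. F h)
      = (\<Sum>h\<in>{- int n..int n}. (real (Suc n) - \<bar>of_int h\<bar>) * F h)"
    by (simp add: algebra_simps flip: sum.distrib)
  finally show ?case unfolding set .
qed simp

lemma sum_shift_le:
  fixes F :: "int \<Rightarrow> real"
  assumes "\<And>H. finite H \<Longrightarrow> sum F H \<le> S"
  shows "(\<Sum>j=1..(n::nat). F (a - int j)) \<le> S" "(\<Sum>j=1..n. F (int j - a)) \<le> S"
proof -
  have "(\<Sum>j=1..n. F (a - int j)) = sum F ((\<lambda>j. a - int j) ` {1..n})"
    by (subst sum.reindex) (auto intro: inj_onI)
  then show "(\<Sum>j=1..n. F (a - int j)) \<le> S" using assms by simp
  have "(\<Sum>j=1..n. F (int j - a)) = sum F ((\<lambda>j. int j - a) ` {1..n})"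
    by (subst sum.reindex) (auto intro: inj_onI)
  then show "(\<Sum>j=1..n. F (int j - a)) \<le> S" using assms by simp
qed

text \<open>Averaging over the sample replaces the weight 1 of frequency h by the triangular weight
  1 - |h| / n, or 0 for |h| >= n. Cauchy-Schwarz against the square summable c bounds the
  loss.\<close>

lemma toeplitz_bias:
  fixes \<rho> c :: "int \<Rightarrow> real"
  assumes n: "1 \<le> n" and c: "\<And>H. finite H \<Longrightarrow> (\<Sum>h\<in>H. (c h)\<^sup>2) \<le> 1"
    and \<rho>: "\<And>H. finite H \<Longrightarrow> (\<Sum>h\<in>H. \<bar>of_int h\<bar> * (\<rho> h)\<^sup>2) \<le> B"
    and sum: "((\<lambda>h. \<rho> h * c h) has_sum \<beta>) UNIV"
  shows "\<bar>(\<Sum>i=1..n. \<Sum>j=1..n. \<rho> (int i - int j) * c (int i - int j)) / real n - \<beta>\<bar> \<le> sqrt (B / real n)"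
proof -
  define T where "T = (\<Sum>i=1..n. \<Sum>j=1..n. \<rho> (int i - int j) * c (int i - int j)) / real n"
  \<comment> \<open>The missing weight. Being at most 1 and at most |h| / n, it satisfies m^2 <= |h|
    / n, which brings in the sum of |h| \<rho>(h)^2.\<close>
  define m where "m = (\<lambda>h::int. min 1 (\<bar>of_int h\<bar> / real n))"
  have bound: "\<bar>T - (\<Sum>h\<in>H. \<rho> h * c h)\<bar> \<le> sqrt (B / real n)" if H: "finite H" "{- int n<..<int n} \<subseteq> H" for H
  proof -
    have "T = (\<Sum>h\<in>{- int n<..<int n}. (1 - m h) * (\<rho> h * c h))"
    proof -
      have "T = (\<Sum>h\<in>{- int n<..<int n}. (real n - \<bar>of_int h\<bar>) * (\<rho> h * c h)) / real n"
        unfolding T_def using sum_toeplitz[of "\<lambda>h. \<rho> h * c h" n] by simp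
      also have "\<dots> = (\<Sum>h\<in>{- int n<..<int n}. (1 - m h) * (\<rho> h * c h))"
        unfolding sum_divide_distrib using n
        by (intro sum.cong refl) (auto simp: m_def min_def field_simps)
      finally show ?thesis .
    qed
    also have "\<dots> = (\<Sum>h\<in>H. (1 - m h) * (\<rho> h * c h))"
    proof (rule sum.mono_neutral_left[OF H])
      show "\<forall>h\<in>H - {- int n<..<int n}. (1 - m h) * (\<rho> h * c h) = 0"
      proof
        fix h assume "h \<in> H - {- int n<..<int n}"
        then have "int n \<le> \<bar>h\<bar>" by auto
        then have "real n \<le> \<bar>of_int h\<bar>" by linarith
        then have "m h = 1" using n by (simp add: m_def min_def field_simps)
        then show "(1 - m h) * (\<rho> h * c h) = 0" by simp
      qed
    qed
    finally have "T - (\<Sum>h\<in>H. \<rho> h * c h) = (\<Sum>h\<in>H. - (m h * \<rho> h * c h))"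
      by (simp add: algebra_simps flip: sum_subtractf)
    then have "\<bar>T - (\<Sum>h\<in>H. \<rho> h * c h)\<bar> \<le> (\<Sum>h\<in>H. \<bar>m h * \<rho> h\<bar> * \<bar>c h\<bar>)"
      using sum_abs[of "\<lambda>h. - (m h * \<rho> h * c h)" H] by (simp add: abs_mult)
    also have "\<dots> \<le> L2_set (\<lambda>h. m h * \<rho> h) H * L2_set c H"
      by (rule L2_set_mult_ineq)
    also have "\<dots> \<le> sqrt (B / real n) * 1"
    proof (intro mult_mono)
      have "(m h * \<rho> h)\<^sup>2 \<le> \<bar>of_int h\<bar> * (\<rho> h)\<^sup>2 / real n" for h
      proof -
        have "0 \<le> m h" "m h \<le> 1" "m h \<le> \<bar>of_int h\<bar> / real n" by (auto simp: m_def)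
        then have "m h * m h \<le> 1 * (\<bar>of_int h\<bar> / real n)" by (intro mult_mono) auto
        then have "m h * m h * (\<rho> h)\<^sup>2 \<le> 1 * (\<bar>of_int h\<bar> / real n) * (\<rho> h)\<^sup>2"
          by (intro mult_right_mono) auto
        then show ?thesis by (simp add: power2_eq_square mult_ac)
      qed
      then have "(\<Sum>h\<in>H. (m h * \<rho> h)\<^sup>2) \<le> (\<Sum>h\<in>H. \<bar>of_int h\<bar> * (\<rho> h)\<^sup>2 / real n)"
        by (intro sum_mono)
      also have "\<dots> \<le> B / real n"
        unfolding sum_divide_distrib[symmetric] using \<rho>[OF H(1)] by (intro divide_right_mono) auto
      finally show "L2_set (\<lambda>h. m h * \<rho> h) H \<le> sqrt (B / real n)" unfolding L2_set_def by simp
      show "L2_set c H \<le> 1" unfolding L2_set_def using c[OF H(1)] by simp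
    qed (use \<rho>[of "{}"] in auto)
    finally show ?thesis by simp
  qed
  have "((\<lambda>H. \<bar>T - (\<Sum>h\<in>H. \<rho> h * c h)\<bar>) \<longlongrightarrow> \<bar>T - \<beta>\<bar>) (finite_subsets_at_top UNIV)"
    using sum unfolding has_sum_def by (intro tendsto_intros)
  moreover have "\<forall>\<^sub>F H in finite_subsets_at_top UNIV. \<bar>T - (\<Sum>h\<in>H. \<rho> h * c h)\<bar> \<le> sqrt (B / real n)"
    unfolding eventually_finite_subsets_at_top by (intro exI[of _ "{- int n<..<int n}"]) (auto intro: bound)
  ultimately have "\<bar>T - \<beta>\<bar> \<le> sqrt (B / real n)"
    by (rule tendsto_upperbound) (simp add: finite_subsets_at_top_neq_bot)
  then show ?thesis by (simp add: T_def)
qed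

section \<open>Mean squared error of one empirical coefficient\<close>

locale gaussian_process = prob_space P for P :: "'w measure" +
  fixes X :: "nat \<Rightarrow> 'w \<Rightarrow> real" and \<rho> :: "int \<Rightarrow> real"
  assumes stationary: "stationary_gaussian P X \<rho>"
begin

lemma gaussian_lin:
  assumes "finite I"
  shows "gaussian_rv P (\<lambda>w. \<Sum>t\<in>I. a t * X t w)"
proof -
  obtain N where N: "I \<subseteq> {..<N}" using assms finite_nat_bounded by blast
  have "\<forall>N a. gaussian_rv P (\<lambda>w. \<Sum>t<N. a t * X t w)"
    using stationary unfolding stationary_gaussian_def gaussian_sequence_def by simp
  from spec[OF spec[OF this, of N], of "\<lambda>t. if t \<in> I then a t else 0"]
  have "gaussian_rv P (\<lambda>w. \<Sum>t<N. (if t \<in> I then a t else 0) * X t w)" .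
  moreover have "(\<Sum>t<N. (if t \<in> I then a t else 0) * X t w) = (\<Sum>t\<in>I. a t * X t w)" for w
    by (rule sum.mono_neutral_cong_right) (use N in auto)
  ultimately show ?thesis by simp
qed

lemma gaussian_X: "gaussian_rv P (X t)"
  using gaussian_lin[of "{t}" "\<lambda>_. 1"] by simp

lemma measurable_X [measurable]: "X t \<in> borel_measurable P"
  using gaussian_X by (simp add: gaussian_rv_def)

lemma integrable_X: "integrable P (X t)"
  by (rule gaussian_central_moments(1)[OF gaussian_X])

definition \<mu> :: real where "\<mu> = expectation (X 0)"

lemma expectation_X: "expectation (X t) = \<mu>"
  using stationary unfolding stationary_gaussian_def \<mu>_def by blast

definition Z :: "nat \<Rightarrow> 'w \<Rightarrow> real" where "Z t w = X t w - \<mu>"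

lemma expectation_ZZ: "expectation (\<lambda>w. Z t w * Z t' w) = \<rho> (int t' - int t)"
proof -
  have "cov P (X t) (X t') = \<rho> (int t' - int t)"
    using stationary unfolding stationary_gaussian_def by blast
  then show ?thesis by (simp add: cov_def Z_def expectation_X)
qed

lemma \<rho>_even: "\<rho> (- h) = \<rho> h"
proof -
  have "\<rho> (int t' - int t) = \<rho> (int t - int t')" for t t'
    using expectation_ZZ[of t t'] expectation_ZZ[of t' t] by (simp add: mult.commute)
  from this[of "nat h" "nat (- h)"] show ?thesis by (cases "0 \<le> h") simp_all
qed

lemma gaussian_vector_Z:
  assumes "finite I"
  shows "gaussian_vector P I Z"
proof unfold_locales
  show "Z t \<in> borel_measurable P" for t unfolding Z_def by measurable
  fix a :: "nat \<Rightarrow> real"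
  define L where "L = (\<lambda>w. \<Sum>t\<in>I. a t * X t w)"
  have "expectation L = (\<Sum>t\<in>I. a t * \<mu>)"
    unfolding L_def by (simp add: Bochner_Integration.integral_sum integrable_X expectation_X)
  then have eq: "(\<Sum>t\<in>I. a t * Z t w) = L w - expectation L" for w
    by (simp add: L_def Z_def right_diff_distrib sum_subtractf)
  have "gaussian_rv P L" unfolding L_def by (rule gaussian_lin) fact
  from gaussian_central_moments[OF this]
  show "integrable P (\<lambda>w. (\<Sum>t\<in>I. a t * Z t w) ^ 4)"
    "expectation (\<lambda>w. (\<Sum>t\<in>I. a t * Z t w) ^ 4) = 3 * (expectation (\<lambda>w. (\<Sum>t\<in>I. a t * Z t w)\<^sup>2))\<^sup>2"
    unfolding eq by simp_all
qed fact

definition Y :: "nat \<Rightarrow> nat \<Rightarrow> 'w \<Rightarrow> real" where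
  "Y n t w = X t w - sample_mean n (\<lambda>t. X t w)"

lemma Y_eq: "1 \<le> n \<Longrightarrow> Y n t w = Z t w - (\<Sum>i=1..n. Z i w) / real n"
  by (simp add: Y_def Z_def sample_mean_def sum_subtractf diff_divide_distrib)

lemma gaussian_vector_Y:
  assumes "1 \<le> n"
  shows "gaussian_vector P {1..n} (Y n)"
proof (rule gaussian_vector_linear_image[OF gaussian_vector_Z[of "{1..n}"]])
  show "finite {1..n}" "finite {1..n}" by simp_all
  show "Y n j w = (\<Sum>i\<in>{1..n}. ((if i = j then 1 else 0) - 1 / real n) * Z i w)" if "j \<in> {1..n}" for j w
    using that assms
    by (simp add: Y_eq left_diff_distrib sum_subtractf sum_divide_distrib if_distrib[of "\<lambda>z. z * _"] cong: if_cong)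
qed

lemma integrable_ZZ: "integrable P (\<lambda>w. Z i w * Z j w)"
proof -
  interpret V: gaussian_vector P "{i, j}" Z by (rule gaussian_vector_Z) simp
  show ?thesis by (intro V.integrable_mult2) auto
qed

lemma expectation_YY:
  assumes n: "1 \<le> n"
  shows "expectation (\<lambda>w. Y n i w * Y n j w) = \<rho> (int i - int j)
    - (\<Sum>k=1..n. \<rho> (int i - int k)) / real n - (\<Sum>k=1..n. \<rho> (int j - int k)) / real n
    + (\<Sum>k=1..n. \<Sum>l=1..n. \<rho> (int k - int l)) / (real n)\<^sup>2"
proof -
  have "Y n i w * Y n j w = Z i w * Z j w - (\<Sum>k=1..n. Z i w * Z k w) / real n
      - (\<Sum>k=1..n. Z j w * Z k w) / real n + (\<Sum>k=1..n. \<Sum>l=1..n. Z k w * Z l w) / (real n)\<^sup>2" for w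
  proof -
    have alg: "(a - s / m) * (b - s / m) = a * b - a * s / m - b * s / m + s * s / m\<^sup>2" for a b s m :: real
      by (simp add: algebra_simps power2_eq_square)
    show ?thesis unfolding Y_eq[OF n] alg sum_product by (simp add: sum_distrib_left)
  qed
  then have "expectation (\<lambda>w. Y n i w * Y n j w)
      = expectation (\<lambda>w. Z i w * Z j w - (\<Sum>k=1..n. Z i w * Z k w) / real n
      - (\<Sum>k=1..n. Z j w * Z k w) / real n + (\<Sum>k=1..n. \<Sum>l=1..n. Z k w * Z l w) / (real n)\<^sup>2)"
    by simp
  also have "\<dots> = \<rho> (int j - int i)
    - (\<Sum>k=1..n. \<rho> (int k - int i)) / real n - (\<Sum>k=1..n. \<rho> (int k - int j)) / real n
    + (\<Sum>k=1..n. \<Sum>l=1..n. \<rho> (int l - int k)) / (real n)\<^sup>2"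
    by (simp add: integrable_ZZ expectation_ZZ Bochner_Integration.integral_sum)
  finally show ?thesis
    using \<rho>_even[of "int _ - int _"] by simp
qed

text \<open>Variance and squared bias from \<open>quadratic_form\<close>. With row sums at most 4 S,
  S = 2 pi B, the variance is at most 32 B^2 / n. The bias d1 + d2 contributes at most 2 d1^2 + 2
  d2^2 <= (18 B^2 + 2 B) / n, whence 50 = 32 + 18.\<close>

lemma empirical_mse:
  assumes n: "1 \<le> n"
    and c: "\<And>H. finite H \<Longrightarrow> (\<Sum>h\<in>H. (c h)\<^sup>2) \<le> 1"
    and B1: "\<And>H. finite H \<Longrightarrow> (\<Sum>h\<in>H. \<bar>\<rho> h\<bar> / (2 * pi)) \<le> B"
    and B2: "\<And>H. finite H \<Longrightarrow> (\<Sum>h\<in>H. \<bar>of_int h\<bar> * (\<rho> h / (2 * pi))\<^sup>2) \<le> B"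
    and \<beta>: "((\<lambda>h. \<rho> h / (2 * pi) * c h) has_sum \<beta>) UNIV"
  defines "b \<equiv> \<lambda>w. \<Sum>i=1..n. \<Sum>j=1..n. c (int i - int j) / (2 * pi * real n) * (Y n i w * Y n j w)"
  shows "integrable P (\<lambda>w. (b w - \<beta>)\<^sup>2)"
    and "expectation (\<lambda>w. (b w - \<beta>)\<^sup>2) \<le> (50 * B\<^sup>2 + 2 * B) / real n"
proof -
  interpret V: gaussian_vector P "{1..n}" "Y n" by (rule gaussian_vector_Y[OF n])
  define C where "C = (\<lambda>i j. c (int i - int j) / (2 * pi * real n))"
  define S where "S = 2 * pi * B"
  have B0: "0 \<le> B" using B1[of "{}"] by simp
  have n0: "0 < real n" using n by simp
  have S: "(\<Sum>h\<in>H. \<bar>\<rho> h\<bar>) \<le> S" if "finite H" for H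
    using B1[OF that] by (simp add: S_def field_simps flip: sum_divide_distrib)
  have S0: "0 \<le> S" using B0 by (simp add: S_def)
  have row: "(\<Sum>k=1..n. \<bar>\<rho> (int i - int k)\<bar>) \<le> S" for i
    by (rule sum_shift_le(1)) (rule S)
  \<comment> \<open>Subtracting the sample mean perturbs the covariance by three averages, each at
    most S / n because the rows of \<rho> are absolutely summable.\<close>
  have \<Gamma>: "\<bar>V.\<Gamma> i j - \<rho> (int i - int j)\<bar> \<le> 3 * S / real n" for i j
  proof -
    have r: "\<bar>\<Sum>k=1..n. \<rho> (int i - int k)\<bar> / real n \<le> S / real n" for i
      using order_trans[OF sum_abs row[of i]] n0 by (intro divide_right_mono) auto
    have "\<bar>\<Sum>k=1..n. \<Sum>l=1..n. \<rho> (int k - int l)\<bar> \<le> (\<Sum>k=1..n. S)"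
      by (rule order_trans[OF sum_abs]) (intro sum_mono order_trans[OF sum_abs row])
    then have d: "\<bar>\<Sum>k=1..n. \<Sum>l=1..n. \<rho> (int k - int l)\<bar> / (real n)\<^sup>2 \<le> S / real n"
      using n0 by (simp add: field_simps power2_eq_square)
    have "V.\<Gamma> i j - \<rho> (int i - int j) = - ((\<Sum>k=1..n. \<rho> (int i - int k)) / real n) - (\<Sum>k=1..n. \<rho> (int j - int k)) / real n
      + (\<Sum>k=1..n. \<Sum>l=1..n. \<rho> (int k - int l)) / (real n)\<^sup>2"
      unfolding V.\<Gamma>_def expectation_YY[OF n] by simp
    moreover have "\<bar>- x - y + z\<bar> \<le> \<bar>x\<bar> + \<bar>y\<bar> + \<bar>z\<bar>" for x y z :: real by linarith
    ultimately have "\<bar>V.\<Gamma> i j - \<rho> (int i - int j)\<bar> \<le> \<bar>(\<Sum>k=1..n. \<rho> (int i - int k)) / real n\<bar>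
      + \<bar>(\<Sum>k=1..n. \<rho> (int j - int k)) / real n\<bar> + \<bar>(\<Sum>k=1..n. \<Sum>l=1..n. \<rho> (int k - int l)) / (real n)\<^sup>2\<bar>"
      by (simp only:)
    also have "\<dots> \<le> S / real n + S / real n + S / real n"
      using r[of i] r[of j] d by (intro add_mono) (simp_all add: abs_divide)
    finally show ?thesis by simp
  qed
  have rowV: "(\<Sum>j\<in>{1..n}. \<bar>V.\<Gamma> i j\<bar>) \<le> 4 * S" for i
  proof -
    have "(\<Sum>j\<in>{1..n}. \<bar>V.\<Gamma> i j\<bar>) \<le> (\<Sum>j\<in>{1..n}. \<bar>\<rho> (int i - int j)\<bar> + 3 * S / real n)"
    proof (intro sum_mono)
      fix j show "\<bar>V.\<Gamma> i j\<bar> \<le> \<bar>\<rho> (int i - int j)\<bar> + 3 * S / real n"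
        using \<Gamma>[of i j] by linarith
    qed
    also have "\<dots> \<le> 4 * S" using row[of i] n0 by (simp add: sum.distrib)
    finally show ?thesis .
  qed
  have crow: "(\<Sum>j=1..n. (c (int i - int j))\<^sup>2) \<le> 1" for i
    by (rule sum_shift_le(1)) (rule c)
  have Csq: "(\<Sum>i\<in>{1..n}. \<Sum>j\<in>{1..n}. (C i j)\<^sup>2) \<le> 1 / (4 * pi\<^sup>2 * real n)"
  proof -
    have "(\<Sum>i\<in>{1..n}. \<Sum>j\<in>{1..n}. (C i j)\<^sup>2) = (\<Sum>i\<in>{1..n}. \<Sum>j\<in>{1..n}. (c (int i - int j))\<^sup>2) / (2 * pi * real n)\<^sup>2"
      by (simp add: C_def power_divide sum_divide_distrib)
    also have "\<dots> \<le> (\<Sum>i\<in>{1..n}. 1) / (2 * pi * real n)\<^sup>2"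
      using crow by (intro divide_right_mono sum_mono) auto
    also have "\<dots> = 1 / (4 * pi\<^sup>2 * real n)" using n0 by (simp add: power2_eq_square field_simps)
    finally show ?thesis .
  qed
  \<comment> \<open>c is only square summable, so a row of n entries has absolute sum up to sqrt n.
    Against covariance errors 3 S / n this still leaves d1 of order n^(-1/2).\<close>
  have absc: "(\<Sum>i=1..n. \<Sum>j=1..n. \<bar>c (int i - int j)\<bar>) \<le> real n * sqrt (real n)"
  proof -
    have "(\<Sum>j=1..n. \<bar>c (int i - int j)\<bar>) \<le> sqrt (real n)" for i
    proof -
      have "(\<Sum>j=1..n. \<bar>c (int i - int j)\<bar>) = (\<Sum>j=1..n. \<bar>1\<bar> * \<bar>c (int i - int j)\<bar>)" by simp
      also have "\<dots> \<le> L2_set (\<lambda>_. 1) {1..n} * L2_set (\<lambda>j. c (int i - int j)) {1..n}"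
        by (rule L2_set_mult_ineq)
      also have "\<dots> \<le> sqrt (real n) * 1"
        using crow[of i] by (intro mult_mono) (auto simp: L2_set_def sum_nonneg)
      finally show ?thesis by simp
    qed
    then have "(\<Sum>i=1..n. \<Sum>j=1..n. \<bar>c (int i - int j)\<bar>) \<le> (\<Sum>i=1..n. sqrt (real n))" by (intro sum_mono)
    then show ?thesis by simp
  qed
  define d1 where "d1 = (\<Sum>i=1..n. \<Sum>j=1..n. C i j * (V.\<Gamma> i j - \<rho> (int i - int j)))"
  define d2 where "d2 = (\<Sum>i=1..n. \<Sum>j=1..n. C i j * \<rho> (int i - int j)) - \<beta>"
  have split: "(\<Sum>i=1..n. \<Sum>j=1..n. C i j * V.\<Gamma> i j) - \<beta> = d1 + d2"
    by (simp add: d1_def d2_def right_diff_distrib sum_subtractf)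
  have d1: "d1\<^sup>2 \<le> 9 * B\<^sup>2 / real n"
  proof -
    have "\<bar>d1\<bar> \<le> (\<Sum>i=1..n. \<Sum>j=1..n. \<bar>c (int i - int j)\<bar> * (3 * S / real n / (2 * pi * real n)))"
      unfolding d1_def
    proof (rule order_trans[OF sum_abs], rule sum_mono, rule order_trans[OF sum_abs], rule sum_mono)
      fix i j
      have "\<bar>C i j * (V.\<Gamma> i j - \<rho> (int i - int j))\<bar>
          = \<bar>c (int i - int j)\<bar> * (\<bar>V.\<Gamma> i j - \<rho> (int i - int j)\<bar> / (2 * pi * real n))"
        by (simp add: C_def abs_mult)
      also have "\<dots> \<le> \<bar>c (int i - int j)\<bar> * (3 * S / real n / (2 * pi * real n))"
        using \<Gamma>[of i j] by (intro mult_left_mono divide_right_mono) auto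
      finally show "\<bar>C i j * (V.\<Gamma> i j - \<rho> (int i - int j))\<bar> \<le> \<bar>c (int i - int j)\<bar> * (3 * S / real n / (2 * pi * real n))" .
    qed
    also have "\<dots> = (\<Sum>i=1..n. \<Sum>j=1..n. \<bar>c (int i - int j)\<bar>) * (3 * S / real n / (2 * pi * real n))"
      by (simp only: sum_distrib_right)
    also have "\<dots> \<le> (real n * sqrt (real n)) * (3 * S / real n / (2 * pi * real n))"
      using absc S0 n0 by (intro mult_right_mono) auto
    also have "\<dots> = 3 * B * (sqrt (real n) / real n)"
      using n0 by (simp add: S_def field_simps)
    finally have "\<bar>d1\<bar> \<le> 3 * B * (sqrt (real n) / real n)" .
    from power_mono[OF this, of 2] show ?thesis
      using n0 by (simp add: power_mult_distrib power_divide) (simp add: power2_eq_square)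
  qed
  have d2: "d2\<^sup>2 \<le> B / real n"
  proof -
    have "(\<Sum>i=1..n. \<Sum>j=1..n. C i j * \<rho> (int i - int j))
        = (\<Sum>i=1..n. \<Sum>j=1..n. \<rho> (int i - int j) / (2 * pi) * c (int i - int j)) / real n"
      by (simp add: C_def sum_divide_distrib mult_ac)
    then have "\<bar>d2\<bar> \<le> sqrt (B / real n)"
      unfolding d2_def using toeplitz_bias[OF n c B2 \<beta>] by simp
    from power_mono[OF this, of 2] show ?thesis using B0 n0 by simp
  qed
  have bw: "b w = (\<Sum>i\<in>{1..n}. \<Sum>j\<in>{1..n}. C i j * (Y n i w * Y n j w))" for w
    by (simp add: b_def C_def)
  show "integrable P (\<lambda>w. (b w - \<beta>)\<^sup>2)"
    unfolding bw by (rule V.quadratic_form(1)[OF rowV])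
  have "expectation (\<lambda>w. (b w - \<beta>)\<^sup>2)
      \<le> 2 * (4 * S)\<^sup>2 * (\<Sum>i\<in>{1..n}. \<Sum>j\<in>{1..n}. (C i j)\<^sup>2) + ((\<Sum>i\<in>{1..n}. \<Sum>j\<in>{1..n}. C i j * V.\<Gamma> i j) - \<beta>)\<^sup>2"
    unfolding bw by (rule V.quadratic_form(2)[OF rowV])
  also have "\<dots> \<le> 2 * (4 * S)\<^sup>2 * (1 / (4 * pi\<^sup>2 * real n)) + (2 * (9 * B\<^sup>2 / real n) + 2 * (B / real n))"
  proof (intro add_mono mult_left_mono Csq)
    have "(d1 + d2)\<^sup>2 \<le> 2 * d1\<^sup>2 + 2 * d2\<^sup>2"
      using zero_le_power2[of "d1 - d2"] by (simp add: power2_sum power2_diff)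
    then show "((\<Sum>i\<in>{1..n}. \<Sum>j\<in>{1..n}. C i j * V.\<Gamma> i j) - \<beta>)\<^sup>2 \<le> 2 * (9 * B\<^sup>2 / real n) + 2 * (B / real n)"
      unfolding split using d1 d2 by linarith
  qed auto
  also have "\<dots> = (50 * B\<^sup>2 + 2 * B) / real n"
    using n0 by (simp add: S_def power_mult_distrib field_simps)
  finally show "expectation (\<lambda>w. (b w - \<beta>)\<^sup>2) \<le> (50 * B\<^sup>2 + 2 * B) / real n" .
qed

end

section \<open>The periodogram as a real quadratic form\<close>

definition emp_coeff_real :: "(real \<Rightarrow> real) \<Rightarrow> nat \<Rightarrow> (nat \<Rightarrow> real) \<Rightarrow> real" where
  "emp_coeff_real v n x = (\<Sum>i=1..n. \<Sum>j=1..n. cos_coef v (int i - int j) / (2 * pi * real n)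
     * ((x i - sample_mean n x) * (x j - sample_mean n x)))"

text \<open>The imaginary part is antisymmetric under exchange of the two time indices, so it equals
  its own negative.\<close>

lemma periodogram_real:
  "periodogram n x \<omega> = complex_of_real (\<Sum>i=1..n. \<Sum>j=1..n.
     (x i - sample_mean n x) * (x j - sample_mean n x) / (2 * pi * real n) * cos (2 * pi * of_int (int i - int j) * \<omega>))"
proof -
  define y where "y = (\<lambda>i. x i - sample_mean n x)"
  define S where "S = (\<Sum>i=1..n. \<Sum>j=1..n. y i * y j * sin (2 * pi * of_int (int i - int j) * \<omega>))"
  have "S = (\<Sum>j=1..n. \<Sum>i=1..n. y i * y j * sin (2 * pi * of_int (int i - int j) * \<omega>))"
    unfolding S_def by (rule sum.swap)
  also have "\<dots> = (\<Sum>j=1..n. \<Sum>i=1..n. - (y j * y i * sin (2 * pi * of_int (int j - int i) * \<omega>)))"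
  proof (intro sum.cong refl)
    fix i j :: nat
    have "2 * pi * of_int (int i - int j) * \<omega> = - (2 * pi * of_int (int j - int i) * \<omega>)"
      by (simp add: algebra_simps)
    then have "sin (2 * pi * of_int (int i - int j) * \<omega>) = - sin (2 * pi * of_int (int j - int i) * \<omega>)"
      by (simp only: sin_minus)
    then show "y i * y j * sin (2 * pi * of_int (int i - int j) * \<omega>) = - (y j * y i * sin (2 * pi * of_int (int j - int i) * \<omega>))"
      by (simp add: mult.commute mult.left_commute del: of_int_diff)
  qed
  also have "\<dots> = - S" unfolding S_def sum_negf ..
  finally have S0: "S = 0" by simp
  have e: "exp (\<i> * 2 * pi * \<omega> * (real i - real j)) = cis (2 * pi * of_int (int i - int j) * \<omega>)" for i j
    by (simp add: cis_conv_exp mult_ac)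
  have summand: "complex_of_real (y i) * cnj (complex_of_real (y j)) * exp (\<i> * 2 * pi * \<omega> * (real i - real j))
      = Complex (y i * y j * cos (2 * pi * of_int (int i - int j) * \<omega>)) (y i * y j * sin (2 * pi * of_int (int i - int j) * \<omega>))" for i j
    unfolding e by (simp add: complex_eq_iff del: of_int_diff)
  have "(\<Sum>i=1..n. \<Sum>j=1..n. complex_of_real (y i) * cnj (complex_of_real (y j)) * exp (\<i> * 2 * pi * \<omega> * (real i - real j)))
      = Complex (\<Sum>i=1..n. \<Sum>j=1..n. y i * y j * cos (2 * pi * of_int (int i - int j) * \<omega>)) S"
    unfolding summand S_def by (simp add: complex_eq_iff)
  also have "\<dots> = complex_of_real (\<Sum>i=1..n. \<Sum>j=1..n. y i * y j * cos (2 * pi * of_int (int i - int j) * \<omega>))"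
    by (simp add: S0 complex_eq_iff)
  finally have "periodogram n x \<omega> = 1 / (2 * pi * real n) * complex_of_real (\<Sum>i=1..n. \<Sum>j=1..n. y i * y j * cos (2 * pi * of_int (int i - int j) * \<omega>))"
    unfolding periodogram_def y_def by simp
  also have "\<dots> = complex_of_real ((\<Sum>i=1..n. \<Sum>j=1..n. y i * y j * cos (2 * pi * of_int (int i - int j) * \<omega>)) / (2 * pi * real n))"
    by simp
  also have "(\<Sum>i=1..n. \<Sum>j=1..n. y i * y j * cos (2 * pi * of_int (int i - int j) * \<omega>)) / (2 * pi * real n)
      = (\<Sum>i=1..n. \<Sum>j=1..n. y i * y j / (2 * pi * real n) * cos (2 * pi * of_int (int i - int j) * \<omega>))"
    unfolding sum_divide_distrib by simp
  finally show ?thesis unfolding y_def .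
qed

lemma emp_coeff_eq_real:
  assumes v: "wavelet \<phi> \<psi> 0 jk \<in> L2_unit"
  shows "emp_coeff \<phi> \<psi> n x jk = complex_of_real (emp_coeff_real (wavelet \<phi> \<psi> 0 jk) n x)"
proof -
  define v where "v = wavelet \<phi> \<psi> 0 jk"
  define y where "y = (\<lambda>i j. (x i - sample_mean n x) * (x j - sample_mean n x) / (2 * pi * real n))"
  have vi: "integrable unit_leb v" unfolding v_def by (rule integrable_L2_unit[OF v])
  have vcos: "integrable unit_leb (\<lambda>t. v t * cos (c * t))" for c
  proof (rule Bochner_Integration.integrable_bound[OF vi])
    show "(\<lambda>t. v t * cos (c * t)) \<in> borel_measurable unit_leb"
      using borel_measurable_integrable[OF vi] measurable_cos_unit by (rule borel_measurable_times)
  qed (auto simp: abs_mult mult_right_le_one_le)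
  have "emp_coeff \<phi> \<psi> n x jk = (\<integral>t. complex_of_real (\<Sum>i=1..n. \<Sum>j=1..n. y i j * (v t * cos (2 * pi * of_int (int i - int j) * t))) \<partial>unit_leb)"
  proof -
    have "periodogram n x t = complex_of_real (\<Sum>i=1..n. \<Sum>j=1..n. y i j * cos (2 * pi * of_int (int i - int j) * t))" for t
      unfolding periodogram_real y_def ..
    then show ?thesis
      unfolding emp_coeff_def v_def[symmetric]
      by (simp only: of_real_mult[symmetric] sum_distrib_right mult.assoc) (simp only: mult.commute[of "v _"])
  qed
  also have "\<dots> = complex_of_real (\<integral>t. (\<Sum>i=1..n. \<Sum>j=1..n. y i j * (v t * cos (2 * pi * of_int (int i - int j) * t))) \<partial>unit_leb)"
    by (rule integral_complex_of_real)
  also have "(\<integral>t. (\<Sum>i=1..n. \<Sum>j=1..n. y i j * (v t * cos (2 * pi * of_int (int i - int j) * t))) \<partial>unit_leb)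
      = (\<Sum>i=1..n. \<Sum>j=1..n. y i j * cos_coef v (int i - int j))"
    unfolding cos_coef_def
    using vcos by (simp add: Bochner_Integration.integral_sum Bochner_Integration.integrable_sum del: of_int_diff)
  finally show ?thesis by (simp add: emp_coeff_real_def v_def y_def mult_ac)
qed

section \<open>Existence and risk of the projection estimator\<close>

context wavelet_basis
begin

definition besov_ball :: "real \<Rightarrow> real \<Rightarrow> (real \<Rightarrow> real) \<Rightarrow> bool" where
  "besov_ball s M g \<longleftrightarrow> g \<in> L2_unit \<and> besov_finite \<psi> s 2 2 g \<and> besov_norm \<phi> \<psi> s 2 2 g \<le> M"

text \<open>The error is measured against the coefficients of f itself; the distance from those to
  the coefficients of exp(g_J) is deterministic and added in
  \<open>small_error_bound\<close>.\<close>

definition sq_error :: "(real \<Rightarrow> real) \<Rightarrow> nat \<Rightarrow> nat \<Rightarrow> (nat \<Rightarrow> real) \<Rightarrow> real" where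
  "sq_error f J n x = (\<Sum>i\<in>trunc_index 0 J. (emp_coeff_real (W i) n x - (\<integral>\<omega>. f \<omega> * W i \<omega> \<partial>unit_leb))\<^sup>2)"

lemma W_trunc_L2: "i \<in> trunc_index 0 J \<Longrightarrow> W i \<in> L2_unit"
  using W_L2 trunc_index_subset by blast

lemma solves_projection_iff:
  "solves_projection \<phi> \<psi> J n x \<theta> \<longleftrightarrow> (\<forall>i\<in>trunc_index 0 J. F.coef J \<theta> i = emp_coeff_real (W i) n x)"
proof -
  have "ip (exp_family \<phi> \<psi> J \<theta>) (W i) = F.coef J \<theta> i" for i
    by (simp add: ip_def exp_family_def F.coef_def F.lin_def)
  then show ?thesis
    unfolding solves_projection_def using emp_coeff_eq_real[OF W_trunc_L2] by (auto simp del: of_real_eq_iff) (simp_all only: of_real_eq_iff)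
qed

lemma KL_loss_exp:
  assumes "\<And>x. x \<in> {0..1} \<Longrightarrow> f x = exp (g x)"
  shows "KL_loss f (exp_family \<phi> \<psi> J \<theta>)
    = (\<integral>x. exp (g x) * (g x - F.lin J \<theta> x) - exp (g x) + exp (F.lin J \<theta> x) \<partial>unit_leb)"
  unfolding KL_loss_def
proof (rule Bochner_Integration.integral_cong[OF refl])
  fix x assume "x \<in> space unit_leb"
  then have f: "f x = exp (g x)" using assms by simp
  have e: "exp_family \<phi> \<psi> J \<theta> x = exp (F.lin J \<theta> x)" by (simp add: exp_family_def F.lin_def)
  show "f x * ln (f x / exp_family \<phi> \<psi> J \<theta> x) - f x + exp_family \<phi> \<psi> J \<theta> x
      = exp (g x) * (g x - F.lin J \<theta> x) - exp (g x) + exp (F.lin J \<theta> x)"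
    unfolding f e by (simp flip: exp_diff)
qed

text \<open>Let \<eta> be twice the sum of squared bias and \<open>sq_error\<close>. It bounds the
  squared distance from the empirical coefficients c to those of exp(g_J), so every solution lies
  within 2 exp(B) sqrt \<eta> of a. The loss is the approximation loss plus a pairing of that
  displacement with c - b, at most 2 exp(B) \<eta>.\<close>

lemma small_error_bound:
  fixes J :: nat
  assumes s: "1/2 < s" and M: "0 < M" and g: "besov_ball s M g"
    and f: "\<And>x. x \<in> {0..1} \<Longrightarrow> f x = exp (g x)"
  defines "B \<equiv> sup_bound s M" and "e \<equiv> M\<^sup>2 * 2 powr (- 2 * real J * s)"
  assumes small: "2 * ((exp B)\<^sup>2 * e + sq_error f J n x) * (D J)\<^sup>2 < (exp (- B) / 2)\<^sup>2"
  shows "\<exists>\<theta>. solves_projection \<phi> \<psi> J n x \<theta>"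
    and "solves_projection \<phi> \<psi> J n x \<theta> \<Longrightarrow>
      KL_loss f (exp_family \<phi> \<psi> J \<theta>) \<le> exp B * e + 4 * exp B * ((exp B)\<^sup>2 * e + sq_error f J n x)"
proof -
  define a where "a = (\<lambda>i. ip g (W i))"
  define b where "b = (\<lambda>i. \<integral>x. exp (g x) * W i x \<partial>unit_leb)"
  define c where "c = (\<lambda>i. emp_coeff_real (W i) n x)"
  let ?I = "trunc_index 0 J"
  have g': "g \<in> L2_unit" "besov_finite \<psi> s 2 2 g" "besov_norm \<phi> \<psi> s 2 2 g \<le> M"
    using g by (auto simp: besov_ball_def)
  have gm: "g \<in> borel_measurable unit_leb" using g' by (simp add: L2_unit_def)
  note gB = AE_abs_besov_le[OF s M g', folded B_def]
  have aB: "\<bar>F.lin J a x\<bar> \<le> B" for x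
    unfolding a_def B_def by (rule abs_lin_besov_le[OF s M g'(2,3)])
  have approx: "(\<integral>x. (g x - F.lin J a x)\<^sup>2 \<partial>unit_leb) \<le> e"
    unfolding a_def e_def by (rule lin_approx_le[OF s g'])
  have fb: "(\<integral>\<omega>. f \<omega> * W i \<omega> \<partial>unit_leb) = b i" for i
    unfolding b_def by (rule Bochner_Integration.integral_cong) (simp_all add: f)
  define \<sigma> where "\<sigma> = sq_error f J n x"
  have \<sigma>: "\<sigma> = (\<Sum>i\<in>?I. (c i - b i)\<^sup>2)" by (simp add: \<sigma>_def sq_error_def fb c_def)
  have \<sigma>0: "0 \<le> \<sigma>" by (simp add: \<sigma> sum_nonneg)
  define \<eta> where "\<eta> = 2 * ((exp B)\<^sup>2 * e + \<sigma>)"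
  have e0: "0 \<le> e" by (simp add: e_def)
  have \<eta>0: "0 \<le> \<eta>" using \<sigma>0 e0 by (simp add: \<eta>_def)
  have "(\<Sum>i\<in>?I. (b i - F.coef J a i)\<^sup>2) \<le> (exp B)\<^sup>2 * (\<integral>x. (g x - F.lin J a x)\<^sup>2 \<partial>unit_leb)"
    unfolding b_def by (rule F.coef_approx_le[OF gm gB aB])
  also have "\<dots> \<le> (exp B)\<^sup>2 * e" using approx by (intro mult_left_mono) auto
  finally have bias: "(\<Sum>i\<in>?I. (b i - F.coef J a i)\<^sup>2) \<le> (exp B)\<^sup>2 * e" .
  have "(\<Sum>i\<in>?I. (c i - F.coef J a i)\<^sup>2) \<le> (\<Sum>i\<in>?I. 2 * (c i - b i)\<^sup>2 + 2 * (b i - F.coef J a i)\<^sup>2)"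
  proof (rule sum_mono)
    fix i
    have "0 \<le> ((c i - b i) - (b i - F.coef J a i))\<^sup>2" by simp
    then show "(c i - F.coef J a i)\<^sup>2 \<le> 2 * (c i - b i)\<^sup>2 + 2 * (b i - F.coef J a i)\<^sup>2"
      by (simp add: power2_eq_square algebra_simps)
  qed
  also have "\<dots> \<le> \<eta>" using bias by (simp add: \<eta>_def \<sigma> sum.distrib flip: sum_distrib_left)
  finally have L2: "L2_set (\<lambda>i. c i - F.coef J a i) ?I \<le> sqrt \<eta>" by (simp add: L2_set_def)
  have D0: "0 \<le> D J" using A_pos by simp
  have "sqrt \<eta> * D J < exp (- B) / 2"
  proof (rule power2_less_imp_less)
    show "(sqrt \<eta> * D J)\<^sup>2 < (exp (- B) / 2)\<^sup>2"
      using small \<eta>0 by (simp add: power_mult_distrib \<eta>_def \<sigma>_def)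
  qed simp
  then have near: "L2_set (\<lambda>i. c i - F.coef J a i) ?I * D J < exp (- B) / 2"
    using mult_right_mono[OF L2 D0] by linarith
  have "\<exists>\<theta>. \<forall>i\<in>?I. F.coef J \<theta> i = c i" by (rule F.coef_surj_near[OF aB near])
  then show "\<exists>\<theta>. solves_projection \<phi> \<psi> J n x \<theta>" by (simp add: solves_projection_iff c_def)
  assume "solves_projection \<phi> \<psi> J n x \<theta>"
  then have \<theta>: "F.coef J \<theta> i = c i" if "i \<in> ?I" for i using that by (simp add: solves_projection_iff c_def)
  have "L2_set (\<lambda>i. \<theta> i - a i) ?I \<le> L2_set (\<lambda>i. c i - F.coef J a i) ?I / (exp (- B) / 2)"
    by (rule F.coef_near[OF aB near \<theta>])
  also have "\<dots> \<le> sqrt \<eta> / (exp (- B) / 2)" using L2 by (intro divide_right_mono) auto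
  also have "\<dots> = 2 * exp B * sqrt \<eta>" by (simp add: exp_minus field_simps)
  finally have \<theta>a: "L2_set (\<lambda>i. \<theta> i - a i) ?I \<le> 2 * exp B * sqrt \<eta>" .
  \<comment> \<open>The pairing in \<open>KL_projection_le\<close> is with the coefficients b of f,
    not with those of exp(g_J); the error c - b alone is also below sqrt \<eta>.\<close>
  have "L2_set (\<lambda>i. c i - b i) ?I \<le> sqrt \<eta>"
    unfolding L2_set_def \<sigma>[symmetric] using \<sigma>0 e0 by (simp add: \<eta>_def)
  then have "L2_set (\<lambda>i. \<theta> i - a i) ?I * L2_set (\<lambda>i. c i - b i) ?I \<le> (2 * exp B * sqrt \<eta>) * sqrt \<eta>"
    using \<theta>a \<eta>0 by (intro mult_mono) auto
  also have "\<dots> = 2 * exp B * \<eta>" using \<eta>0 by simp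
  finally have cross: "L2_set (\<lambda>i. \<theta> i - a i) ?I * L2_set (\<lambda>i. c i - b i) ?I \<le> 2 * exp B * \<eta>" .
  have "KL_loss f (exp_family \<phi> \<psi> J \<theta>)
      \<le> (\<integral>x. exp (g x) * (g x - F.lin J a x) - exp (g x) + exp (F.lin J a x) \<partial>unit_leb)
        + (\<Sum>i\<in>?I. (\<theta> i - a i) * (F.coef J \<theta> i - b i))"
    using F.KL_projection_le[OF gm gB aB, where \<theta>=\<theta>] KL_loss_exp[of f g J \<theta>, OF f] unfolding b_def by (simp only:)
  also have "(\<Sum>i\<in>?I. (\<theta> i - a i) * (F.coef J \<theta> i - b i)) = (\<Sum>i\<in>?I. (\<theta> i - a i) * (c i - b i))"
    by (intro sum.cong refl) (simp add: \<theta>)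
  also have "\<dots> \<le> 2 * exp B * \<eta>"
    using F.abs_sum_mult_le[where J=J and f="\<lambda>i. \<theta> i - a i" and g="\<lambda>i. c i - b i"] cross by linarith
  also have "(\<integral>x. exp (g x) * (g x - F.lin J a x) - exp (g x) + exp (F.lin J a x) \<partial>unit_leb)
      \<le> exp B * (\<integral>x. (g x - F.lin J a x)\<^sup>2 \<partial>unit_leb)"
    by (rule F.KL_approx_le[OF gm gB aB])
  also have "\<dots> \<le> exp B * e" using approx by (intro mult_left_mono) auto
  finally show "KL_loss f (exp_family \<phi> \<psi> J \<theta>) \<le> exp B * e + 4 * exp B * ((exp B)\<^sup>2 * e + sq_error f J n x)"
    by (simp add: \<eta>_def \<sigma>_def algebra_simps)
qed

end

section \<open>The chosen level and its rates\<close>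

lemma level_bounds:
  assumes "0 < s" "1 \<le> n"
  shows "2 ^ level s n \<le> real n powr (1 / (2 * s + 1))"
    and "real n powr (1 / (2 * s + 1)) < 2 ^ Suc (level s n)"
proof -
  define N where "N = real n powr (1 / (2 * s + 1))"
  have N1: "1 \<le> N" unfolding N_def using assms by (intro ge_one_powr_ge_zero) auto
  obtain b where "N < 2 ^ b" using real_arch_pow[of 2 N] by auto
  have b: "j \<le> b" if "2 ^ j \<le> N" for j
  proof (rule ccontr)
    assume "\<not> j \<le> b"
    then have "(2::real) ^ b \<le> 2 ^ j" by (intro power_increasing) auto
    then show False using that \<open>N < 2 ^ b\<close> by linarith
  qed
  have P0: "2 ^ 0 \<le> N" using N1 by simp
  have lev: "level s n = (GREATEST j. 2 ^ j \<le> N)" by (simp add: level_def N_def)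
  show "2 ^ level s n \<le> real n powr (1 / (2 * s + 1))"
    unfolding lev N_def[symmetric] by (rule GreatestI_nat[of "\<lambda>j. 2 ^ j \<le> N", OF P0 b])
  show "real n powr (1 / (2 * s + 1)) < 2 ^ Suc (level s n)"
  proof (rule ccontr)
    assume "\<not> real n powr (1 / (2 * s + 1)) < 2 ^ Suc (level s n)"
    then have "2 ^ Suc (level s n) \<le> N" by (simp add: N_def)
    from Greatest_le_nat[of "\<lambda>j. 2 ^ j \<le> N", OF this b] show False unfolding lev by simp
  qed
qed

text \<open>Maximality of the level gives 2^J >= n^(1/(2s+1)) / 2; the halving costs the factor
  2^(2s).\<close>

lemma level_powr_le:
  assumes s: "0 < s" and n: "1 \<le> n"
  shows "2 powr (- 2 * real (level s n) * s) \<le> 2 powr (2 * s) * real n powr (- (2 * s / (2 * s + 1)))"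
proof -
  define N where "N = real n powr (1 / (2 * s + 1))"
  define J where "J = level s n"
  have n0: "0 < real n" using n by simp
  then have N0: "0 < N" by (simp add: N_def)
  have "N / 2 \<le> 2 ^ J" using level_bounds(2)[OF s n] by (simp add: N_def J_def)
  then have "(2 ^ J :: real) powr (- 2 * s) \<le> (N / 2) powr (- 2 * s)"
    using s N0 by (intro powr_mono2') auto
  moreover have "(2 ^ J :: real) powr (- 2 * s) = 2 powr (- 2 * real J * s)"
    by (simp add: powr_powr mult_ac flip: powr_realpow)
  moreover have "(N / 2) powr (- 2 * s) = 2 powr (2 * s) * N powr (- 2 * s)"
    using N0 by (simp add: powr_divide powr_minus field_simps)
  moreover have "N powr (- 2 * s) = real n powr (- (2 * s / (2 * s + 1)))"
    unfolding N_def powr_powr by (simp add: field_simps)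
  ultimately show ?thesis by (simp add: J_def)
qed

context wavelet_basis
begin

text \<open>A purely deterministic statement. The threshold for n and the constant K' precede the
  choice of f and of the path, which is what later gives uniformity over the class.\<close>

lemma sq_error_implies_good:
  assumes s: "1/2 < s" and M: "0 < M" and K: "0 \<le> K"
  obtains K' where "\<forall>\<^sub>F n in sequentially. \<forall>g f x. besov_ball s M g \<longrightarrow> (\<forall>t\<in>{0..1}. f t = exp (g t)) \<longrightarrow>
    real n powr (2 * s / (2 * s + 1)) * sq_error f (level s n) n x \<le> K \<longrightarrow>
    estimator_exists \<phi> \<psi> s n x \<and> \<not> loss_exceeds \<phi> \<psi> s f n K' x"
proof -
  define r where "r = 2 * s / (2 * s + 1)"
  define B where "B = sup_bound s M"
  define e0 where "e0 = M\<^sup>2 * 2 powr (2 * s)"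
  \<comment> \<open>Both constants come from \<open>small_error_bound\<close> on inserting e <= e0
    n^(-r), squared error <= K n^(-r) and 2^J <= n^(1/(2s+1)): c for the smallness condition, K' for
    the loss. In the former, the exponent 1/(2s+1) - r = (1-2s)/(2s+1) is negative.\<close>
  define c where "c = 2 * ((exp B)\<^sup>2 * e0 + K) * A\<^sup>2"
  define K' where "K' = exp B * e0 + 4 * exp B * ((exp B)\<^sup>2 * e0 + K)"
  have "(\<lambda>n. c * real n powr ((1 - 2 * s) / (2 * s + 1))) \<longlonglongrightarrow> c * 0"
  proof (intro tendsto_mult tendsto_const)
    have "(1 - 2 * s) / (2 * s + 1) < 0" using s by (simp add: divide_neg_pos)
    then show "(\<lambda>n. real n powr ((1 - 2 * s) / (2 * s + 1))) \<longlonglongrightarrow> 0"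
      by (intro tendsto_neg_powr filterlim_real_sequentially)
  qed
  then have "\<forall>\<^sub>F n in sequentially. c * real n powr ((1 - 2 * s) / (2 * s + 1)) < (exp (- B) / 2)\<^sup>2"
    by (intro order_tendstoD(2)) auto
  then have "\<forall>\<^sub>F n in sequentially. \<forall>g f x. besov_ball s M g \<longrightarrow> (\<forall>t\<in>{0..1}. f t = exp (g t)) \<longrightarrow>
    real n powr r * sq_error f (level s n) n x \<le> K \<longrightarrow>
    estimator_exists \<phi> \<psi> s n x \<and> \<not> loss_exceeds \<phi> \<psi> s f n K' x"
    using eventually_ge_at_top[of 1]
  proof eventually_elim
    case (elim n)
    show ?case
    proof (intro allI impI)
      fix g f x
      assume g: "besov_ball s M g" and f: "\<forall>t\<in>{0..1}. f t = exp (g t)"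
        and le: "real n powr r * sq_error f (level s n) n x \<le> K"
      define J where "J = level s n"
      define N where "N = real n powr (- r)"
      define e where "e = M\<^sup>2 * 2 powr (- 2 * real J * s)"
      have n0: "0 < real n" using elim(2) by simp
      then have N0: "0 < N" by (simp add: N_def)
      have rN: "real n powr r * N = 1" using n0 by (simp add: N_def flip: powr_add)
      have "e \<le> M\<^sup>2 * (2 powr (2 * s) * N)"
        unfolding e_def J_def N_def r_def using level_powr_le[of s n] s elim(2) by (intro mult_left_mono) auto
      then have e: "e \<le> e0 * N" by (simp add: e0_def mult.assoc)
      have "N * (real n powr r * sq_error f J n x) \<le> N * K" using le N0 by (simp add: J_def)
      also have "N * (real n powr r * sq_error f J n x) = (real n powr r * N) * sq_error f J n x" by simp
      finally have \<sigma>: "sq_error f J n x \<le> K * N" unfolding rN by (simp add: mult.commute)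
      have e\<sigma>: "(exp B)\<^sup>2 * e + sq_error f J n x \<le> ((exp B)\<^sup>2 * e0 + K) * N"
      proof -
        have "(exp B)\<^sup>2 * e \<le> (exp B)\<^sup>2 * (e0 * N)" using e by (intro mult_left_mono) auto
        moreover have "((exp B)\<^sup>2 * e0 + K) * N = (exp B)\<^sup>2 * (e0 * N) + K * N" by (simp add: algebra_simps)
        ultimately show ?thesis using \<sigma> by linarith
      qed
      have e0': "0 \<le> (exp B)\<^sup>2 * e + sq_error f J n x"
        by (simp add: e_def sq_error_def sum_nonneg)
      have "(D J)\<^sup>2 \<le> A\<^sup>2 * real n powr (1 / (2 * s + 1))"
        using level_bounds(1)[of s n] s elim(2) by (simp add: power_mult_distrib J_def mult_left_mono)
      then have "2 * ((exp B)\<^sup>2 * e + sq_error f J n x) * (D J)\<^sup>2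
          \<le> 2 * (((exp B)\<^sup>2 * e0 + K) * N) * (A\<^sup>2 * real n powr (1 / (2 * s + 1)))"
        using e\<sigma> e0' by (intro mult_mono) auto
      also have "\<dots> = c * (N * real n powr (1 / (2 * s + 1)))" by (simp add: c_def)
      also have "N * real n powr (1 / (2 * s + 1)) = real n powr ((1 - 2 * s) / (2 * s + 1))"
        unfolding N_def r_def powr_add[symmetric] by (simp add: diff_divide_distrib)
      also note elim(1)
      finally have small: "2 * ((exp B)\<^sup>2 * e + sq_error f J n x) * (D J)\<^sup>2 < (exp (- B) / 2)\<^sup>2" .
      have f': "f t = exp (g t)" if "t \<in> {0..1}" for t using f that by blast
      note good = small_error_bound[OF s M g f' small[unfolded B_def e_def], folded B_def e_def]
      have "real n powr r * KL_loss f (exp_family \<phi> \<psi> J \<theta>) \<le> K'" if "solves_projection \<phi> \<psi> J n x \<theta>" for \<theta>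
      proof -
        have "exp B * e + 4 * exp B * ((exp B)\<^sup>2 * e + sq_error f J n x)
            \<le> exp B * (e0 * N) + 4 * exp B * (((exp B)\<^sup>2 * e0 + K) * N)"
          using e e\<sigma> by (intro add_mono mult_left_mono) auto
        also have "\<dots> = K' * N" by (simp add: K'_def algebra_simps)
        finally have "KL_loss f (exp_family \<phi> \<psi> J \<theta>) \<le> K' * N" using good(2)[OF _ that] by linarith
        then have "real n powr r * KL_loss f (exp_family \<phi> \<psi> J \<theta>) \<le> real n powr r * (K' * N)"
          by (intro mult_left_mono) auto
        also have "\<dots> = K'" using rN by (simp add: mult_ac)
        finally show ?thesis .
      qed
      then show "estimator_exists \<phi> \<psi> s n x \<and> \<not> loss_exceeds \<phi> \<psi> s f n K' x"
        using good(1) unfolding estimator_exists_def loss_exceeds_def J_def r_def by (auto simp: not_less)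
    qed
  qed
  then show thesis using that by (simp add: r_def)
qed

end

section \<open>Tail bounds uniform over the class\<close>

locale regular_spectral_class = wavelet_basis \<phi> \<psi> A for \<phi> \<psi> A +
  fixes s M B :: real
  assumes s_gt: "1/2 < s" and M_pos: "0 < M"
    and fourier_bound: "\<And>f. f \<in> exp_class \<phi> \<psi> s 2 2 M \<Longrightarrow>
      (\<lambda>h. norm (fourier_cov f h)) summable_on UNIV \<and> (\<Sum>\<^sub>\<infinity>h. norm (fourier_cov f h)) \<le> B \<and>
      (\<lambda>h. norm (of_int h * (fourier_cov f h)\<^sup>2)) summable_on UNIV \<and>
      (\<Sum>\<^sub>\<infinity>h. norm (of_int h * (fourier_cov f h)\<^sup>2)) \<le> B"
begin

abbreviation "S \<equiv> exp_class \<phi> \<psi> s 2 2 M"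

text \<open>The constant of \<open>empirical_mse\<close>. Here \<open>B\<close> bounds the Fourier
  sums over the class; it is not the sup bound on the logarithm.\<close>

definition V :: real where "V = 50 * B\<^sup>2 + 2 * B"

lemma exp_classE:
  assumes "f \<in> S"
  obtains g where "besov_ball s M g" "\<forall>t\<in>{0..1}. f t = exp (g t)" "f \<in> borel_measurable unit_leb"
proof -
  obtain g where g: "besov_ball s M g" and f: "\<forall>t\<in>{0..1}. f t = exp (g t)"
    using assms by (auto simp: exp_class_def besov_ball_def)
  have "g \<in> borel_measurable unit_leb" using g by (simp add: besov_ball_def L2_unit_def)
  then have "(\<lambda>t. exp (g t)) \<in> borel_measurable unit_leb" by measurable
  moreover have "f \<in> borel_measurable unit_leb \<longleftrightarrow> (\<lambda>t. exp (g t)) \<in> borel_measurable unit_leb"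
    by (rule measurable_cong) (use f in auto)
  ultimately show thesis using that g f by blast
qed

section \<open>A single process with spectral density in the class\<close>

context
  fixes f :: "real \<Rightarrow> real" and P :: "'w measure" and X \<rho>
  assumes f: "f \<in> S" and stat: "stationary_gaussian P X \<rho>" and spec: "spectral_density \<rho> f"
begin

interpretation P: gaussian_process P X \<rho>
proof -
  have "prob_space P" using stat by (simp add: stationary_gaussian_def gaussian_sequence_def)
  then interpret prob_space P .
  show "gaussian_process P X \<rho>" by unfold_locales (rule stat)
qed

lemma measurable_emp_coeff_real [measurable]:
  "(\<lambda>w. emp_coeff_real v n (\<lambda>t. X t w)) \<in> borel_measurable P"
  unfolding emp_coeff_real_def sample_mean_def by measurable

lemma expectation_sq_error:
  assumes n: "1 \<le> n"
  shows "integrable P (\<lambda>w. sq_error f J n (\<lambda>t. X t w))"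
    and "P.expectation (\<lambda>w. sq_error f J n (\<lambda>t. X t w)) \<le> 2 ^ J * V / real n"
proof -
  obtain g where fm: "f \<in> borel_measurable unit_leb" using exp_classE[OF f] by blast
  have fc: "\<bar>\<rho> h\<bar> / (2 * pi) \<le> norm (fourier_cov f h)" for h
    by (rule abs_autocov_le_fourier_cov[OF spec fm P.\<rho>_even])
  note F = fourier_bound[OF f]
  have B1: "(\<Sum>h\<in>H. \<bar>\<rho> h\<bar> / (2 * pi)) \<le> B" if "finite H" for H
  proof -
    have "(\<Sum>h\<in>H. \<bar>\<rho> h\<bar> / (2 * pi)) \<le> (\<Sum>h\<in>H. norm (fourier_cov f h))" by (intro sum_mono fc)
    also have "\<dots> \<le> (\<Sum>\<^sub>\<infinity>h. norm (fourier_cov f h))"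
      using F that by (intro finite_sum_le_infsum) auto
    finally show ?thesis using F by linarith
  qed
  have B2: "(\<Sum>h\<in>H. \<bar>of_int h\<bar> * (\<rho> h / (2 * pi))\<^sup>2) \<le> B" if "finite H" for H
  proof -
    have "\<bar>of_int h\<bar> * (\<rho> h / (2 * pi))\<^sup>2 \<le> norm (of_int h * (fourier_cov f h)\<^sup>2)" for h
    proof -
      have "(\<bar>\<rho> h\<bar> / (2 * pi))\<^sup>2 \<le> (norm (fourier_cov f h))\<^sup>2" by (intro power_mono fc) auto
      then have "\<bar>of_int h\<bar> * (\<bar>\<rho> h\<bar> / (2 * pi))\<^sup>2 \<le> \<bar>of_int h\<bar> * (norm (fourier_cov f h))\<^sup>2"
        by (intro mult_left_mono) auto
      then show ?thesis by (simp add: norm_mult norm_power power_divide)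
    qed
    then have "(\<Sum>h\<in>H. \<bar>of_int h\<bar> * (\<rho> h / (2 * pi))\<^sup>2) \<le> (\<Sum>h\<in>H. norm (of_int h * (fourier_cov f h)\<^sup>2))"
      by (intro sum_mono)
    also have "\<dots> \<le> (\<Sum>\<^sub>\<infinity>h. norm (of_int h * (fourier_cov f h)\<^sup>2))"
      using F that by (intro finite_sum_le_infsum) auto
    finally show ?thesis using F by linarith
  qed
  have one: "integrable P (\<lambda>w. (emp_coeff_real (W i) n (\<lambda>t. X t w) - (\<integral>\<omega>. f \<omega> * W i \<omega> \<partial>unit_leb))\<^sup>2)"
    "P.expectation (\<lambda>w. (emp_coeff_real (W i) n (\<lambda>t. X t w) - (\<integral>\<omega>. f \<omega> * W i \<omega> \<partial>unit_leb))\<^sup>2) \<le> V / real n"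
    if i: "i \<in> trunc_index 0 J" for i
  proof -
    have WL: "W i \<in> L2_unit" by (rule W_trunc_L2[OF i])
    have "i \<in> full_index 0" using i trunc_index_subset by blast
    then have "ip (W i) (W i) = 1" using W_orthonormal by simp
    then have "(\<integral>x. (W i x)\<^sup>2 \<partial>unit_leb) = 1" by (simp add: ip_def power2_eq_square)
    then have c: "(\<Sum>h\<in>H. (cos_coef (W i) h)\<^sup>2) \<le> 1" if "finite H" for H
      using cos_coef_bessel[OF WL that] by simp
    note mse = P.empirical_mse[OF n c B1 B2 has_sum_spectral_inner[OF spec fm WL]]
    show "integrable P (\<lambda>w. (emp_coeff_real (W i) n (\<lambda>t. X t w) - (\<integral>\<omega>. f \<omega> * W i \<omega> \<partial>unit_leb))\<^sup>2)"
      using mse(1) by (simp add: emp_coeff_real_def P.Y_def)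
    show "P.expectation (\<lambda>w. (emp_coeff_real (W i) n (\<lambda>t. X t w) - (\<integral>\<omega>. f \<omega> * W i \<omega> \<partial>unit_leb))\<^sup>2) \<le> V / real n"
      using mse(2) by (simp add: emp_coeff_real_def P.Y_def V_def)
  qed
  show "integrable P (\<lambda>w. sq_error f J n (\<lambda>t. X t w))"
    unfolding sq_error_def by (intro Bochner_Integration.integrable_sum one(1))
  have "P.expectation (\<lambda>w. sq_error f J n (\<lambda>t. X t w)) = (\<Sum>i\<in>trunc_index 0 J.
      P.expectation (\<lambda>w. (emp_coeff_real (W i) n (\<lambda>t. X t w) - (\<integral>\<omega>. f \<omega> * W i \<omega> \<partial>unit_leb))\<^sup>2))"
    unfolding sq_error_def by (rule Bochner_Integration.integral_sum) (rule one(1))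
  also have "\<dots> \<le> (\<Sum>i\<in>trunc_index 0 J. V / real n)"
    by (intro sum_mono one(2))
  finally show "P.expectation (\<lambda>w. sq_error f J n (\<lambda>t. X t w)) \<le> 2 ^ J * V / real n"
    by (simp add: card_trunc_index)
qed

text \<open>Markov's inequality: the 2^J coefficients have total expected error at most n^(1/(2s+1))
  V / n, which is V n^(-r).\<close>

lemma sq_error_tail:
  assumes n: "1 \<le> n" and K: "0 < K"
  shows "P.prob {w \<in> space P. K < real n powr (2 * s / (2 * s + 1)) * sq_error f (level s n) n (\<lambda>t. X t w)} \<le> V / K"
proof -
  define r where "r = 2 * s / (2 * s + 1)"
  define u where "u = (\<lambda>w. real n powr r * sq_error f (level s n) n (\<lambda>t. X t w))"
  have n0: "0 < real n" using n by simp
  have u: "integrable P u" unfolding u_def using expectation_sq_error(1)[OF n] by simp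
  \<comment> \<open>The sign of \<open>V\<close> is needed below to replace 2^J by its upper bound;
    it is read off at J = 0, where the expected squared error is nonnegative and at most V /
    n.\<close>
  have "0 \<le> P.expectation (\<lambda>w. sq_error f 0 n (\<lambda>t. X t w))"
    by (simp add: sq_error_def sum_nonneg)
  also have "\<dots> \<le> V / real n" using expectation_sq_error(2)[OF n, of 0] by simp
  finally have V0: "0 \<le> V" using n0 by (simp add: zero_le_divide_iff)
  have "P.expectation u = real n powr r * P.expectation (\<lambda>w. sq_error f (level s n) n (\<lambda>t. X t w))"
    by (simp add: u_def)
  also have "\<dots> \<le> real n powr r * (2 ^ level s n * V / real n)"
    by (intro mult_left_mono expectation_sq_error(2)[OF n]) auto
  also have "\<dots> \<le> real n powr r * (real n powr (1 / (2 * s + 1)) * V / real n)"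
    using level_bounds(1)[of s n] s_gt n V0 by (intro mult_left_mono divide_right_mono mult_right_mono) auto
  also have "\<dots> = (real n powr r * real n powr (1 / (2 * s + 1))) * V / real n" by simp
  also have "real n powr r * real n powr (1 / (2 * s + 1)) = real n"
  proof -
    have "r + 1 / (2 * s + 1) = 1" using s_gt by (simp add: r_def field_simps)
    then show ?thesis using n0 by (simp flip: powr_add)
  qed
  finally have Eu: "P.expectation u \<le> V" using n0 by simp
  have "{w \<in> space P. K \<le> u w} \<in> sets P"
    using borel_measurable_integrable[OF u] by measurable
  then have "P.prob {w \<in> space P. K < u w} \<le> P.prob {w \<in> space P. K \<le> u w}"
    by (intro P.finite_measure_mono) auto
  also have "\<dots> \<le> P.expectation u / K"
    by (rule integral_Markov_inequality_measure[OF u, of "{}"]) (use K in \<open>auto simp: u_def sq_error_def sum_nonneg\<close>)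
  also have "\<dots> \<le> V / K" using Eu K by (simp add: divide_right_mono)
  finally show ?thesis by (simp add: u_def r_def)
qed

text \<open>The definition of \<open>V\<close> does not show its sign, but
  \<open>sq_error_tail\<close> at n = K = 1 places a probability below it.\<close>

lemma V_nonneg: "0 \<le> V"
proof -
  have "0 \<le> P.prob {w \<in> space P. 1 < real 1 powr (2 * s / (2 * s + 1)) * sq_error f (level s 1) 1 (\<lambda>t. X t w)}"
    by simp
  also have "\<dots> \<le> V / 1" by (rule sq_error_tail) auto
  finally show ?thesis by simp
qed

lemma estimator_exists_sets:
  "{w \<in> space P. estimator_exists \<phi> \<psi> s n (\<lambda>t. X t w)} \<in> sets P"
  unfolding estimator_exists_def solves_projection_iff
  by (rule F.measurable_coef_range) (rule measurable_emp_coeff_real)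

lemma measurable_sq_error [measurable]: "(\<lambda>w. sq_error f J n (\<lambda>t. X t w)) \<in> borel_measurable P"
  unfolding sq_error_def by measurable

text \<open>Nonexistence of the estimator and a large loss both lie in the tail event of the squared
  error. The second part is stated for all larger thresholds, since the final limit lets the
  threshold grow.\<close>

lemma good_probability:
  assumes n: "1 \<le> n" and K: "0 < K"
    and good: "\<And>x. real n powr (2 * s / (2 * s + 1)) * sq_error f (level s n) n x \<le> K \<Longrightarrow>
      estimator_exists \<phi> \<psi> s n x \<and> \<not> loss_exceeds \<phi> \<psi> s f n K' x"
  shows "1 - V / K \<le> P.prob {w \<in> space P. estimator_exists \<phi> \<psi> s n (\<lambda>t. X t w)}"
    and "K' \<le> K'' \<Longrightarrow> emeasure P {w \<in> space P. loss_exceeds \<phi> \<psi> s f n K'' (\<lambda>t. X t w)} \<le> ennreal (V / K)"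
proof -
  let ?E = "{w \<in> space P. estimator_exists \<phi> \<psi> s n (\<lambda>t. X t w)}"
  let ?T = "{w \<in> space P. K < real n powr (2 * s / (2 * s + 1)) * sq_error f (level s n) n (\<lambda>t. X t w)}"
  note T = sq_error_tail[OF n K]
  have Ts: "?T \<in> sets P" by measurable
  have "space P - ?E \<subseteq> ?T" using good by (auto simp: not_le[symmetric])
  then have "P.prob (space P - ?E) \<le> P.prob ?T" by (intro P.finite_measure_mono Ts)
  then show "1 - V / K \<le> P.prob ?E"
    using T P.prob_compl[OF estimator_exists_sets] by simp
  assume KK: "K' \<le> K''"
  have "{w \<in> space P. loss_exceeds \<phi> \<psi> s f n K'' (\<lambda>t. X t w)} \<subseteq> ?T"
  proof (intro subsetI, rule ccontr)
    fix w assume w: "w \<in> {w \<in> space P. loss_exceeds \<phi> \<psi> s f n K'' (\<lambda>t. X t w)}" and "w \<notin> ?T"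
    then have "\<not> loss_exceeds \<phi> \<psi> s f n K' (\<lambda>t. X t w)" using good by auto
    moreover have "loss_exceeds \<phi> \<psi> s f n K' (\<lambda>t. X t w)"
      using w KK unfolding loss_exceeds_def by (auto intro: le_less_trans)
    ultimately show False by simp
  qed
  \<comment> \<open>Monotonicity of the measure asks measurability of the larger set
    \<open>?T\<close> only.\<close>
  then have "emeasure P {w \<in> space P. loss_exceeds \<phi> \<psi> s f n K'' (\<lambda>t. X t w)} \<le> emeasure P ?T"
    by (rule emeasure_mono[OF _ Ts])
  also have "\<dots> \<le> ennreal (V / K)" using T by (simp add: P.emeasure_eq_measure ennreal_leI)
  finally show "emeasure P {w \<in> space P. loss_exceeds \<phi> \<psi> s f n K'' (\<lambda>t. X t w)} \<le> ennreal (V / K)" .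
qed

end

text \<open>Stated for an arbitrary sample space, so that it serves both the given process and, with
  the coordinate process, all laws on path space.\<close>

lemma uniform_tail:
  assumes K: "0 < K"
  obtains K' where
    "\<forall>\<^sub>F n in sequentially. \<forall>f\<in>S. \<forall>P X \<rho>. stationary_gaussian (P :: 'w measure) X \<rho> \<longrightarrow> spectral_density \<rho> f \<longrightarrow>
      1 - V / K \<le> measure P {w \<in> space P. estimator_exists \<phi> \<psi> s n (\<lambda>t. X t w)} \<and>
      (\<forall>K''\<ge>K'. emeasure P {w \<in> space P. loss_exceeds \<phi> \<psi> s f n K'' (\<lambda>t. X t w)} \<le> ennreal (V / K))"
proof -
  obtain K' where ev: "\<forall>\<^sub>F n in sequentially. \<forall>g f x. besov_ball s M g \<longrightarrow> (\<forall>t\<in>{0..1}. f t = exp (g t)) \<longrightarrow>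
    real n powr (2 * s / (2 * s + 1)) * sq_error f (level s n) n x \<le> K \<longrightarrow>
    estimator_exists \<phi> \<psi> s n x \<and> \<not> loss_exceeds \<phi> \<psi> s f n K' x"
    using sq_error_implies_good[OF s_gt M_pos less_imp_le[OF K]] by blast
  show thesis
  proof (rule that[of K'], use ev eventually_ge_at_top[of 1] in eventually_elim, intro ballI allI impI conjI)
    fix n f and P :: "'w measure" and X \<rho> 
    assume good: "\<forall>g f x. besov_ball s M g \<longrightarrow> (\<forall>t\<in>{0..1}. f t = exp (g t)) \<longrightarrow>
      real n powr (2 * s / (2 * s + 1)) * sq_error f (level s n) n x \<le> K \<longrightarrow>
      estimator_exists \<phi> \<psi> s n x \<and> \<not> loss_exceeds \<phi> \<psi> s f n K' x"
      and n: "1 \<le> n" and f: "f \<in> S" and stat: "stationary_gaussian P X \<rho>" and spec: "spectral_density \<rho> f"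
    obtain g where g: "besov_ball s M g" "\<forall>t\<in>{0..1}. f t = exp (g t)" using exp_classE[OF f] by blast
    have good': "estimator_exists \<phi> \<psi> s n x \<and> \<not> loss_exceeds \<phi> \<psi> s f n K' x"
      if "real n powr (2 * s / (2 * s + 1)) * sq_error f (level s n) n x \<le> K" for x
      using good g that by blast
    show "1 - V / K \<le> measure P {w \<in> space P. estimator_exists \<phi> \<psi> s n (\<lambda>t. X t w)}"
      by (rule good_probability(1)[OF f stat spec n K good'])
    fix K'' assume "K' \<le> K''"
    then show "emeasure P {w \<in> space P. loss_exceeds \<phi> \<psi> s f n K'' (\<lambda>t. X t w)} \<le> ennreal (V / K)"
      by (intro good_probability(2)[OF f stat spec n K good'])
  qed
qed

end

theorem theorem2p5:
  fixes \<phi> \<psi> f :: "real \<Rightarrow> real" and m :: nat and M s :: real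
    and P :: "'w measure" and X :: "nat \<Rightarrow> 'w \<Rightarrow> real" and \<rho> :: "int \<Rightarrow> real"
  assumes "wavelet_system \<phi> \<psi> m"
    and "M > 0" and "s > 1/2" and "s < real m"
    and "stationary_gaussian P X \<rho>"
    and "covariance_conditions \<rho>"
    and "uniform_covariance_bound (exp_class \<phi> \<psi> s 2 2 M)"
    and "spectral_density \<rho> f"
    and "f \<in> exp_class \<phi> \<psi> s 2 2 M"
  shows "((\<lambda>n. measure P {w \<in> space P. estimator_exists \<phi> \<psi> s n (\<lambda>t. X t w)}) \<longlonglongrightarrow> 1) \<and>
    (\<forall>\<epsilon>>0. \<exists>K. \<forall>\<^sub>F n in sequentially.
       measure P {w \<in> space P. loss_exceeds \<phi> \<psi> s f n K (\<lambda>t. X t w)} < \<epsilon>) \<and>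
    ((\<lambda>K. limsup (\<lambda>n. SUP (f, Q) \<in> Sigma (exp_class \<phi> \<psi> s 2 2 M) process_laws.
       emeasure Q {x \<in> space Q. loss_exceeds \<phi> \<psi> s f n K x})) \<longlongrightarrow> 0) at_top"
proof -
  obtain A where "wavelet_basis \<phi> \<psi> A" using wavelet_system_basis[OF assms(1)] by blast
  then interpret wavelet_basis \<phi> \<psi> A .
  obtain B where B: "\<forall>f\<in>exp_class \<phi> \<psi> s 2 2 M.
      (\<lambda>h. norm (fourier_cov f h)) summable_on UNIV \<and> (\<Sum>\<^sub>\<infinity>h. norm (fourier_cov f h)) \<le> B \<and>
      (\<lambda>h. norm (of_int h * (fourier_cov f h)\<^sup>2)) summable_on UNIV \<and>
      (\<Sum>\<^sub>\<infinity>h. norm (of_int h * (fourier_cov f h)\<^sup>2)) \<le> B"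
    using assms(7) unfolding uniform_covariance_bound_def by blast
  interpret regular_spectral_class \<phi> \<psi> A s M B
    using assms(2,3) B by unfold_locales auto
  interpret P: prob_space P
    using assms(5) by (simp add: stationary_gaussian_def gaussian_sequence_def)
  note V0 = V_nonneg[OF assms(9,5,8)]
  \<comment> \<open>The threshold (V + 1) / \<epsilon> makes the tail bound V / K smaller than
    \<epsilon>; the added 1 keeps it positive when V = 0.\<close>
  have K: "0 < (V + 1) / \<epsilon>" "V / ((V + 1) / \<epsilon>) < \<epsilon>" if "0 < \<epsilon>" for \<epsilon> :: real
    using that V0 by (simp_all add: field_simps)
  have "(\<lambda>n. measure P {w \<in> space P. estimator_exists \<phi> \<psi> s n (\<lambda>t. X t w)}) \<longlonglongrightarrow> 1"
  proof (rule order_tendstoI)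
    fix a :: real assume "1 < a"
    then show "\<forall>\<^sub>F n in sequentially. measure P {w \<in> space P. estimator_exists \<phi> \<psi> s n (\<lambda>t. X t w)} < a"
      by (intro always_eventually allI le_less_trans[OF P.prob_le_1])
  next
    fix a :: real assume "a < 1"
    then have a: "0 < 1 - a" by simp
    obtain K' where "\<forall>\<^sub>F n in sequentially. \<forall>f\<in>S. \<forall>P X \<rho>. stationary_gaussian (P :: 'w measure) X \<rho> \<longrightarrow> spectral_density \<rho> f \<longrightarrow>
      1 - V / ((V + 1) / (1 - a)) \<le> measure P {w \<in> space P. estimator_exists \<phi> \<psi> s n (\<lambda>t. X t w)} \<and>
      (\<forall>K''\<ge>K'. emeasure P {w \<in> space P. loss_exceeds \<phi> \<psi> s f n K'' (\<lambda>t. X t w)} \<le> ennreal (V / ((V + 1) / (1 - a))))"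
      using uniform_tail[OF K(1)[OF a]] by blast
    then show "\<forall>\<^sub>F n in sequentially. a < measure P {w \<in> space P. estimator_exists \<phi> \<psi> s n (\<lambda>t. X t w)}"
    proof eventually_elim
      case (elim n)
      then have "1 - V / ((V + 1) / (1 - a)) \<le> measure P {w \<in> space P. estimator_exists \<phi> \<psi> s n (\<lambda>t. X t w)}"
        using assms(5,8,9) by blast
      then show ?case using K(2)[OF a] by linarith
    qed
  qed
  moreover have "\<exists>K. \<forall>\<^sub>F n in sequentially. measure P {w \<in> space P. loss_exceeds \<phi> \<psi> s f n K (\<lambda>t. X t w)} < \<epsilon>"
    if \<epsilon>: "0 < \<epsilon>" for \<epsilon>
  proof -
    obtain K' where "\<forall>\<^sub>F n in sequentially. \<forall>f\<in>S. \<forall>P X \<rho>. stationary_gaussian (P :: 'w measure) X \<rho> \<longrightarrow> spectral_density \<rho> f \<longrightarrow>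
      1 - V / ((V + 1) / \<epsilon>) \<le> measure P {w \<in> space P. estimator_exists \<phi> \<psi> s n (\<lambda>t. X t w)} \<and>
      (\<forall>K''\<ge>K'. emeasure P {w \<in> space P. loss_exceeds \<phi> \<psi> s f n K'' (\<lambda>t. X t w)} \<le> ennreal (V / ((V + 1) / \<epsilon>)))"
      using uniform_tail[OF K(1)[OF \<epsilon>]] by blast
    then have "\<forall>\<^sub>F n in sequentially. measure P {w \<in> space P. loss_exceeds \<phi> \<psi> s f n K' (\<lambda>t. X t w)} < \<epsilon>"
    proof eventually_elim
      case (elim n)
      then have "emeasure P {w \<in> space P. loss_exceeds \<phi> \<psi> s f n K' (\<lambda>t. X t w)} \<le> ennreal (V / ((V + 1) / \<epsilon>))"
        using assms(5,8,9) by blast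
      then have "measure P {w \<in> space P. loss_exceeds \<phi> \<psi> s f n K' (\<lambda>t. X t w)} \<le> V / ((V + 1) / \<epsilon>)"
        using V0 \<epsilon> by (simp add: P.emeasure_eq_measure)
      then show ?case using K(2)[OF \<epsilon>] by linarith
    qed
    then show ?thesis by blast
  qed
  moreover have "((\<lambda>K. limsup (\<lambda>n. SUP (f, Q) \<in> Sigma S process_laws.
       emeasure Q {x \<in> space Q. loss_exceeds \<phi> \<psi> s f n K x})) \<longlongrightarrow> 0) at_top"
  proof (rule order_tendstoI)
    fix a :: ennreal assume "0 < a"
    \<comment> \<open>\<open>a\<close> may be infinite. A value strictly between 0 and
      \<open>a\<close> is finite, hence a real \<epsilon> for \<open>uniform_tail\<close>, and it
      leaves room for the strict inequality after the limsup.\<close>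
    then obtain e' where e': "0 < e'" "e' < a" using dense by blast
    then obtain e where e: "e' = ennreal e" "0 < e"
      by (cases e') auto
    obtain K' where ev: "\<forall>\<^sub>F n in sequentially. \<forall>f\<in>S. \<forall>P X \<rho>. stationary_gaussian (P :: (nat \<Rightarrow> real) measure) X \<rho> \<longrightarrow> spectral_density \<rho> f \<longrightarrow>
      1 - V / ((V + 1) / e) \<le> measure P {w \<in> space P. estimator_exists \<phi> \<psi> s n (\<lambda>t. X t w)} \<and>
      (\<forall>K''\<ge>K'. emeasure P {w \<in> space P. loss_exceeds \<phi> \<psi> s f n K'' (\<lambda>t. X t w)} \<le> ennreal (V / ((V + 1) / e)))"
      using uniform_tail[OF K(1)[OF e(2)]] by blast
    have "limsup (\<lambda>n. SUP (f, Q) \<in> Sigma S process_laws. emeasure Q {x \<in> space Q. loss_exceeds \<phi> \<psi> s f n K'' x}) < a"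
      if K'': "K' \<le> K''" for K''
    proof -
      have "limsup (\<lambda>n. SUP (f, Q) \<in> Sigma S process_laws. emeasure Q {x \<in> space Q. loss_exceeds \<phi> \<psi> s f n K'' x}) \<le> e'"
      proof (rule Limsup_bounded)
        show "\<forall>\<^sub>F n in sequentially. (SUP (f, Q) \<in> Sigma S process_laws. emeasure Q {x \<in> space Q. loss_exceeds \<phi> \<psi> s f n K'' x}) \<le> e'"
          using ev
        proof eventually_elim
          case (elim n)
          show ?case
          proof (rule SUP_least, clarify)
            fix f Q assume f: "f \<in> S" and Q: "Q \<in> process_laws f"
            then obtain \<rho> where "stationary_gaussian Q (\<lambda>t x. x t) \<rho>" "spectral_density \<rho> f"
              by (auto simp: process_laws_def)
            with elim f K'' have "emeasure Q {x \<in> space Q. loss_exceeds \<phi> \<psi> s f n K'' (\<lambda>t. x t)} \<le> ennreal (V / ((V + 1) / e))"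
              by blast
            also have "\<dots> \<le> e'" unfolding e(1) using K(2)[OF e(2)] by (intro ennreal_leI) simp
            finally show "emeasure Q {x \<in> space Q. loss_exceeds \<phi> \<psi> s f n K'' x} \<le> e'" by simp
          qed
        qed
      qed
      then show ?thesis using e'(2) by simp
    qed
    then show "\<forall>\<^sub>F K in at_top. limsup (\<lambda>n. SUP (f, Q) \<in> Sigma S process_laws. emeasure Q {x \<in> space Q. loss_exceeds \<phi> \<psi> s f n K x}) < a"
      unfolding eventually_at_top_linorder by blast
  qed simp
  ultimately show ?thesis by blast
qed

end
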